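(* Let $d\ge2$ be an integer. If $\mathcal{HCS}_d=\{1-d,\frac{1}{1-d}\}$ then, up to automorphisms of $\mathbb{P}^2_{\mathbb{C}}$, the Fermat foliation $\mathcal{F}_0^d$ is the unique reduced convex foliation of degree $d$ on $\mathbb{P}^2_{\mathbb{C}}$.
   Context: Foliations on $\mathbb{P}^2_{\mathbb{C}}$ are holomorphic, with isolated singularities. The degree of a foliation is the number of tangencies (with multiplicity) with a generic line. The Fermat foliation $\mathcal{F}_0^d$ is the foliation of degree $d$ on $\mathbb{P}^2_{\mathbb{C}}$ defined in an affine chart by $(x^d-x)\,\mathrm{d}y-(y^d-y)\,\mathrm{d}x$. Convexity: a foliation on $\mathbb{P}^2_{\mathbb{C}}$ is convex if its leaves other than straight lines have no inflection points. A foliation of degree $d\ge1$ has at most $3d$ distinct invariant lines, and if this bound is reached it is convex; a foliation of degree $d$ having exactly $3d$ distinct invariant lines is called reduced convex. Homogeneous foliations: a foliation $\mathcal{H}$ of degree $d$ is homogeneous if, for a suitable choice of affine coordinates $(x,y)$, it is given by $A(x,y)\,\mathrm{d}x+B(x,y)\,\mathrm{d}y$ with $A,B$ homogeneous polynomials of degree $d$ and $\gcd(A,B)=1$; $\ell_\infty$ denotes the line at infinity of this affine chart (it is invariant by $\mathcal{H}$). Camacho–Sad index: if $\ell$ is a line invariant by a foliation $\mathcal{F}$ and $s\in\ell$ a singular point, choose local coordinates $(u,v)$ centered at $s$ with $\ell=\{v=0\}$ and a local vector field $P(u,v)\partial_u+vQ(u,v)\partial_v$ with isolated zero defining $\mathcal{F}$;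 then $\mathrm{CS}(\mathcal{F},\ell,s)=\mathrm{Res}_{u=0}\frac{Q(u,0)}{P(u,0)}\,\mathrm{d}u$. $\mathcal{HCS}_d$ is the set of $\lambda\in\mathbb{C}\setminus\{0,1\}$ for which there exist two homogeneous convex foliations $\mathcal{H}$ and $\mathcal{H}'$ of degree $d$ on $\mathbb{P}^2_{\mathbb{C}}$ having respective singular points $s$ and $s'$ on the line at infinity $\ell_\infty$ such that $\mathrm{CS}(\mathcal{H},\ell_\infty,s)=\lambda$ and $\mathrm{CS}(\mathcal{H}',\ell_\infty,s')=\frac1\lambda$. *)

theory Defs
  imports "HOL-Complex_Analysis.Complex_Analysis" "HOL-Computational_Algebra.Computational_Algebra"
begin

text \<open>
  The complex projective plane is handled through homogeneous coordinates in \<^typ>\<open>complex^3\<close>: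
  points are the one-dimensional, lines the two-dimensional complex subspaces. Covectors are also
  elements of \<^typ>\<open>complex^3\<close>, paired with vectors by the complex bilinear form below (the inner
  product of the library is only real bilinear).
\<close>

definition pairing :: "complex^3 \<Rightarrow> complex^3 \<Rightarrow> complex" where
  "pairing a v = (\<Sum>i\<in>UNIV. a $ i * v $ i)"

definition basis3 :: "complex^3 \<Rightarrow> complex^3 \<Rightarrow> complex^3 \<Rightarrow> bool" where
  "basis3 b e f \<longleftrightarrow> det (vector [b, e, f] :: complex^3^3) \<noteq> 0"

definition point :: "complex^3 \<Rightarrow> (complex^3) set" where
  "point p = vec.span {p}"

definition line :: "complex^3 \<Rightarrow> (complex^3) set" where
  "line l = {p. pairing l p = 0}"

definition homogeneous3 :: "nat \<Rightarrow> (complex^3 \<Rightarrow> complex) \<Rightarrow> bool" where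
  "homogeneous3 n F \<longleftrightarrow> (\<exists>c. \<forall>p. F p =
     (\<Sum>(i, j, k) \<in> {(i, j, k). i + j + k = n}. c i j k * (p $ 1) ^ i * (p $ 2) ^ j * (p $ 3) ^ k))"


subsection \<open>Foliations\<close>

text \<open>
  Every holomorphic foliation of the plane with isolated singularities is algebraic: it
  is given by a homogeneous polynomial 1-form \<open>\<omega> = \<omega>\<^sub>1 dx + \<omega>\<^sub>2 dy + \<omega>\<^sub>3 dz\<close> annihilated by
  the radial field and with finite singular set in the plane (which is compact, so that this means
  isolated singularities). Two such forms define the same foliation iff they are proportional by a
  nonzero constant; all notions below are invariant under such a rescaling.
\<close>

definition foliation :: "(complex^3 \<Rightarrow> complex^3) \<Rightarrow> bool" where
  "foliation \<omega> \<longleftrightarrow>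
     (\<exists>n. \<forall>i. homogeneous3 n (\<lambda>p. \<omega> p $ i)) \<and>
     (\<forall>p. pairing (\<omega> p) p = 0) \<and>
     finite {point p | p. p \<noteq> 0 \<and> \<omega> p = 0}"

text \<open>
  The order of tangency with a line at one of its points \<open>[p]\<close>: for another point \<open>[v]\<close> of the line,
  it is the order at \<open>t = 0\<close> of the restriction of \<open>\<omega>\<close> to the parametrized line \<open>t \<mapsto> [p + t v]\<close>.
  It does not depend on \<open>p\<close> and \<open>v\<close>. It is meaningful for non-invariant lines only.
\<close>

definition tangency_order ::
  "(complex^3 \<Rightarrow> complex^3) \<Rightarrow> (complex^3) set \<Rightarrow> (complex^3) set \<Rightarrow> nat" where
  "tangency_order \<omega> L P = (THE n. \<exists>p v. p \<noteq> 0 \<and> P = point p \<and> L = vec.span {p, v} \<and>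
     int n = zorder (\<lambda>t. pairing (\<omega> (p + t *s v)) v) 0)"

definition tangency_points ::
  "(complex^3 \<Rightarrow> complex^3) \<Rightarrow> (complex^3) set \<Rightarrow> (complex^3) set set" where
  "tangency_points \<omega> L = {point p | p. p \<in> L \<and> p \<noteq> 0 \<and> (\<forall>v\<in>L. pairing (\<omega> p) v = 0)}"

definition tangency_number :: "(complex^3 \<Rightarrow> complex^3) \<Rightarrow> (complex^3) set \<Rightarrow> nat" where
  "tangency_number \<omega> L = (\<Sum>P \<in> tangency_points \<omega> L. tangency_order \<omega> L P)"

text \<open>A generic line is one outside some proper algebraic subset of the dual plane.\<close>

definition has_degree :: "(complex^3 \<Rightarrow> complex^3) \<Rightarrow> nat \<Rightarrow> bool" where
  "has_degree \<omega> d \<longleftrightarrow> (\<exists>m G. homogeneous3 m G \<and> (\<exists>l. l \<noteq> 0 \<and> G l \<noteq> 0) \<and>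
     (\<forall>l. l \<noteq> 0 \<and> G l \<noteq> 0 \<longrightarrow> finite (tangency_points \<omega> (line l)) \<and> tangency_number \<omega> (line l) = d))"

definition invariant_line :: "(complex^3 \<Rightarrow> complex^3) \<Rightarrow> (complex^3) set \<Rightarrow> bool" where
  "invariant_line \<omega> L \<longleftrightarrow> (\<exists>l. l \<noteq> 0 \<and> L = line l) \<and> (\<forall>p\<in>L. \<forall>v\<in>L. pairing (\<omega> p) v = 0)"

definition reduced_convex :: "nat \<Rightarrow> (complex^3 \<Rightarrow> complex^3) \<Rightarrow> bool" where
  "reduced_convex d \<omega> \<longleftrightarrow>
     foliation \<omega> \<and> has_degree \<omega> d \<and> card {L. invariant_line \<omega> L} = 3 * d"

text \<open>Equality of the foliations \<open>\<eta>\<close> and \<open>M\<^sup>*\<omega>\<close> for an automorphism of the plane given by \<open>M\<close>.\<close>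

definition proj_equivalent ::
  "(complex^3 \<Rightarrow> complex^3) \<Rightarrow> (complex^3 \<Rightarrow> complex^3) \<Rightarrow> bool" where
  "proj_equivalent \<omega> \<eta> \<longleftrightarrow> (\<exists>(M :: complex^3^3) c. invertible M \<and> c \<noteq> 0 \<and>
     (\<forall>p v. pairing (\<eta> p) v = c * pairing (\<omega> (M *v p)) (M *v v)))"


subsection \<open>Convexity\<close>

definition vderiv :: "(complex \<Rightarrow> complex^3) \<Rightarrow> complex \<Rightarrow> complex^3" where
  "vderiv \<gamma> t = (\<chi> i. deriv (\<lambda>s. \<gamma> s $ i) t)"

text \<open>
  \<open>\<gamma>\<close> is a (lift to \<^typ>\<open>complex^3\<close> of a) holomorphic immersion of a disc into a leaf. Independence of
  \<open>\<gamma>(t)\<close> and \<open>\<gamma>'(t)\<close> expresses that the curve \<open>[\<gamma>]\<close> in the plane is immersed.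
\<close>

definition leaf_param :: "(complex^3 \<Rightarrow> complex^3) \<Rightarrow> real \<Rightarrow> (complex \<Rightarrow> complex^3) \<Rightarrow> bool" where
  "leaf_param \<omega> r \<gamma> \<longleftrightarrow> r > 0 \<and> (\<forall>i. (\<lambda>t. \<gamma> t $ i) holomorphic_on ball 0 r) \<and>
     (\<forall>t\<in>ball 0 r. \<gamma> t \<noteq> 0 \<and> vderiv \<gamma> t \<notin> vec.span {\<gamma> t} \<and>
        \<omega> (\<gamma> t) \<noteq> 0 \<and> pairing (\<omega> (\<gamma> t)) (vderiv \<gamma> t) = 0)"

text \<open>
  \<open>[\<gamma>(0)]\<close> is an inflection point iff the lifted curve has vanishing Wronskian there. A leaf is
  contained in a straight line as soon as a piece of it is.
\<close>

definition convex_foliation :: "(complex^3 \<Rightarrow> complex^3) \<Rightarrow> bool" where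
  "convex_foliation \<omega> \<longleftrightarrow> (\<forall>r \<gamma>. leaf_param \<omega> r \<gamma> \<and>
     det (vector [\<gamma> 0, vderiv \<gamma> 0, vderiv (vderiv \<gamma>) 0] :: complex^3^3) = 0 \<longrightarrow>
     (\<exists>l. l \<noteq> 0 \<and> \<gamma> ` ball 0 r \<subseteq> line l))"


subsection \<open>Affine charts, homogeneous foliations and the Fermat foliation\<close>

text \<open>
  A basis \<open>(b, e, f)\<close> yields the affine chart \<open>(x, y) \<mapsto> [b + x e + y f]\<close>, with line at infinity
  spanned by \<open>e\<close> and \<open>f\<close>. The foliation is given there by the form \<open>A dx + B dy\<close>.
\<close>

definition given_in_chart :: "(complex^3 \<Rightarrow> complex^3) \<Rightarrow> complex^3 \<Rightarrow> complex^3 \<Rightarrow> complex^3 \<Rightarrow>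
    (complex \<Rightarrow> complex \<Rightarrow> complex) \<Rightarrow> (complex \<Rightarrow> complex \<Rightarrow> complex) \<Rightarrow> bool" where
  "given_in_chart \<omega> b e f A B \<longleftrightarrow> basis3 b e f \<and> (\<exists>c. c \<noteq> 0 \<and>
     (\<forall>x y. pairing (\<omega> (b + x *s e + y *s f)) e = c * A x y \<and>
            pairing (\<omega> (b + x *s e + y *s f)) f = c * B x y))"

text \<open>In \<^typ>\<open>complex poly poly\<close> the outer variable is \<open>y\<close> and the inner one is \<open>x\<close>.\<close>

definition poly2 :: "complex poly poly \<Rightarrow> complex \<Rightarrow> complex \<Rightarrow> complex" where
  "poly2 A x y = poly (poly A [:y:]) x"

definition homogeneous_poly2 :: "nat \<Rightarrow> complex poly poly \<Rightarrow> bool" where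
  "homogeneous_poly2 n A \<longleftrightarrow> (\<forall>i j. coeff (coeff A j) i \<noteq> 0 \<longrightarrow> i + j = n)"

definition homogeneous_foliation ::
  "nat \<Rightarrow> (complex^3 \<Rightarrow> complex^3) \<Rightarrow> complex^3 \<Rightarrow> complex^3 \<Rightarrow> complex^3 \<Rightarrow> bool" where
  "homogeneous_foliation d \<omega> b e f \<longleftrightarrow> foliation \<omega> \<and> has_degree \<omega> d \<and>
     (\<exists>A B. homogeneous_poly2 d A \<and> homogeneous_poly2 d B \<and> coprime A B \<and>
            given_in_chart \<omega> b e f (poly2 A) (poly2 B))"

text \<open>The homogenization of \<open>(x\<^sup>d - x) dy - (y\<^sup>d - y) dx\<close>; see the lemma below.\<close>

definition fermat_foliation :: "nat \<Rightarrow> complex^3 \<Rightarrow> complex^3" where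
  "fermat_foliation d p = (let x = p $ 1; y = p $ 2; z = p $ 3 in
     vector [- z * (y ^ d - y * z ^ (d - 1)), z * (x ^ d - x * z ^ (d - 1)), x * y ^ d - y * x ^ d])"

lemma fermat_foliation_in_chart:
  "given_in_chart (fermat_foliation d) (axis 3 1) (axis 1 1) (axis 2 1)
     (\<lambda>x y. - (y ^ d - y)) (\<lambda>x y. x ^ d - x)"
  unfolding given_in_chart_def
proof
  show "basis3 (axis 3 1) (axis 1 1) (axis 2 1)"
    by (simp add: basis3_def det_3 axis_def)
  show "\<exists>c. c \<noteq> 0 \<and> (\<forall>x y.
      pairing (fermat_foliation d (axis 3 1 + x *s axis 1 1 + y *s axis 2 1)) (axis 1 1) =
        c * (- (y ^ d - y)) \<and>
      pairing (fermat_foliation d (axis 3 1 + x *s axis 1 1 + y *s axis 2 1)) (axis 2 1) =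
        c * (x ^ d - x))"
    by (rule exI[of _ 1]) (simp add: pairing_def fermat_foliation_def sum_3 axis_def Let_def)
qed


subsection \<open>Camacho--Sad indices\<close>

text \<open>
  Let \<open>L\<close> be an invariant line, \<open>[p]\<close> a singular point on it, \<open>[e]\<close> another point of \<open>L\<close> and \<open>f\<close> a
  vector outside \<open>L\<close>. In the local coordinates \<open>(u, v) \<mapsto> [p + u e + v f]\<close>, for which \<open>L = {v = 0}\<close>,
  the foliation is given by \<open>a du + b dv\<close> with \<open>a = \<omega>(p + u e + v f)(e)\<close> and
  \<open>b = \<omega>(p + u e + v f)(f)\<close>, hence by the field \<open>P \<partial>\<^sub>u + v Q \<partial>\<^sub>v\<close> with \<open>P = b\<close> and \<open>v Q = - a\<close>; in
  particular \<open>Q(u, 0) = - \<partial>a/\<partial>v (u, 0)\<close>. The resulting residue does not depend on \<open>p\<close>, \<open>e\<close>, \<open>f\<close>.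
\<close>

definition has_CS_index ::
  "(complex^3 \<Rightarrow> complex^3) \<Rightarrow> (complex^3) set \<Rightarrow> (complex^3) set \<Rightarrow> complex \<Rightarrow> bool" where
  "has_CS_index \<omega> L s \<mu> \<longleftrightarrow> invariant_line \<omega> L \<and>
     (\<exists>p e f. s = point p \<and> \<omega> p = 0 \<and> L = vec.span {p, e} \<and> basis3 p e f \<and>
       (let P = (\<lambda>u v. pairing (\<omega> (p + u *s e + v *s f)) f);
            Q\<^sub>0 = (\<lambda>u. - deriv (\<lambda>v. pairing (\<omega> (p + u *s e + v *s f)) e) 0)
        in \<mu> = residue (\<lambda>u. Q\<^sub>0 u / P u 0) 0))"

text \<open>
  The values \<open>CS(\<H>, \<ell>\<^sub>\<infinity>, s)\<close> for \<open>\<H>\<close> a homogeneous convex foliation of degree \<open>d\<close> and \<open>s\<close> a singular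
  point on \<open>\<ell>\<^sub>\<infinity>\<close>.
\<close>

definition hom_convex_CS_values :: "nat \<Rightarrow> complex set" where
  "hom_convex_CS_values d = {\<mu>. \<exists>\<omega> b e f s. homogeneous_foliation d \<omega> b e f \<and>
     convex_foliation \<omega> \<and> has_CS_index \<omega> (vec.span {e, f}) s \<mu>}"

definition HCS :: "nat \<Rightarrow> complex set" where
  "HCS d = {\<mu>. \<mu> \<noteq> 0 \<and> \<mu> \<noteq> 1 \<and> \<mu> \<in> hom_convex_CS_values d \<and> 1 / \<mu> \<in> hom_convex_CS_values d}"

end

theory Submission
  imports Defs
begin

text \<open>
  Fix an invariant line \<open>\<ell>\<close> of a reduced convex foliation of degree \<open>d\<close>, in coordinates where it is
  \<open>z = 0\<close>. The inflection polynomial of the foliation has degree \<open>3d - 1\<close> in this chart and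
  vanishes on the \<open>3d - 1\<close> other invariant lines, so it is a constant times the product of their
  equations, and the constant is nonzero since otherwise the leaf through a general point would be
  a further invariant line. Hence the inflection polynomial of the homogeneous foliation given by the
  top degree part is the product of the directions of these lines. This homogeneous foliation is therefore
  convex, and counting orders of vanishing shows that \<open>\<ell>\<close> carries exactly \<open>d + 1\<close> singular points, all
  with nonzero index, and that exactly one other invariant line passes through those whose index
  is not \<open>1\<close>. There the indices along the two lines are mutually inverse, so they belong to
  \<open>HCS d\<close>. As the indices along \<open>\<ell>\<close> add up to \<open>1\<close>, a line with an index \<open>1 / (1 - d)\<close>, and one exists, has
  \<open>d - 1\<close> points of this index and two others, and through each of those two pass \<open>d\<close> lines besides \<open>\<ell>\<close>.
  Placing these two points on the coordinate axes at infinity separates the variables, and the remaining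
  \<open>d - 1\<close> invariant lines determine the foliation.
\<close>

text \<open>The hypothesis constrains homogeneous foliations only. It reaches an arbitrary reduced
  convex foliation because, on the chosen invariant line, the inflection polynomial involves nothing
  but the top degree part of the form, and there it splits as a Wronskian times the tangent cone.
  The multiplicity of a root r of the cone in this product is the number k of other invariant lines
  through the singular point r; on the other hand (x - r)^k divides the equation of the tangencies
  with the direction r. Comparing these two facts excludes every degeneration: the cone has simple
  roots, k lies between 1 and d, and k = 1 unless the index is 1. The constants are those of the
  Fermat foliation: its line at infinity has two radial singularities of index 1, with d further
  lines each, and d - 1 singularities of index 1 / (1 - d), with one further line each, so that 2 +
  (d - 1) / (1 - d) = 1 and 2 d + (d - 1) = 3 d - 1. The value 1 - d is the index at these d - 1
  points along the other line.\<close>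

no_notation fps_nth (infixl "$" 75)

subsection \<open>Homogeneous polynomial functions in three variables\<close>

text \<open>Generating homogeneous polynomial functions by closure properties makes restriction to
  lines, gradients and division by a coordinate accessible to rule induction;
  \<open>homogeneous3_iff_form\<close> returns to the coefficient definition. The zero function has
  every degree.\<close>

inductive form :: "nat \<Rightarrow> (complex^3 \<Rightarrow> complex) \<Rightarrow> bool" where
  zero: "form n (\<lambda>p. 0)"
| const: "form 0 (\<lambda>p. c)"
| coord: "form 1 (\<lambda>p. p $ i)"
| add: "form n F \<Longrightarrow> form n G \<Longrightarrow> form n (\<lambda>p. F p + G p)"
| mult: "form m F \<Longrightarrow> form n G \<Longrightarrow> form (m + n) (\<lambda>p. F p * G p)"

lemmas form_coord' = form.coord[unfolded One_nat_def]

lemma form_cmult: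
  assumes "form n F"
  shows "form n (\<lambda>p. c * F p)"
  using form.mult[OF form.const[of c] assms] by simp

lemma form_minus:
  assumes "form n F"
  shows "form n (\<lambda>p. - F p)"
  using form_cmult[OF assms, of "-1"] by simp

lemma form_diff:
  assumes "form n F" "form n G"
  shows "form n (\<lambda>p. F p - G p)"
  using form.add[OF assms(1) form_minus[OF assms(2)]] by simp

lemma form_sum:
  assumes "\<And>a. a \<in> I \<Longrightarrow> form n (F a)"
  shows "form n (\<lambda>p. \<Sum>a\<in>I. F a p)"
  using assms by (induction I rule: infinite_finite_induct) (auto intro: form.intros)

lemma form_power:
  assumes "form n F"
  shows "form (k * n) (\<lambda>p. F p ^ k)"
  using assms by (induction k) (auto intro: form.intros)

lemma form_mult':
  assumes "form m F" "form n G" "k = m + n"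
  shows "form k (\<lambda>p. F p * G p)"
  using form.mult assms by simp

lemma form_coord_mult: "form n F \<Longrightarrow> form (Suc n) (\<lambda>p. p $ i * F p)"
  by (rule form_mult'[OF form.coord]) auto

lemma form_coord_power: "form n (\<lambda>p. (p $ i) ^ n)"
  using form_power[OF form.coord, of n] by simp

lemma form_compose:
  assumes "form n F" "\<And>i. form m (\<lambda>p. T p $ i)"
  shows "form (n * m) (\<lambda>p. F (T p))"
  using assms(1)
proof induction
  case (mult k F n G)
  then show ?case
    using form.mult[of "k * m" _ "n * m"] by (simp add: algebra_simps)
qed (auto intro: form.intros assms(2))

lemma form_matrix: "form 1 (\<lambda>p. ((M :: complex^3^3) *v p) $ i)"
  unfolding matrix_vector_mult_def
  by (auto intro!: form_sum form_cmult form_coord')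

lemma form_compose_matrix: "form n F \<Longrightarrow> form n (\<lambda>p. F ((M :: complex^3^3) *v p))"
  using form_compose[of n F 1 "\<lambda>p. M *v p"] form_matrix by auto

definition monom3 :: "nat \<Rightarrow> nat \<Rightarrow> nat \<Rightarrow> complex^3 \<Rightarrow> complex" where
  "monom3 i j k p = (p $ 1) ^ i * (p $ 2) ^ j * (p $ 3) ^ k"

lemma finite_exponents: "finite {(i, j, k). i + j + k = (n::nat)}"
  by (rule finite_subset[of _ "{..n} \<times> {..n} \<times> {..n}"]) auto

abbreviation monomial_sum :: "nat \<Rightarrow> (nat \<times> nat \<times> nat \<Rightarrow> complex) \<Rightarrow> complex^3 \<Rightarrow> complex" where
  "monomial_sum n c p \<equiv> (\<Sum>e \<in> {(i, j, k). i + j + k = n}.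
     c e * monom3 (fst e) (fst (snd e)) (snd (snd e)) p)"

lemma homogeneous3_altdef: "homogeneous3 n F \<longleftrightarrow> (\<exists>c. \<forall>p. F p = monomial_sum n c p)"
proof
  assume "homogeneous3 n F"
  then obtain c where c: "\<And>p. F p =
     (\<Sum>(i, j, k) \<in> {(i, j, k). i + j + k = n}. c i j k * (p $ 1) ^ i * (p $ 2) ^ j * (p $ 3) ^ k)"
    unfolding homogeneous3_def by blast
  show "\<exists>c. \<forall>p. F p = monomial_sum n c p"
    by (rule exI[of _ "\<lambda>(i, j, k). c i j k"])
       (auto simp: c monom3_def mult.assoc intro!: sum.cong)
next
  assume "\<exists>c. \<forall>p. F p = monomial_sum n c p"
  then obtain c where c: "\<And>p. F p = monomial_sum n c p" by blast
  show "homogeneous3 n F"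
    unfolding homogeneous3_def
    by (rule exI[of _ "\<lambda>i j k. c (i, j, k)"])
       (auto simp: c monom3_def mult.assoc intro!: sum.cong)
qed

lemma homogeneous3_monom3: "homogeneous3 (i + j + k) (\<lambda>p. c * monom3 i j k p)"
  unfolding homogeneous3_altdef
proof (rule exI[of _ "\<lambda>e. if e = (i, j, k) then c else 0"], intro allI)
  fix p
  let ?I = "{(i', j', k'). i' + j' + k' = i + j + k}"
  have "(\<Sum>e\<in>?I. (if e = (i, j, k) then c else 0) * monom3 (fst e) (fst (snd e)) (snd (snd e)) p) =
        (\<Sum>e\<in>?I. if e = (i, j, k) then c * monom3 i j k p else 0)"
    by (intro sum.cong) auto
  also have "\<dots> = c * monom3 i j k p"
    by (subst sum.delta[OF finite_exponents]) auto
  finally show "c * monom3 i j k p = (\<Sum>e\<in>?I.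
    (if e = (i, j, k) then c else 0) * monom3 (fst e) (fst (snd e)) (snd (snd e)) p)" ..
qed

lemma homogeneous3_add:
  assumes "homogeneous3 n F" "homogeneous3 n G"
  shows "homogeneous3 n (\<lambda>p. F p + G p)"
proof -
  obtain c where c: "\<And>p. F p = monomial_sum n c p"
    using assms(1) unfolding homogeneous3_altdef by blast
  obtain c' where c': "\<And>p. G p = monomial_sum n c' p"
    using assms(2) unfolding homogeneous3_altdef by blast
  show ?thesis
    unfolding homogeneous3_altdef
    by (rule exI[of _ "\<lambda>e. c e + c' e"]) (simp add: c c' sum.distrib algebra_simps)
qed

lemma homogeneous3_zero: "homogeneous3 n (\<lambda>p. 0)"
  unfolding homogeneous3_altdef by (rule exI[of _ "\<lambda>e. 0"]) simp

lemma homogeneous3_sum: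
  assumes "\<And>a. a \<in> I \<Longrightarrow> homogeneous3 n (F a)"
  shows "homogeneous3 n (\<lambda>p. \<Sum>a\<in>I. F a p)"
  using assms
  by (induction I rule: infinite_finite_induct) (auto intro: homogeneous3_zero homogeneous3_add)

lemma homogeneous3_mult:
  assumes "homogeneous3 m F" "homogeneous3 n G"
  shows "homogeneous3 (m + n) (\<lambda>p. F p * G p)"
proof -
  obtain c where c: "\<And>p. F p = monomial_sum m c p"
    using assms(1) unfolding homogeneous3_altdef by blast
  obtain c' where c': "\<And>p. G p = monomial_sum n c' p"
    using assms(2) unfolding homogeneous3_altdef by blast
  have "homogeneous3 (m + n) (\<lambda>p. c e * monom3 (fst e) (fst (snd e)) (snd (snd e)) p *
      (c' e' * monom3 (fst e') (fst (snd e')) (snd (snd e')) p))"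
    if ee: "e \<in> {(i, j, k). i + j + k = m}" "e' \<in> {(i, j, k). i + j + k = n}" for e e'
  proof -
    obtain i j k where e: "e = (i, j, k)" "i + j + k = m" using ee by (cases e) auto
    obtain i' j' k' where e': "e' = (i', j', k')" "i' + j' + k' = n" using ee by (cases e') auto
    have [simp]: "m + n = (i + i') + (j + j') + (k + k')" using e e' by simp
    have "(\<lambda>p. c e * monom3 (fst e) (fst (snd e)) (snd (snd e)) p *
      (c' e' * monom3 (fst e') (fst (snd e')) (snd (snd e')) p)) =
      (\<lambda>p. (c e * c' e') * monom3 (i + i') (j + j') (k + k') p)"
      by (auto simp: e e' monom3_def power_add)
    then show ?thesis
      using homogeneous3_monom3[of "i + i'" "j + j'" "k + k'" "c e * c' e'"] by simp
  qed
  then have "homogeneous3 (m + n) (\<lambda>p. \<Sum>e\<in>{(i, j, k). i + j + k = m}.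
      \<Sum>e'\<in>{(i, j, k). i + j + k = n}. c e * monom3 (fst e) (fst (snd e)) (snd (snd e)) p *
      (c' e' * monom3 (fst e') (fst (snd e')) (snd (snd e')) p))"
    by (intro homogeneous3_sum) auto
  then show ?thesis
    by (simp add: c c' sum_product)
qed

lemma homogeneous3_iff_form: "homogeneous3 n F \<longleftrightarrow> form n F"
proof
  assume "homogeneous3 n F"
  then obtain c where c: "\<And>p. F p = monomial_sum n c p"
    unfolding homogeneous3_altdef by blast
  have "form n (\<lambda>p. c e * monom3 (fst e) (fst (snd e)) (snd (snd e)) p)"
    if ee: "e \<in> {(i, j, k). i + j + k = n}" for e
  proof -
    obtain i j k where e: "e = (i, j, k)" "i + j + k = n" using ee by (cases e) auto
    show ?thesis
      unfolding monom3_def e(1) fst_conv snd_conv e(2)[symmetric]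
      by (intro form_cmult form.mult form_coord_power)
  qed
  then have "form n (monomial_sum n c)"
    by (rule form_sum)
  then show "form n F"
    using c by presburger
next
  assume "form n F"
  then show "homogeneous3 n F"
  proof induction
    case (const c)
    then show ?case using homogeneous3_monom3[of 0 0 0 c] by (simp add: monom3_def)
  next
    case (coord i)
    then show ?case
      using exhaust_3[of i] homogeneous3_monom3[of 1 0 0 1] homogeneous3_monom3[of 0 1 0 1]
        homogeneous3_monom3[of 0 0 1 1] by (auto simp: monom3_def)
  qed (auto intro: homogeneous3_zero homogeneous3_add homogeneous3_mult)
qed

lemma form_scale:
  assumes "form n F"
  shows "F (c *s p) = c ^ n * F p"
  using assms by induction (auto simp: power_add algebra_simps)

text \<open>Here m and n only bound the degrees, which may drop. A summand with i \<noteq> m has i >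
  m or m + n - i > n.\<close>

lemma coeff_mult_at_bounds:
  fixes p q :: "complex poly"
  assumes "degree p \<le> m" "degree q \<le> n"
  shows "coeff (p * q) (m + n) = coeff p m * coeff q n"
proof -
  have "coeff (p * q) (m + n) = (\<Sum>i\<le>m + n. coeff p i * coeff q (m + n - i))"
    by (rule coeff_mult)
  also have "\<dots> = (\<Sum>i\<in>{m}. coeff p i * coeff q (m + n - i))"
  proof (rule sum.mono_neutral_right)
    show "\<forall>i\<in>{..m + n} - {m}. coeff p i * coeff q (m + n - i) = 0"
    proof
      fix i assume "i \<in> {..m + n} - {m}"
      then have "i > m \<or> m + n - i > n" by auto
      then show "coeff p i * coeff q (m + n - i) = 0"
        using assms by (auto simp: coeff_eq_0)
    qed
  qed auto
  finally show ?thesis by simp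
qed

text \<open>The coefficient of t^n is the value of F at the point at infinity v of the line, even if
  the degree drops. Leading coefficients are read off this way throughout.\<close>

lemma form_on_line:
  assumes "form n F"
  shows "\<exists>q. degree q \<le> n \<and> coeff q n = F v \<and> (\<forall>t. F (u + t *s v) = poly q t)"
  using assms
proof induction
  case (zero n)
  show ?case by (rule exI[of _ 0]) auto
next
  case (const c)
  show ?case by (rule exI[of _ "[:c:]"]) auto
next
  case (coord i)
  show ?case by (rule exI[of _ "[:u $ i, v $ i:]"]) auto
next
  case (add n F G)
  then obtain q q' where "degree q \<le> n \<and> coeff q n = F v \<and> (\<forall>t. F (u + t *s v) = poly q t)"
    "degree q' \<le> n \<and> coeff q' n = G v \<and> (\<forall>t. G (u + t *s v) = poly q' t)" by blast
  then show ?case by (intro exI[of _ "q + q'"]) (auto intro: degree_add_le)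
next
  case (mult m F n G)
  then obtain q q' where "degree q \<le> m \<and> coeff q m = F v \<and> (\<forall>t. F (u + t *s v) = poly q t)"
    "degree q' \<le> n \<and> coeff q' n = G v \<and> (\<forall>t. G (u + t *s v) = poly q' t)" by blast
  then show ?case
    using coeff_mult_at_bounds[of q m q' n] degree_mult_le[of q q']
    by (intro exI[of _ "q * q'"]) auto
qed

text \<open>Forms of degree \<open>n - 1\<close>; for \<open>n = 0\<close> this leaves the zero function only.\<close>

definition lower_form :: "nat \<Rightarrow> (complex^3 \<Rightarrow> complex) \<Rightarrow> bool" where
  "lower_form n F \<longleftrightarrow> (case n of 0 \<Rightarrow> F = (\<lambda>p. 0) | Suc k \<Rightarrow> form k F)"

lemma lower_form_Suc [simp]: "lower_form (Suc n) F \<longleftrightarrow> form n F"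
  by (simp add: lower_form_def)

lemma lower_form_zero: "lower_form n (\<lambda>p. 0)"
  by (auto simp: lower_form_def form.zero split: nat.splits)

lemma lower_form_add: "lower_form n F \<Longrightarrow> lower_form n G \<Longrightarrow> lower_form n (\<lambda>p. F p + G p)"
  by (auto simp: lower_form_def split: nat.splits intro: form.add)

lemma lower_form_mult: "form m F \<Longrightarrow> lower_form n G \<Longrightarrow> lower_form (m + n) (\<lambda>p. F p * G p)"
  by (auto simp: lower_form_def form.zero split: nat.splits intro: form.mult form_mult')

lemma lower_form_mult': "lower_form m F \<Longrightarrow> form n G \<Longrightarrow> lower_form (m + n) (\<lambda>p. F p * G p)"
  using lower_form_mult[of n G m F] by (simp add: mult.commute add.commute)

text \<open>The chain rule along arbitrary differentiable curves is taken as the definition: it is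
  applied to lines as well as to lifted leaves.\<close>

definition gradient :: "(complex^3 \<Rightarrow> complex) \<Rightarrow> (complex^3 \<Rightarrow> complex^3) \<Rightarrow> bool" where
  "gradient F D \<longleftrightarrow> (\<forall>\<gamma> \<gamma>' t. (\<forall>i. ((\<lambda>s. \<gamma> s $ i) has_field_derivative \<gamma>' $ i) (at t)) \<longrightarrow>
     ((\<lambda>s. F (\<gamma> s)) has_field_derivative pairing (D (\<gamma> t)) \<gamma>') (at t))"

lemma gradientD:
  "gradient F D \<Longrightarrow> (\<And>i. ((\<lambda>s. \<gamma> s $ i) has_field_derivative \<gamma>' $ i) (at t)) \<Longrightarrow>
     ((\<lambda>s. F (\<gamma> s)) has_field_derivative pairing (D (\<gamma> t)) \<gamma>') (at t)"
  by (simp add: gradient_def)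

lemma gradient_on_line:
  assumes "gradient F D"
  shows "((\<lambda>t. F (u + t *s v)) has_field_derivative pairing (D (u + t *s v)) v) (at t)"
  by (rule gradientD[OF assms]) (auto intro!: derivative_eq_intros)

lemma form_gradient:
  assumes "form n F"
  shows "\<exists>D. (\<forall>i. lower_form n (\<lambda>p. D p $ i)) \<and> gradient F D"
  using assms
proof induction
  case (zero n)
  show ?case by (rule exI[of _ "\<lambda>p. 0"]) (auto simp: lower_form_zero pairing_def gradient_def)
next
  case (const c)
  show ?case by (rule exI[of _ "\<lambda>p. 0"]) (auto simp: lower_form_zero pairing_def gradient_def)
next
  case (coord i)
  have eq: "axis i 1 $ j * x $ j = (if j = i then x $ i else 0)" for j and x :: "complex^3"
    by (auto simp: axis_def)
  have "lower_form 1 (\<lambda>p. axis i 1 $ j)" for j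
    unfolding One_nat_def lower_form_Suc by (rule form.const)
  then show ?case by (intro exI[of _ "\<lambda>p. axis i 1"]) (auto simp: pairing_def eq gradient_def)
next
  case (add n F G)
  then obtain D E where "\<forall>i. lower_form n (\<lambda>p. D p $ i)" "gradient F D"
    "\<forall>i. lower_form n (\<lambda>p. E p $ i)" "gradient G E" by blast
  then show ?case
    by (intro exI[of _ "\<lambda>p. D p + E p"])
      (auto intro!: lower_form_add derivative_eq_intros
        simp: gradient_def pairing_def sum.distrib algebra_simps)
next
  case (mult m F n G)
  then obtain D E where DE: "\<forall>i. lower_form m (\<lambda>p. D p $ i)" "gradient F D"
    "\<forall>i. lower_form n (\<lambda>p. E p $ i)" "gradient G E" by blast
  have "pairing (F p *s E p + G p *s D p) v = pairing (D p) v * G p + pairing (E p) v * F p" for p v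
    by (simp add: pairing_def sum_distrib_left sum_distrib_right sum.distrib algebra_simps)
  then have "gradient (\<lambda>p. F p * G p) (\<lambda>p. F p *s E p + G p *s D p)"
    using DE(2,4) unfolding gradient_def by (auto intro!: DERIV_mult)
  moreover have "lower_form (m + n) (\<lambda>p. (F p *s E p + G p *s D p) $ i)" for i
  proof -
    have 1: "lower_form (m + n) (\<lambda>p. F p * E p $ i)"
      by (rule lower_form_mult) (use DE mult in auto)
    have 2: "lower_form (m + n) (\<lambda>p. D p $ i * G p)"
      by (rule lower_form_mult') (use DE mult in auto)
    show ?thesis
      using lower_form_add[OF 1 2] by (simp add: mult.commute)
  qed
  ultimately show ?case by (intro exI[of _ "\<lambda>p. F p *s E p + G p *s D p"]) auto
qed

text \<open>Differentiate F(t p) = t^n F(p) at t = 1.\<close>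

lemma form_euler:
  assumes "form n F" "gradient F D"
  shows "pairing (D p) p = of_nat n * F p"
proof -
  have "((\<lambda>t. F (0 + t *s p)) has_field_derivative pairing (D (0 + 1 *s p)) p) (at 1)"
    by (rule gradient_on_line[OF assms(2)])
  moreover have "((\<lambda>t. F (0 + t *s p)) has_field_derivative of_nat n * F p) (at 1)"
    using form_scale[OF assms(1)] by (auto intro!: derivative_eq_intros)
  ultimately show ?thesis using DERIV_unique by fastforce
qed

text \<open>Division by the third coordinate, with the values on z = 0 as remainder: a form that
  vanishes on z = 0 is z times a form of one degree less.\<close>

lemma form_split_third:
  assumes "form n F"
  shows "\<exists>G. lower_form n G \<and> (\<forall>p. F p = F (vector [p $ 1, p $ 2, 0]) + p $ 3 * G p)"
  using assms
proof induction
  case (zero n)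
  show ?case by (rule exI[of _ "\<lambda>p. 0"]) (auto simp: lower_form_zero)
next
  case (const c)
  show ?case by (rule exI[of _ "\<lambda>p. 0"]) (auto simp: lower_form_zero)
next
  case (coord i)
  have "lower_form 1 (\<lambda>p. if i = 3 then 1 else 0)"
    unfolding One_nat_def lower_form_Suc by (rule form.const)
  then show ?case using exhaust_3[of i]
    by (intro exI[of _ "\<lambda>p. if i = 3 then 1 else 0"]) auto
next
  case (add n F G)
  then obtain F' G' where FG: "lower_form n F'" "\<And>p. F p = F (vector [p $ 1, p $ 2, 0]) + p $ 3 * F' p"
    "lower_form n G'" "\<And>p. G p = G (vector [p $ 1, p $ 2, 0]) + p $ 3 * G' p" by blast
  have "F p + G p = F (vector [p $ 1, p $ 2, 0]) + G (vector [p $ 1, p $ 2, 0]) + p $ 3 * (F' p + G' p)" for p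
    by (subst FG(2), subst FG(4)) (simp add: algebra_simps)
  then show ?case
    using lower_form_add[OF FG(1,3)] by blast
next
  case (mult m F n G)
  then obtain F' G' where FG: "lower_form m F'" "\<And>p. F p = F (vector [p $ 1, p $ 2, 0]) + p $ 3 * F' p"
    "lower_form n G'" "\<And>p. G p = G (vector [p $ 1, p $ 2, 0]) + p $ 3 * G' p" by blast
  define H where "H = (\<lambda>p. F' p * G p + F (vector [p $ 1, p $ 2, 0]) * G' p)"
  have "form (m * 1) (\<lambda>p. F (vector [p $ 1, p $ 2, 0]))"
  proof (rule form_compose[OF mult(1)])
    fix i :: 3
    show "form 1 (\<lambda>p. vector [p $ 1, p $ 2, 0] $ i)"
      using exhaust_3[of i] by (auto intro: form_coord' form.zero)
  qed
  then have "lower_form (m + n) H"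
    unfolding H_def by (intro lower_form_add lower_form_mult lower_form_mult' FG mult) auto
  moreover have "F p * G p = F (vector [p $ 1, p $ 2, 0]) * G (vector [p $ 1, p $ 2, 0]) + p $ 3 * H p" for p
  proof -
    have "F p * G p = F (vector [p $ 1, p $ 2, 0]) * G p + p $ 3 * F' p * G p"
      by (subst FG(2)) (simp add: algebra_simps)
    also have "F (vector [p $ 1, p $ 2, 0]) * G p =
      F (vector [p $ 1, p $ 2, 0]) * (G (vector [p $ 1, p $ 2, 0]) + p $ 3 * G' p)"
      by (subst FG(4)) (rule refl)
    finally show ?thesis by (simp add: H_def algebra_simps)
  qed
  ultimately show ?case by blast
qed

lemma vec3_eq_iff: "(p :: 'a^3) = q \<longleftrightarrow> p $ 1 = q $ 1 \<and> p $ 2 = q $ 2 \<and> p $ 3 = q $ 3"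
  by (simp add: vec_eq_iff forall_3)

lemma vector3_eta: "vector [p $ 1, p $ 2, p $ 3] = (p :: complex^3)"
  by (simp add: vec3_eq_iff)

lemma poly_eq_if_infinite:
  fixes p q :: "complex poly"
  assumes "infinite {t. poly p t = poly q t}"
  shows "p = q"
  using assms poly_roots_finite[of "p - q"] by auto

text \<open>Homogeneity gives equality off z = 0. A point of z = 0 is reached along the direction of
  the third axis, on which both sides are polynomials agreeing for all but one parameter.\<close>

lemma form_eqI:
  assumes "form n F" "form n G" "\<And>x y. F (vector [x, y, 1]) = G (vector [x, y, 1])"
  shows "F p = G p"
proof -
  have eq: "F p = G p" if "p $ 3 \<noteq> 0" for p
  proof -
    have p: "p = p $ 3 *s vector [p $ 1 / p $ 3, p $ 2 / p $ 3, 1]"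
      using that by (simp add: vec3_eq_iff)
    show ?thesis
      by (subst (1 2) p) (simp only: form_scale[OF assms(1)] form_scale[OF assms(2)] assms(3))
  qed
  obtain q where q: "\<And>t. F (p + t *s axis 3 1) = poly q t"
    using form_on_line[OF assms(1)] by blast
  obtain q' where q': "\<And>t. G (p + t *s axis 3 1) = poly q' t"
    using form_on_line[OF assms(2)] by blast
  have "poly q t = poly q' t" if "t \<noteq> - p $ 3" for t
  proof -
    have "p $ 3 + t \<noteq> 0" using that by (simp add: add_eq_0_iff)
    then show ?thesis
      using eq[of "p + t *s axis 3 1"] q[of t] q'[of t] by (simp add: axis_def)
  qed
  then have "- {- p $ 3} \<subseteq> {t. poly q t = poly q' t}" by auto
  moreover have "infinite (- {- p $ 3})"
    using finite_compl[of "{- p $ 3}"] infinite_UNIV_char_0[where 'a = complex] by simp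
  ultimately have "q = q'"
    by (intro poly_eq_if_infinite) (auto dest: finite_subset)
  then show ?thesis using q[of 0] q'[of 0] by simp
qed

subsection \<open>Linear algebra in homogeneous coordinates\<close>

declare transpose_matrix_vector [simp del]

lemma pairing_3: "pairing a v = a $ 1 * v $ 1 + a $ 2 * v $ 2 + a $ 3 * v $ 3"
  by (simp add: pairing_def sum_3)

lemma pairing_add: "pairing a (u + v) = pairing a u + pairing a v"
  by (simp add: pairing_3 algebra_simps)

lemma pairing_scale: "pairing a (c *s v) = c * pairing a v"
  by (simp add: pairing_3 algebra_simps)

lemma pairing_zero [simp]: "pairing a 0 = 0" "pairing 0 a = 0"
  by (simp_all add: pairing_3)

lemma in_line_iff [simp]: "p \<in> line l \<longleftrightarrow> pairing l p = 0"
  by (simp add: line_def)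

text \<open>The complex bilinear vector product. As a covector it is the equation of the line
  through two points; dually it is the intersection point of two lines, and it vanishes exactly on
  dependent pairs.\<close>

definition cross :: "complex^3 \<Rightarrow> complex^3 \<Rightarrow> complex^3" where
  "cross a b = vector [a $ 2 * b $ 3 - a $ 3 * b $ 2, a $ 3 * b $ 1 - a $ 1 * b $ 3,
     a $ 1 * b $ 2 - a $ 2 * b $ 1]"

lemma cross_components [simp]:
  "cross a b $ 1 = a $ 2 * b $ 3 - a $ 3 * b $ 2"
  "cross a b $ 2 = a $ 3 * b $ 1 - a $ 1 * b $ 3"
  "cross a b $ 3 = a $ 1 * b $ 2 - a $ 2 * b $ 1"
  by (simp_all add: cross_def)

lemma nonzero_component:
  assumes "(a :: complex^3) \<noteq> 0"
  obtains j where "a $ j \<noteq> 0"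
  using assms by (auto simp: vec_eq_iff)

lemma cross_eq_0_imp_multiple:
  assumes "cross a b = 0" "a \<noteq> 0"
  shows "\<exists>k. b = k *s a"
proof -
  obtain j where j: "a $ j \<noteq> 0" using assms(2) by (rule nonzero_component)
  have eq: "a $ i * b $ k = a $ k * b $ i" for i k
  proof -
    have "cross a b $ 1 = 0" "cross a b $ 2 = 0" "cross a b $ 3 = 0" using assms(1) by simp_all
    then show ?thesis using exhaust_3[of i] exhaust_3[of k] by auto
  qed
  have "b = (b $ j / a $ j) *s a"
    using j eq[of j] by (simp add: vec_eq_iff field_simps)
  then show ?thesis by blast
qed

lemma annihilator_multiple_of_cross:
  assumes "pairing w a = 0" "pairing w b = 0" "cross a b \<noteq> 0"
  shows "\<exists>k. w = k *s cross a b"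
proof -
  have "cross (cross a b) w = 0"
  proof -
    have "cross (cross a b) w = pairing w a *s b - pairing w b *s a"
      by (simp add: vec3_eq_iff pairing_3 algebra_simps)
    then show ?thesis using assms by simp
  qed
  then show ?thesis using cross_eq_0_imp_multiple assms(3) by blast
qed

lemma pairing_cross [simp]: "pairing (cross a b) a = 0" "pairing (cross a b) b = 0"
  by (simp_all add: pairing_3 algebra_simps)

lemma span2: "vec.span {a, b :: complex^3} = {p. \<exists>s t. p = s *s a + t *s b}"
proof (intro set_eqI iffI)
  fix p assume "p \<in> vec.span {a, b}"
  then obtain k where "p - k *s a \<in> vec.span {b}" using vec.span_breakdown_eq by blast
  then obtain m where "p - k *s a = m *s b" unfolding vec.span_singleton by blast
  then have "p = k *s a + m *s b" by (simp add: algebra_simps)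
  then show "p \<in> {p. \<exists>s t. p = s *s a + t *s b}" by blast
next
  fix p assume "p \<in> {p. \<exists>s t. p = s *s a + t *s b}"
  then obtain s t where p: "p = s *s a + t *s b" by blast
  have "s *s a \<in> vec.span {a, b}" "t *s b \<in> vec.span {a, b}"
    by (intro vec.span_scale vec.span_base; simp)+
  then show "p \<in> vec.span {a, b}" unfolding p by (rule vec.span_add)
qed

lemma span1: "vec.span {a :: complex^3} = {p. \<exists>s. p = s *s a}"
  unfolding vec.span_singleton by auto

lemma span_eq_line:
  assumes "cross a b \<noteq> 0"
  shows "vec.span {a, b} = line (cross a b)"
proof (intro set_eqI iffI)
  fix p assume "p \<in> vec.span {a, b}"
  then show "p \<in> line (cross a b)" unfolding span2 by (auto simp: pairing_add pairing_scale)
next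
  fix p assume "p \<in> line (cross a b)"
  then have p: "cross a b $ 1 * p $ 1 + cross a b $ 2 * p $ 2 + cross a b $ 3 * p $ 3 = 0"
    by (simp add: pairing_3)
  \<comment> \<open>Cramer's rule: in component i the two sides differ by the determinant of a, b, p
    if i = j and by nothing otherwise, and this determinant is zero.\<close>
  have eq: "cross a b $ j *s p = (cross p b $ j) *s a + (cross a p $ j) *s b" for j
  proof -
    have "cross a b $ j * p $ i - (cross p b $ j * a $ i + cross a p $ j * b $ i) =
      (if i = j then cross a b $ 1 * p $ 1 + cross a b $ 2 * p $ 2 + cross a b $ 3 * p $ 3 else 0)" for i
      using exhaust_3[of i] exhaust_3[of j] by (auto simp: algebra_simps)
    then have "cross a b $ j * p $ i = cross p b $ j * a $ i + cross a p $ j * b $ i" for i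
      using p by (metis (no_types, lifting) eq_iff_diff_eq_0)
    then show ?thesis by (simp add: vec_eq_iff)
  qed
  obtain j where j: "cross a b $ j \<noteq> 0" using assms by (rule nonzero_component)
  have "p = (1 / cross a b $ j) *s (cross a b $ j *s p)" using j by (simp add: vec_eq_iff)
  also have "\<dots> = (cross p b $ j / cross a b $ j) *s a + (cross a p $ j / cross a b $ j) *s b"
    unfolding eq by (simp add: vec_eq_iff field_simps)
  finally show "p \<in> vec.span {a, b}" unfolding span2 by blast
qed

lemma line_scale: "c \<noteq> 0 \<Longrightarrow> line (c *s l) = line l"
  by (auto simp: line_def pairing_3 mult.assoc simp flip: distrib_left)

lemma line_eq_span:
  assumes "l \<noteq> 0" "a \<in> line l" "b \<in> line l" "cross a b \<noteq> 0"
  shows "line l = vec.span {a, b}"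
proof -
  obtain k where k: "l = k *s cross a b"
    using annihilator_multiple_of_cross[of l a b] assms by auto
  then have "k \<noteq> 0" using assms(1) by auto
  then show ?thesis using k span_eq_line[OF assms(4)] line_scale by simp
qed

lemma line_has_basis:
  assumes "l \<noteq> 0"
  obtains a b where "a \<in> line l" "b \<in> line l" "cross a b \<noteq> 0"
proof -
  obtain j where j: "l $ j \<noteq> 0" using assms by (rule nonzero_component)
  consider "j = 1" | "j = 2" | "j = 3" using exhaust_3 by blast
  then show thesis
  proof cases
    case 1
    then show ?thesis
      using j that[of "vector [- l $ 2, l $ 1, 0]" "vector [- l $ 3, 0, l $ 1]"]
      by (simp add: pairing_3 vec3_eq_iff)
  next
    case 2
    then show ?thesis
      using j that[of "vector [l $ 2, - l $ 1, 0]" "vector [0, - l $ 3, l $ 2]"]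
      by (simp add: pairing_3 vec3_eq_iff)
  next
    case 3
    then show ?thesis
      using j that[of "vector [l $ 3, 0, - l $ 1]" "vector [0, l $ 3, - l $ 2]"]
      by (simp add: pairing_3 vec3_eq_iff)
  qed
qed

lemma line_eq_imp_multiple:
  assumes "line l = line l'" "l \<noteq> 0" "l' \<noteq> 0"
  shows "\<exists>c. c \<noteq> 0 \<and> l' = c *s l"
proof -
  obtain a b where ab: "a \<in> line l" "b \<in> line l" "cross a b \<noteq> 0" using line_has_basis[OF assms(2)] .
  obtain k where k: "l = k *s cross a b"
    using annihilator_multiple_of_cross[of l a b] ab by auto
  obtain k' where k': "l' = k' *s cross a b"
    using annihilator_multiple_of_cross[of l' a b] ab assms(1) by auto
  have "k \<noteq> 0" "k' \<noteq> 0" using k k' assms by auto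
  then show ?thesis unfolding k k' by (intro exI[of _ "k' / k"]) (simp add: vec_eq_iff)
qed

lemma point_eq_iff:
  assumes "p \<noteq> 0" "q \<noteq> 0"
  shows "point p = point q \<longleftrightarrow> (\<exists>c. c \<noteq> 0 \<and> q = c *s p)"
proof
  assume "point p = point q"
  then have "q \<in> point p" unfolding point_def by (simp add: vec.span_base)
  then obtain c where c: "q = c *s p" by (auto simp: point_def span1)
  then show "\<exists>c. c \<noteq> 0 \<and> q = c *s p" using assms by (intro exI[of _ c]) auto
next
  assume "\<exists>c. c \<noteq> 0 \<and> q = c *s p"
  then obtain c where c: "c \<noteq> 0" "q = c *s p" by blast
  show "point p = point q"
    unfolding point_def span1
  proof (intro set_eqI iffI; clarsimp)
    fix s show "\<exists>t. s *s p = t *s q" by (rule exI[of _ "s / c"]) (use c in \<open>simp add: vec_eq_iff\<close>)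
    show "\<exists>t. s *s q = t *s p" by (rule exI[of _ "s * c"]) (use c in \<open>simp add: vec_eq_iff\<close>)
  qed
qed

definition columns3 :: "complex^3 \<Rightarrow> complex^3 \<Rightarrow> complex^3 \<Rightarrow> complex^3^3" where
  "columns3 a b c = transpose (vector [a, b, c])"

lemma columns3_mult: "columns3 a b c *v p = p $ 1 *s a + p $ 2 *s b + p $ 3 *s c"
  by (simp add: columns3_def matrix_vector_mult_def vec_eq_iff sum_3 transpose_def algebra_simps)

lemma det_vector3: "det (vector [a, b, c] :: complex^3^3) = pairing (cross a b) c"
  by (simp add: det_3 pairing_3 algebra_simps)

lemma invertible_columns3: "invertible (columns3 a b c) \<longleftrightarrow> pairing (cross a b) c \<noteq> 0"
  unfolding columns3_def invertible_det_nz det_transpose det_vector3 ..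


subsection \<open>Foliations under linear coordinate changes\<close>

definition form_foliation :: "nat \<Rightarrow> (complex^3 \<Rightarrow> complex^3) \<Rightarrow> bool" where
  "form_foliation n \<omega> \<longleftrightarrow> (\<forall>i. form n (\<lambda>p. \<omega> p $ i)) \<and> (\<forall>p. pairing (\<omega> p) p = 0) \<and>
     finite {point p | p. p \<noteq> 0 \<and> \<omega> p = 0}"

lemma foliation_iff_form_foliation: "foliation \<omega> \<longleftrightarrow> (\<exists>n. form_foliation n \<omega>)"
  by (auto simp: foliation_def form_foliation_def homogeneous3_iff_form)

lemma
  assumes "form_foliation n \<omega>"
  shows form_foliation_form: "form n (\<lambda>p. \<omega> p $ i)"
    and form_foliation_radial: "pairing (\<omega> p) p = 0"
    and form_foliation_finite: "finite {point p | p. p \<noteq> 0 \<and> \<omega> p = 0}"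
  using assms by (auto simp: form_foliation_def)

lemma form_pairing: "(\<And>i. form n (\<lambda>p. \<omega> p $ i)) \<Longrightarrow> form n (\<lambda>p. pairing (\<omega> p) v)"
  unfolding pairing_def
  by (intro form_sum, subst mult.commute, intro form_cmult) auto

lemma form_foliation_scale:
  assumes "form_foliation n \<omega>"
  shows "\<omega> (c *s p) = c ^ n *s \<omega> p"
  using form_scale[OF form_foliation_form[OF assms]] by (simp add: vec_eq_iff)

definition pull :: "complex^3^3 \<Rightarrow> (complex^3 \<Rightarrow> complex^3) \<Rightarrow> complex^3 \<Rightarrow> complex^3" where
  "pull M \<omega> p = transpose M *v \<omega> (M *v p)"

lemma pairing_pull: "pairing (pull M \<omega> p) v = pairing (\<omega> (M *v p)) (M *v v)"
proof -
  have "pairing (transpose M *v w) v = pairing w (M *v v)" for w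
    by (simp add: pairing_3 matrix_vector_mult_def sum_3 transpose_def algebra_simps)
  then show ?thesis by (simp add: pull_def)
qed

lemma pull_columns3:
  "pull (columns3 a b c) \<omega> p = vector [pairing (\<omega> (columns3 a b c *v p)) a,
     pairing (\<omega> (columns3 a b c *v p)) b, pairing (\<omega> (columns3 a b c *v p)) c]"
  by (simp add: pull_def columns3_def vec3_eq_iff matrix_vector_mult_def pairing_3 sum_3 mult.commute)

lemma pull_pull: "pull M (pull N \<omega>) = pull (N ** M) \<omega>"
  by (simp add: pull_def fun_eq_iff matrix_transpose_mul matrix_vector_mul_assoc)

lemma matrix_inverse_cancel:
  fixes M N :: "complex^3^3"
  assumes "N ** M = mat 1"
  shows "N *v (M *v p) = p"
  by (simp add: matrix_vector_mul_assoc assms)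

lemma invertible_obtain_inverse:
  fixes M :: "complex^3^3"
  assumes "invertible M"
  obtains N where "M ** N = mat 1" "N ** M = mat 1" "invertible N"
  using assms unfolding invertible_def by blast

lemma transpose_mult_nonzero:
  fixes M N :: "complex^3^3"
  assumes "N ** M = mat 1" "l \<noteq> (0 :: complex^3)"
  shows "transpose N *v l \<noteq> 0"
proof
  assume "transpose N *v l = 0"
  then have "transpose M *v (transpose N *v l) = 0" by simp
  moreover have "transpose M ** transpose N = mat 1"
    using assms(1) by (metis matrix_transpose_mul transpose_mat)
  ultimately show False
    using assms(2) matrix_inverse_cancel[of "transpose M" "transpose N" l] by simp
qed

lemma pull_nonzero:
  assumes "invertible M" "\<omega> (M *v p) \<noteq> 0"
  shows "pull M \<omega> p \<noteq> 0"
  using assms invertible_obtain_inverse[OF assms(1)] transpose_mult_nonzero unfolding pull_def by metis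

lemma form_foliation_pull:
  assumes "form_foliation n \<omega>" "invertible M"
  shows "form_foliation n (pull M \<omega>)"
  unfolding form_foliation_def
proof (intro conjI allI)
  fix i
  have eq: "(\<lambda>p. pull M \<omega> p $ i) = (\<lambda>p. \<Sum>j\<in>UNIV. transpose M $ i $ j * \<omega> (M *v p) $ j)"
    by (simp add: pull_def matrix_vector_mult_def)
  show "form n (\<lambda>p. pull M \<omega> p $ i)"
    unfolding eq using form_foliation_form[OF assms(1)]
    by (intro form_sum form_cmult form_compose_matrix)
next
  fix p show "pairing (pull M \<omega> p) p = 0"
    by (simp add: pairing_pull form_foliation_radial[OF assms(1)])
next
  obtain N where N: "M ** N = mat 1" "N ** M = mat 1" "invertible N"
    using invertible_obtain_inverse[OF assms(2)] .
  have "{point p | p. p \<noteq> 0 \<and> pull M \<omega> p = 0} \<subseteq> (\<lambda>P. (\<lambda>q. N *v q) ` P) ` {point p | p. p \<noteq> 0 \<and> \<omega> p = 0}"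
  proof clarify
    fix p assume p: "p \<noteq> 0" "pull M \<omega> p = 0"
    have NMp: "N *v (M *v p) = p" for p by (rule matrix_inverse_cancel[OF N(2)])
    have "\<omega> (M *v p) = 0" using pull_nonzero[of M \<omega> p] assms(2) p(2) by blast
    moreover have "M *v p \<noteq> 0" using NMp[of p] p(1) by auto
    moreover have "point p = (\<lambda>q. N *v q) ` point (M *v p)"
    proof -
      have "N *v (s *s (M *v p)) = s *s p" for s
        by (simp add: NMp vector_scalar_commute)
      then show ?thesis unfolding point_def vec.span_singleton image_image by simp
    qed
    ultimately show "point p \<in> (\<lambda>P. (\<lambda>q. N *v q) ` P) ` {point p | p. p \<noteq> 0 \<and> \<omega> p = 0}" by blast
  qed
  then show "finite {point p | p. p \<noteq> 0 \<and> pull M \<omega> p = 0}"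
    using form_foliation_finite[OF assms(1)] finite_surj by blast
qed

lemma image_line:
  fixes M N :: "complex^3^3"
  assumes "M ** N = mat 1" "N ** M = mat 1"
  shows "(\<lambda>p. M *v p) ` line l = line (transpose N *v l)"
proof -
  have "pairing (transpose N *v l) q = pairing l (N *v q)" for q
    by (simp add: pairing_3 matrix_vector_mult_def sum_3 transpose_def algebra_simps)
  note pN = this
  show ?thesis
  proof (intro set_eqI iffI)
    fix q assume "q \<in> (\<lambda>p. M *v p) ` line l"
    then show "q \<in> line (transpose N *v l)"
      by (auto simp: pN matrix_inverse_cancel[OF assms(2)])
  next
    fix q assume "q \<in> line (transpose N *v l)"
    then have "N *v q \<in> line l" by (simp add: pN)
    then show "q \<in> (\<lambda>p. M *v p) ` line l"
      using matrix_inverse_cancel[OF assms(1), of q] by (metis image_eqI)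
  qed
qed

lemma invariant_line_pull:
  assumes "invertible M"
  shows "invariant_line (pull M \<omega>) L \<longleftrightarrow> invariant_line \<omega> ((\<lambda>p. M *v p) ` L)"
proof -
  obtain N where N: "M ** N = mat 1" "N ** M = mat 1" "invertible N"
    using invertible_obtain_inverse[OF assms] .
  have *: "\<exists>l. l \<noteq> 0 \<and> (\<lambda>p. A *v p) ` L = line l" if "\<exists>l. l \<noteq> 0 \<and> L = line l"
    "A ** B = mat 1" "B ** A = mat 1" for A B :: "complex^3^3" and L
    using that image_line[OF that(2,3)] transpose_mult_nonzero[OF that(3)] by blast
  have "(\<lambda>p. N *v p) ` (\<lambda>p. M *v p) ` L = L"
    by (simp add: image_image matrix_inverse_cancel[OF N(2)])
  then have "(\<exists>l. l \<noteq> 0 \<and> L = line l) \<longleftrightarrow> (\<exists>l. l \<noteq> 0 \<and> (\<lambda>p. M *v p) ` L = line l)"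
    using *[of L M N] *[of "(\<lambda>p. M *v p) ` L" N M] N by auto
  then show ?thesis by (auto simp: invariant_line_def pairing_pull)
qed

lemma bij_betw_invariant_lines_pull:
  assumes "invertible M"
  shows "bij_betw (\<lambda>L. (\<lambda>p. M *v p) ` L) {L. invariant_line (pull M \<omega>) L} {L. invariant_line \<omega> L}"
proof -
  obtain N where N: "M ** N = mat 1" "N ** M = mat 1" "invertible N"
    using invertible_obtain_inverse[OF assms] .
  have 1: "(\<lambda>p. N *v p) ` (\<lambda>p. M *v p) ` L = L" "(\<lambda>p. M *v p) ` (\<lambda>p. N *v p) ` L = L" for L
    by (simp_all add: image_image matrix_inverse_cancel N)
  show ?thesis
    by (rule bij_betw_byWitness[where f' = "\<lambda>L. (\<lambda>p. N *v p) ` L"])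
       (auto simp: invariant_line_pull[OF assms] 1)
qed

lemma card_invariant_lines_pull:
  "invertible M \<Longrightarrow> card {L. invariant_line (pull M \<omega>) L} = card {L. invariant_line \<omega> L}"
  using bij_betw_invariant_lines_pull by (rule bij_betw_same_card)

text \<open>Covectors move against points: M maps the line with equation
  \<open>transpose M *v l\<close> onto the one with equation l.\<close>

lemma pull_line_iff:
  assumes "invertible M"
  shows "invariant_line (pull M \<omega>) (line (transpose M *v l)) \<longleftrightarrow> invariant_line \<omega> (line l)"
proof -
  obtain N where N: "M ** N = mat 1" "N ** M = mat 1" "invertible N"
    using invertible_obtain_inverse[OF assms] .
  have "transpose N *v (transpose M *v l) = l"
    using N(1) by (metis matrix_inverse_cancel matrix_transpose_mul transpose_mat)
  then show ?thesis
    using image_line[OF N(1,2), of "transpose M *v l"] invariant_line_pull[OF assms] by simp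
qed

lemma invariant_line_span_iff:
  assumes "cross a b \<noteq> 0"
  shows "invariant_line \<omega> (vec.span {a, b}) \<longleftrightarrow>
    (\<forall>s t. pairing (\<omega> (s *s a + t *s b)) a = 0 \<and> pairing (\<omega> (s *s a + t *s b)) b = 0)"
proof
  assume inv: "invariant_line \<omega> (vec.span {a, b})"
  have "a \<in> vec.span {a, b}" "b \<in> vec.span {a, b}" by (auto intro: vec.span_base)
  then show "\<forall>s t. pairing (\<omega> (s *s a + t *s b)) a = 0 \<and> pairing (\<omega> (s *s a + t *s b)) b = 0"
    using inv unfolding invariant_line_def span2 by blast
next
  assume *: "\<forall>s t. pairing (\<omega> (s *s a + t *s b)) a = 0 \<and> pairing (\<omega> (s *s a + t *s b)) b = 0"
  show "invariant_line \<omega> (vec.span {a, b})"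
    unfolding invariant_line_def
  proof
    show "\<exists>l. l \<noteq> 0 \<and> vec.span {a, b} = line l" using span_eq_line[OF assms] assms by blast
    show "\<forall>p\<in>vec.span {a, b}. \<forall>v\<in>vec.span {a, b}. pairing (\<omega> p) v = 0"
      unfolding span2 using * by (auto simp: pairing_add pairing_scale)
  qed
qed

subsection \<open>Tangencies and the degree\<close>

text \<open>The difference of the two sides has degree below n and n roots. If the degree of p is
  less than n, the coefficient and p are both zero.\<close>

lemma poly_eq_prod_roots:
  fixes p :: "complex poly"
  assumes "finite S" "card S = n" "degree p \<le> n" "\<And>a. a \<in> S \<Longrightarrow> poly p a = 0"
  shows "p = smult (coeff p n) (\<Prod>a\<in>S. [:- a, 1:])"
proof (rule ccontr)
  let ?P = "\<Prod>a\<in>S. [:- a, 1:]"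
  define r where "r = p - smult (coeff p n) ?P"
  assume "p \<noteq> smult (coeff p n) ?P"
  then have r0: "r \<noteq> 0" by (simp add: r_def)
  have deg: "degree ?P = n"
    using assms(2) by (subst degree_prod_eq_sum_degree) auto
  have lc: "coeff ?P n = 1"
    using lead_coeff_prod[of "\<lambda>a. [:- a, 1 :: complex:]" S] deg by simp
  have "degree r \<le> n"
    unfolding r_def using assms(3) deg by (intro degree_diff_le) auto
  moreover have "coeff r n = 0" by (simp add: r_def lc)
  ultimately have "degree r < n"
    using r0 by (metis leading_coeff_0_iff le_neq_implies_less)
  have "S \<subseteq> {x. poly r x = 0}"
    using assms(1,4) by (auto simp: r_def poly_prod)
  then have "card S \<le> card {x. poly r x = 0}"
    by (rule card_mono[OF poly_roots_finite[OF r0]])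
  also have "\<dots> \<le> degree r" by (rule card_poly_roots_bound[OF r0])
  finally show False using assms(2) \<open>degree r < n\<close> by simp
qed

lemma form_eq_prod_roots_on_line:
  assumes "form n F" "finite S" "card S = n" "\<And>a. a \<in> S \<Longrightarrow> F (u + a *s v) = 0"
  shows "F (u + t *s v) = F v * (\<Prod>a\<in>S. t - a)"
proof -
  obtain q where q: "degree q \<le> n" "coeff q n = F v" "\<And>t. F (u + t *s v) = poly q t"
    using form_on_line[OF assms(1)] by blast
  have "q = smult (coeff q n) (\<Prod>a\<in>S. [:- a, 1:])"
    using assms(2,3) q(1) by (rule poly_eq_prod_roots) (use assms(4) q(3) in simp)
  then have "poly q t = poly (smult (coeff q n) (\<Prod>a\<in>S. [:- a, 1:])) t" by (rule arg_cong)
  then show ?thesis by (simp add: q poly_prod)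
qed

lemma sum_order_complex:
  fixes p :: "complex poly"
  assumes "p \<noteq> 0"
  shows "(\<Sum>x | poly p x = 0. order x p) = degree p"
proof -
  have "degree p = size (proots p)" by (simp add: size_proots_complex)
  also have "\<dots> = (\<Sum>x | poly p x = 0. order x p)"
    using assms by (simp add: size_multiset_overloaded_eq)
  finally show ?thesis ..
qed

lemma pairing_scale_left: "pairing (c *s a) v = c * pairing a v"
  by (simp add: pairing_3 algebra_simps)

lemma cross_add_right: "cross a (b + c) = cross a b + cross a c"
  by (simp add: vec3_eq_iff algebra_simps)

lemma cross_scale_right: "cross a (t *s b) = t *s cross a b"
  by (simp add: vec3_eq_iff algebra_simps)

lemma cross_self [simp]: "cross a a = 0"
  by (simp add: vec3_eq_iff)

lemma cross_zero [simp]: "cross 0 a = 0" "cross a 0 = 0"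
  by (simp_all add: vec3_eq_iff)

lemma cross_anticommute: "cross b a = - cross a b"
  by (simp add: vec3_eq_iff)

text \<open>The line spanned by u and v, where [u] is not a tangency point. Every tangency point is
  then [v + t u] for a root t of g, since the radial relation makes the component along v equal to
  -t g(t). The order of tangency is the order of the root, and the total is
  \<open>degree g\<close>.\<close>

context
  fixes \<omega> :: "complex^3 \<Rightarrow> complex^3" and n :: nat and u v :: "complex^3" and g :: "complex poly"
  assumes fol: "form_foliation (Suc n) \<omega>"
    and uv: "cross u v \<noteq> 0"
    and nontangent: "pairing (\<omega> u) v \<noteq> 0"
    and g: "\<And>t. poly g t = pairing (\<omega> (v + t *s u)) u"
    and g0: "g \<noteq> 0"
begin

lemma pairing_at_root_param: "pairing (\<omega> (v + t *s u)) v = - t * poly g t"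
proof -
  have "pairing (\<omega> (v + t *s u)) (v + t *s u) = 0" by (rule form_foliation_radial[OF fol])
  then show ?thesis unfolding g pairing_add pairing_scale by (simp add: add_eq_0_iff)
qed

lemma cross_root_param: "cross u (v + t *s u) = cross u v"
  by (simp add: cross_add_right cross_scale_right)

lemma root_param_nonzero: "v + t *s u \<noteq> 0"
  using cross_root_param[of t] uv by auto

lemma tangency_points_eq:
  "tangency_points \<omega> (vec.span {u, v}) = (\<lambda>t. point (v + t *s u)) ` {t. poly g t = 0}"
proof (intro set_eqI iffI)
  fix P assume "P \<in> tangency_points \<omega> (vec.span {u, v})"
  then obtain p where p: "P = point p" "p \<in> vec.span {u, v}" "p \<noteq> 0"
    "\<forall>w\<in>vec.span {u, v}. pairing (\<omega> p) w = 0"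
    unfolding tangency_points_def by blast
  obtain s r where sr: "p = s *s u + r *s v" using p(2) unfolding span2 by blast
  have uv_in: "u \<in> vec.span {u, v}" "v \<in> vec.span {u, v}" by (auto intro: vec.span_base)
  have "r \<noteq> 0"
  proof
    assume "r = 0"
    then have "p = s *s u" "s \<noteq> 0" using sr p(3) by auto
    then have "pairing (\<omega> p) v = s ^ Suc n * pairing (\<omega> u) v"
      by (simp add: form_foliation_scale[OF fol] pairing_3 algebra_simps)
    then show False using p(4) uv_in nontangent \<open>s \<noteq> 0\<close> by simp
  qed
  then have p_eq: "p = r *s (v + (s / r) *s u)" unfolding sr by (simp add: vec_eq_iff field_simps)
  have "r ^ Suc n * poly g (s / r) = pairing (\<omega> p) u"
    unfolding g by (subst p_eq) (simp only: form_foliation_scale[OF fol] pairing_scale_left)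
  then have "poly g (s / r) = 0" using p(4) uv_in \<open>r \<noteq> 0\<close> by simp
  moreover have "point p = point (v + (s / r) *s u)"
  proof -
    have "point (v + (s / r) *s u) = point p"
      using root_param_nonzero p(3) p_eq \<open>r \<noteq> 0\<close> by (subst point_eq_iff) auto
    then show ?thesis ..
  qed
  ultimately show "P \<in> (\<lambda>t. point (v + t *s u)) ` {t. poly g t = 0}" using p(1) by blast
next
  fix P assume "P \<in> (\<lambda>t. point (v + t *s u)) ` {t. poly g t = 0}"
  then obtain t where t: "P = point (v + t *s u)" "poly g t = 0" by blast
  have "v + t *s u \<in> vec.span {u, v}"
    unfolding span2 by (intro CollectI exI[of _ t] exI[of _ 1]) (simp add: add.commute)
  moreover have "\<forall>w\<in>vec.span {u, v}. pairing (\<omega> (v + t *s u)) w = 0"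
    unfolding span2 using t(2) pairing_at_root_param[of t] g[of t]
    by (auto simp: pairing_add pairing_scale)
  ultimately show "P \<in> tangency_points \<omega> (vec.span {u, v})"
    unfolding tangency_points_def using t(1) root_param_nonzero by blast
qed

lemma inj_root_points: "inj (\<lambda>t. point (v + t *s u))"
proof (rule injI)
  fix t t' assume "point (v + t *s u) = point (v + t' *s u)"
  then obtain c where c: "v + t' *s u = c *s (v + t *s u)"
    using point_eq_iff[OF root_param_nonzero root_param_nonzero] by blast
  have "cross (v + t *s u) (v + t' *s u) = (t - t') *s cross u v"
    by (simp add: vec3_eq_iff algebra_simps)
  moreover have "cross (v + t *s u) (v + t' *s u) = 0"
    unfolding c by (simp only: cross_scale_right cross_self) simp
  ultimately show "t = t'" using uv by auto
qed

text \<open>Covers every choice of p and w in the definition of \<open>tangency_order\<close>. The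
  point p + t w is a multiple of v + (t0 + s) u, where s is a Moebius function of t with a simple
  zero at 0, so the order is that of g at t0.\<close>

lemma zorder_restriction:
  assumes "\<kappa> \<noteq> 0" "\<nu> \<noteq> 0"
    and p: "p = \<kappa> *s (v + t0 *s u)" and w: "w = \<mu> *s (v + t0 *s u) + \<nu> *s u"
  shows "zorder (\<lambda>t. pairing (\<omega> (p + t *s w)) w) 0 = int (order t0 g)"
proof -
  define k where "k = order t0 g"
  obtain h where h: "g = [:- t0, 1:] ^ k * h" "\<not> [:- t0, 1:] dvd h"
    using order_decomp[OF g0, of t0] unfolding k_def by blast
  have ht: "poly h t0 \<noteq> 0" using h(2) by (simp add: poly_eq_0_iff_dvd)
  define G where "G = (\<lambda>t. \<nu> * \<kappa> * (\<kappa> + t * \<mu>) ^ n * (\<nu> / (\<kappa> + t * \<mu>)) ^ k *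
     poly h (t0 + t * \<nu> / (\<kappa> + t * \<mu>)))"
  let ?S = "{t. \<kappa> + t * \<mu> \<noteq> 0}"
  have "zorder (\<lambda>t. pairing (\<omega> (p + t *s w)) w) 0 = int k"
  proof (rule zorder_eqI[of ?S _ G])
    show "open ?S" by (intro open_Collect_neq continuous_intros)
    show "0 \<in> ?S" using assms by simp
    show "G holomorphic_on ?S" unfolding G_def by (auto intro!: holomorphic_intros)
    show "G 0 \<noteq> 0" using assms ht by (simp add: G_def)
    fix t assume "t \<in> ?S" "t \<noteq> 0"
    define a where "a = \<kappa> + t * \<mu>"
    define s where "s = t * \<nu> / a"
    have a: "a \<noteq> 0" using \<open>t \<in> ?S\<close> by (simp add: a_def)
    define q where "q = p + t *s w"
    have as: "a * s = t * \<nu>" using a by (simp add: s_def)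
    have q: "q = a *s (v + (t0 + s) *s u)"
    proof -
      have "q = a *s (v + t0 *s u) + (t * \<nu>) *s u"
        unfolding q_def p w by (simp add: vec_eq_iff a_def algebra_simps)
      also have "\<dots> = a *s (v + (t0 + s) *s u)"
        unfolding as[symmetric] by (simp add: vec_eq_iff algebra_simps)
      finally show ?thesis .
    qed
    \<comment> \<open>The form annihilates q at q, so w may be exchanged for a multiple of
      u.\<close>
    have "a *s w = \<mu> *s q + (\<nu> * \<kappa>) *s u"
      unfolding q_def p w a_def by (simp add: vec_eq_iff algebra_simps)
    then have "a * pairing (\<omega> q) w = \<mu> * pairing (\<omega> q) q + \<nu> * \<kappa> * pairing (\<omega> q) u"
      by (metis pairing_add pairing_scale)
    also have "\<dots> = \<nu> * \<kappa> * pairing (\<omega> q) u"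
      by (simp add: form_foliation_radial[OF fol])
    also have "pairing (\<omega> q) u = a ^ Suc n * poly g (t0 + s)"
      unfolding q g form_foliation_scale[OF fol] by (simp add: pairing_3 algebra_simps)
    also have "poly g (t0 + s) = s ^ k * poly h (t0 + s)" by (simp add: h(1))
    finally have "a * pairing (\<omega> q) w = a * (\<nu> * \<kappa> * a ^ n * (s ^ k * poly h (t0 + s)))"
      by (simp add: algebra_simps)
    then have "pairing (\<omega> q) w = \<nu> * \<kappa> * a ^ n * (s ^ k * poly h (t0 + s))"
      using a by simp
    also have "s ^ k = t ^ k * (\<nu> / a) ^ k" by (simp add: s_def power_mult_distrib power_divide)
    finally show "pairing (\<omega> (p + t *s w)) w = G t * (t - 0) powi int k"
      by (simp add: G_def q_def a_def s_def algebra_simps)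
  qed
  then show ?thesis by (simp add: k_def)
qed

lemma tangency_order_eq:
  "tangency_order \<omega> (vec.span {u, v}) (point (v + t0 *s u)) = order t0 g"
  unfolding tangency_order_def
proof (rule the_equality)
  let ?q = "v + t0 *s u"
  have "vec.span {u, v} = vec.span {?q, u}"
  proof -
    have 1: "cross ?q u \<noteq> 0"
      using uv cross_root_param[of t0] cross_anticommute[of "?q" u] by simp
    have "cross ?q u = (-1) *s cross u v" by (simp add: vec3_eq_iff algebra_simps)
    then show ?thesis
      unfolding span_eq_line[OF uv] span_eq_line[OF 1] using line_scale[of "-1" "cross u v"] by simp
  qed
  then show "\<exists>p w. p \<noteq> 0 \<and> point ?q = point p \<and> vec.span {u, v} = vec.span {p, w} \<and>
     int (order t0 g) = zorder (\<lambda>t. pairing (\<omega> (p + t *s w)) w) 0"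
    using zorder_restriction[of 1 1 ?q t0 u 0] root_param_nonzero
    by (intro exI[of _ ?q] exI[of _ u]) simp
next
  let ?q = "v + t0 *s u"
  fix m assume "\<exists>p w. p \<noteq> 0 \<and> point ?q = point p \<and> vec.span {u, v} = vec.span {p, w} \<and>
     int m = zorder (\<lambda>t. pairing (\<omega> (p + t *s w)) w) 0"
  then obtain p w where pw: "p \<noteq> 0" "point ?q = point p" "vec.span {u, v} = vec.span {p, w}"
     "int m = zorder (\<lambda>t. pairing (\<omega> (p + t *s w)) w) 0" by blast
  obtain \<kappa> where \<kappa>: "\<kappa> \<noteq> 0" "p = \<kappa> *s ?q"
    using pw(2) point_eq_iff[OF root_param_nonzero pw(1)] by blast
  have "w \<in> vec.span {u, v}" unfolding pw(3) by (auto intro: vec.span_base)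
  then obtain a b where "w = a *s u + b *s v" unfolding span2 by blast
  then have w: "w = b *s ?q + (a - b * t0) *s u" by (simp add: vec_eq_iff algebra_simps)
  \<comment> \<open>Otherwise p and w would be proportional and could not span a line containing
    u.\<close>
  have "a - b * t0 \<noteq> 0"
  proof
    assume 0: "a - b * t0 = 0"
    have "u \<in> vec.span {p, w}" unfolding pw(3)[symmetric] by (auto intro: vec.span_base)
    then obtain s r where "u = s *s p + r *s w" unfolding span2 by blast
    then have u: "u = (s * \<kappa> + r * b) *s ?q" unfolding w 0 \<kappa>(2) by (simp add: vec_eq_iff algebra_simps)
    have "cross ?q u = 0" by (subst (2) u) (simp only: cross_scale_right cross_self, simp)
    then show False using cross_root_param[of t0] uv cross_anticommute[of "?q" u] by simp
  qed
  then show "m = order t0 g" using zorder_restriction[OF \<kappa>(1) _ \<kappa>(2) w] pw(4) by simp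
qed

lemma tangency_number_eq: "tangency_number \<omega> (vec.span {u, v}) = degree g"
proof -
  have "tangency_number \<omega> (vec.span {u, v}) = (\<Sum>t | poly g t = 0. order t g)"
    unfolding tangency_number_def tangency_points_eq
    by (subst sum.reindex) (auto simp: tangency_order_eq intro: inj_on_subset[OF inj_root_points])
  then show ?thesis by (simp add: sum_order_complex[OF g0])
qed

end

text \<open>The restrictions g and h of the form, evaluated on u and v, satisfy h + t g = 0 by the
  radial relation. The coefficient of t^N in h is \<open>pairing (\<omega> u) v\<close>, which is
  nonzero, so g has a nonzero coefficient at N - 1, while the one at N is the value of \<omega> at u
  on u, which is zero. Hence \<open>degree g\<close> is exactly N - 1: coefficients of degree d + 1
  mean a foliation of degree d.\<close>

lemma tangency_noninvariant_line:
  assumes fol: "form_foliation N \<omega>" and l: "l \<noteq> 0" "\<not> invariant_line \<omega> (line l)"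
  shows "finite (tangency_points \<omega> (line l)) \<and> N = Suc (tangency_number \<omega> (line l))"
proof -
  obtain u v where uv: "u \<in> line l" "v \<in> line l" "pairing (\<omega> u) v \<noteq> 0"
    using l unfolding invariant_line_def by blast
  have cr: "cross u v \<noteq> 0"
  proof
    assume 0: "cross u v = 0"
    show False
    proof (cases "u = 0")
      case True
      then have "pairing (\<omega> u) v = pairing (\<omega> (0 *s v)) v" by simp
      also have "\<dots> = 0"
        unfolding form_foliation_scale[OF fol] pairing_scale_left form_foliation_radial[OF fol] by simp
      finally show ?thesis using uv(3) by simp
    next
      case False
      then obtain k where "v = k *s u" using cross_eq_0_imp_multiple[OF 0] by blast
      then show ?thesis using uv(3) form_foliation_radial[OF fol] by (simp add: pairing_scale)
    qed
  qed
  have L: "line l = vec.span {u, v}" by (rule line_eq_span[OF l(1) uv(1,2) cr])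
  obtain g where g: "degree g \<le> N" "coeff g N = pairing (\<omega> u) u"
    "\<And>t. pairing (\<omega> (v + t *s u)) u = poly g t"
    using form_on_line[OF form_pairing[OF form_foliation_form[OF fol]]] by metis
  obtain h where h: "degree h \<le> N" "coeff h N = pairing (\<omega> u) v"
    "\<And>t. pairing (\<omega> (v + t *s u)) v = poly h t"
    using form_on_line[OF form_pairing[OF form_foliation_form[OF fol]]] by metis
  have "poly (h + pCons 0 g) t = 0" for t
  proof -
    have "poly (h + pCons 0 g) t = pairing (\<omega> (v + t *s u)) (v + t *s u)"
      by (simp add: g(3) h(3) pairing_add pairing_scale)
    then show ?thesis by (simp add: form_foliation_radial[OF fol])
  qed
  then have "h + pCons 0 g = 0" by (metis poly_all_0_iff_0)
  then have hg: "coeff h k + coeff (pCons 0 g) k = 0" for k by (metis coeff_0 coeff_add)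
  have "N \<noteq> 0"
    using hg[of 0] h(2) uv(3) by (intro notI) simp
  then obtain n where n: "N = Suc n" by (cases N) auto
  have gn: "coeff g n \<noteq> 0" using hg[of "Suc n"] h(2) uv(3) unfolding n by auto
  have "coeff g (Suc n) = 0" using g(2) n form_foliation_radial[OF fol] by simp
  then have "degree g = n"
    using g(1) gn unfolding n by (metis coeff_0 le_antisym le_degree le_Suc_eq leading_coeff_0_iff)
  moreover have "g \<noteq> 0" using gn by auto
  ultimately show ?thesis
    unfolding L n
    using tangency_number_eq[OF fol[unfolded n] cr uv(3) g(3)[symmetric]]
      tangency_points_eq[OF fol[unfolded n] cr uv(3) g(3)[symmetric]] poly_roots_finite[of g]
    by auto
qed

lemma point_on_line_nonzero:
  assumes "cross a b \<noteq> 0"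
  shows "a + t *s b \<noteq> 0"
proof
  assume 0: "a + t *s b = 0"
  have "cross b (a + t *s b) = - cross a b" by (simp add: vec3_eq_iff algebra_simps)
  then show False using assms 0 by simp
qed

lemma infinite_points_on_line:
  assumes "cross a b \<noteq> 0"
  shows "infinite ((\<lambda>t. point (a + t *s b)) ` UNIV)"
proof -
  note nz = point_on_line_nonzero[OF assms]
  have "inj (\<lambda>t. point (a + t *s b))"
  proof (rule injI)
    fix t t' assume "point (a + t *s b) = point (a + t' *s b)"
    then obtain c where c: "a + t' *s b = c *s (a + t *s b)"
      using point_eq_iff[OF nz nz] by blast
    have "cross (a + t *s b) (a + t' *s b) = (t' - t) *s cross a b"
      by (simp add: vec3_eq_iff algebra_simps)
    moreover have "cross (a + t *s b) (a + t' *s b) = 0"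
      unfolding c by (simp only: cross_scale_right cross_self) simp
    ultimately show "t = t'" using assms by auto
  qed
  then show ?thesis using infinite_UNIV_char_0 finite_imageD by blast
qed

lemma nonsingular_point_on_line:
  assumes "form_foliation n \<omega>" "cross a b \<noteq> 0"
  obtains t where "\<omega> (a + t *s b) \<noteq> 0"
proof -
  have "\<exists>t. \<omega> (a + t *s b) \<noteq> 0"
  proof (rule ccontr)
    assume *: "\<not> (\<exists>t. \<omega> (a + t *s b) \<noteq> 0)"
    then have "(\<lambda>t. point (a + t *s b)) ` UNIV \<subseteq> {point p | p. p \<noteq> 0 \<and> \<omega> p = 0}"
      using point_on_line_nonzero[OF assms(2)] by blast
    then show False
      using infinite_points_on_line[OF assms(2)] form_foliation_finite[OF assms(1)]
      by (meson finite_subset)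
  qed
  then show ?thesis using that by blast
qed

text \<open>
  If \<open>p\<close> is a regular point and \<open>w = \<omega>(p)\<close>, then the point \<open>l \<times> w\<close> of a line \<open>l\<close> is a witness of
  the non-invariance of \<open>l\<close>, for all \<open>l\<close> outside a curve of the dual plane.
\<close>

lemma generic_line_not_invariant:
  assumes fol: "form_foliation n \<omega>"
  shows "\<exists>G. form (n + 1) G \<and> (\<exists>l. l \<noteq> 0 \<and> G l \<noteq> 0) \<and>
    (\<forall>l. l \<noteq> 0 \<and> G l \<noteq> 0 \<longrightarrow> \<not> invariant_line \<omega> (line l))"
proof -
  have "cross (axis 1 1) (axis 2 1) \<noteq> 0" by (simp add: vec3_eq_iff axis_def)
  have "cross (axis 1 1) (axis 2 1) \<noteq> 0" by (simp add: vec3_eq_iff axis_def)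
  then obtain t where t: "\<omega> (axis 1 1 + t *s axis 2 1) \<noteq> 0"
    by (rule nonsingular_point_on_line[OF fol])
  define p :: "complex^3" where "p = axis 1 1 + t *s axis 2 1"
  have w0: "\<omega> p \<noteq> 0" using t by (simp add: p_def)
  \<comment> \<open>As the first coordinate of p is 1, the first component of the cross product is
    enough for a witness that G is not zero.\<close>
  have p1: "p $ 1 = 1" by (simp add: p_def axis_def)
  define w where "w = \<omega> p"
  define G where "G = (\<lambda>l. cross (\<omega> (cross l w)) l $ 1)"
  have wp: "pairing w p = 0" unfolding w_def by (rule form_foliation_radial[OF fol])
  obtain j where j: "w $ j \<noteq> 0" using w0 unfolding w_def by (rule nonzero_component)
  define r where "r = (axis j 1 :: complex^3)"
  have wr: "pairing w r = w $ j"
    using exhaust_3[of j] by (auto simp: r_def pairing_3 axis_def)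
  \<comment> \<open>A line through p other than the tangent line w: since w does not vanish at r, it
    meets w exactly in [p].\<close>
  define l where "l = cross p r"
  have "cross l w = (- (w $ j)) *s p"
  proof -
    have "cross (cross p r) w = pairing w p *s r - pairing w r *s p"
      by (simp add: vec3_eq_iff pairing_3 algebra_simps)
    then show ?thesis by (simp add: l_def wp wr vec_eq_iff)
  qed
  then have "\<omega> (cross l w) = (- (w $ j)) ^ n *s w"
    using form_foliation_scale[OF fol, of "- (w $ j)" p] by (simp only: w_def)
  then have "cross (\<omega> (cross l w)) l = (- (w $ j)) ^ n *s cross w (cross p r)"
    by (simp add: l_def vec3_eq_iff algebra_simps)
  also have "cross w (cross p r) = pairing w r *s p - pairing w p *s r"
    by (simp add: vec3_eq_iff pairing_3 algebra_simps)
  finally have "cross (\<omega> (cross l w)) l $ 1 = ((- (w $ j)) ^ n *s (pairing w r *s p - pairing w p *s r)) $ 1"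
    by (simp only:)
  then have "G l = (- (w $ j)) ^ n * w $ j"
    unfolding G_def by (simp only: wp wr) (simp add: p1)
  then have Gl: "G l \<noteq> 0" using j by simp
  then have l0: "l \<noteq> 0" by (auto simp: G_def)
  have "\<not> invariant_line \<omega> (line l)" if l: "l \<noteq> 0" "G l \<noteq> 0" for l
  proof
    assume inv: "invariant_line \<omega> (line l)"
    obtain a b where ab: "a \<in> line l" "b \<in> line l" "cross a b \<noteq> 0" using line_has_basis[OF l(1)] .
    have "cross l w \<in> line l" by (simp add: pairing_3 algebra_simps)
    then have "pairing (\<omega> (cross l w)) a = 0" "pairing (\<omega> (cross l w)) b = 0"
      using inv ab unfolding invariant_line_def by blast+
    then obtain k where k: "\<omega> (cross l w) = k *s cross a b"
      using annihilator_multiple_of_cross ab(3) by blast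
    obtain k' where k': "l = k' *s cross a b"
      using annihilator_multiple_of_cross[of l a b] ab by auto
    have "cross (\<omega> (cross l w)) l = 0"
      unfolding k by (subst k') (simp add: vec3_eq_iff algebra_simps)
    then show False using l(2) unfolding G_def by (metis zero_index)
  qed
  moreover have "form (n + 1) G"
  proof -
    have lin: "form 1 (\<lambda>l. cross l w $ i)" for i
    proof -
      have 1: "form 1 (\<lambda>l. l $ a * w $ b - l $ c * w $ d)" for a b c d
        using form_diff[OF form_cmult[OF form.coord[of a], of "w $ b"] form_cmult[OF form.coord[of c], of "w $ d"]]
        by (simp add: mult.commute)
      show ?thesis
        using exhaust_3[of i] 1[of 2 3 3 2] 1[of 3 1 1 3] 1[of 1 2 2 1] by auto
    qed
    have comp: "form n (\<lambda>l. \<omega> (cross l w) $ i)" for i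
      using form_compose[OF form_foliation_form[OF fol, of i] lin] by simp
    show ?thesis
      unfolding G_def cross_components by (intro form_diff form.mult comp form.coord)
  qed
  ultimately show ?thesis using Gl l0 by blast
qed

text \<open>An invariant line has infinitely many tangency points, so a line with finitely many of
  them is not invariant and the count of tangencies applies to it; conversely a generic line is not
  invariant.\<close>

lemma has_degree_form_foliation_iff:
  assumes "form_foliation n \<omega>"
  shows "has_degree \<omega> d \<longleftrightarrow> n = Suc d"
proof
  assume "has_degree \<omega> d"
  then obtain l where l: "l \<noteq> 0" "finite (tangency_points \<omega> (line l))" "tangency_number \<omega> (line l) = d"
    unfolding has_degree_def by blast
  have "\<not> invariant_line \<omega> (line l)"
  proof
    assume inv: "invariant_line \<omega> (line l)"
    obtain a b where ab: "a \<in> line l" "b \<in> line l" "cross a b \<noteq> 0" using line_has_basis[OF l(1)] .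
    have "a + t *s b \<in> line l" for t using ab by (simp add: pairing_add pairing_scale)
    then have "(\<lambda>t. point (a + t *s b)) ` UNIV \<subseteq> tangency_points \<omega> (line l)"
      using inv point_on_line_nonzero[OF ab(3)] unfolding tangency_points_def invariant_line_def by blast
    then show False using infinite_points_on_line[OF ab(3)] l(2) by (meson finite_subset)
  qed
  then show "n = Suc d" using tangency_noninvariant_line[OF assms l(1)] l(3) by simp
next
  assume n: "n = Suc d"
  obtain G where G: "form (n + 1) G" "\<exists>l. l \<noteq> 0 \<and> G l \<noteq> 0"
    "\<And>l. l \<noteq> 0 \<and> G l \<noteq> 0 \<Longrightarrow> \<not> invariant_line \<omega> (line l)"
    using generic_line_not_invariant[OF assms] by blast
  have "finite (tangency_points \<omega> (line l)) \<and> tangency_number \<omega> (line l) = d"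
    if "l \<noteq> 0 \<and> G l \<noteq> 0" for l
    using tangency_noninvariant_line[OF assms _ G(3)[OF that]] that n by simp
  then show "has_degree \<omega> d"
    unfolding has_degree_def homogeneous3_iff_form using G(1,2) by blast
qed

definition reduced_convex_form :: "nat \<Rightarrow> (complex^3 \<Rightarrow> complex^3) \<Rightarrow> bool" where
  "reduced_convex_form d \<omega> \<longleftrightarrow> form_foliation (Suc d) \<omega> \<and> card {L. invariant_line \<omega> L} = 3 * d"

lemma reduced_convex_iff: "reduced_convex d \<omega> \<longleftrightarrow> reduced_convex_form d \<omega>"
  unfolding reduced_convex_def reduced_convex_form_def foliation_iff_form_foliation
  by (metis has_degree_form_foliation_iff)

lemma reduced_convex_form_pull: "reduced_convex_form d \<omega> \<Longrightarrow> invertible M \<Longrightarrow> reduced_convex_form d (pull M \<omega>)"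
  by (simp add: reduced_convex_form_def form_foliation_pull card_invariant_lines_pull)

section \<open>Linear differential equations, divisibility and residues\<close>

text \<open>The coefficient g may vanish away from 0. On a small disc the integrating factor
  exp(-H), where H' = h / g, makes f exp(-H) constant, hence zero; analytic continuation extends
  this to the given disc. It shows that a curve which starts on a line and is tangent to the
  foliation stays on the line.\<close>

lemma zero_if_linear_ode:
  fixes f g h :: "complex \<Rightarrow> complex"
  assumes hol: "f holomorphic_on ball 0 r" "g holomorphic_on ball 0 r" "h holomorphic_on ball 0 r"
    and r: "r > 0" and g0: "g 0 \<noteq> 0" and f0: "f 0 = 0"
    and ode: "\<And>t. t \<in> ball 0 r \<Longrightarrow> g t * deriv f t = f t * h t"
    and t: "t \<in> ball 0 r"
  shows "f t = 0"
proof -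
  have "isCont g 0"
    using hol(2) r by (intro continuous_on_interior[OF holomorphic_on_imp_continuous_on[OF hol(2)]]) auto
  then obtain e where e: "e > 0" "\<And>x. dist 0 x < e \<Longrightarrow> g x \<noteq> 0"
    using continuous_at_avoid[of 0 g 0] g0 by metis
  define \<delta> where "\<delta> = min e r"
  have \<delta>: "\<delta> > 0" using e(1) r by (simp add: \<delta>_def)
  have sub: "ball 0 \<delta> \<subseteq> ball 0 r" by (auto simp: \<delta>_def)
  have gnz: "g x \<noteq> 0" if "x \<in> ball 0 \<delta>" for x using that e(2) by (auto simp: \<delta>_def)
  have "(\<lambda>x. h x / g x) holomorphic_on ball 0 \<delta>"
    using hol sub gnz by (intro holomorphic_on_divide) (auto intro: holomorphic_on_subset)
  then obtain H where H: "\<And>x. x \<in> ball 0 \<delta> \<Longrightarrow> (H has_field_derivative h x / g x) (at x within ball 0 \<delta>)"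
    using holomorphic_convex_primitive'[of "ball 0 \<delta>" "\<lambda>x. h x / g x"] by auto
  define F where "F = (\<lambda>x. f x * exp (- H x))"
  have dF: "(F has_field_derivative 0) (at x within ball 0 \<delta>)" if x: "x \<in> ball 0 \<delta>" for x
  proof -
    have "(f has_field_derivative deriv f x) (at x)"
      using holomorphic_derivI[OF hol(1) open_ball] x sub by blast
    then have f': "(f has_field_derivative deriv f x) (at x within ball 0 \<delta>)"
      by (rule has_field_derivative_at_within)
    have "deriv f x = f x * h x / g x"
      using ode[OF subsetD[OF sub x]] gnz[OF x] by (simp add: field_simps)
    then show ?thesis
      unfolding F_def by (auto intro!: derivative_eq_intros f' H[OF x] simp: algebra_simps)
  qed
  then have "\<exists>c. \<forall>x\<in>ball 0 \<delta>. F x = c"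
    by (intro has_field_derivative_zero_constant) auto
  moreover have "F 0 = 0" by (simp add: F_def f0)
  ultimately have "F x = 0" if "x \<in> ball 0 \<delta>" for x using \<delta> that by (metis centre_in_ball)
  then have fz: "f x = 0" if "x \<in> ball 0 \<delta>" for x using that by (auto simp: F_def)
  show ?thesis
  proof (rule analytic_continuation_open[of "ball 0 \<delta>" "ball 0 r" f "\<lambda>_. 0"])
    show "ball (0::complex) \<delta> \<noteq> {}" using \<delta> by auto
  qed (use hol(1) sub fz t in auto)
qed

lemma form_holomorphic:
  assumes "form n F" "\<And>i. (\<lambda>t. \<gamma> t $ i) holomorphic_on S"
  shows "(\<lambda>t. F (\<gamma> t)) holomorphic_on S"
  using assms(1) by induction (auto intro!: holomorphic_intros assms(2))

lemma lower_form_imp_form: "lower_form n F \<Longrightarrow> \<exists>m. form m F"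
  by (auto simp: lower_form_def form.zero split: nat.splits)

lemma lower_form_holomorphic:
  assumes "lower_form n F" "\<And>i. (\<lambda>t. \<gamma> t $ i) holomorphic_on S"
  shows "(\<lambda>t. F (\<gamma> t)) holomorphic_on S"
  using lower_form_imp_form[OF assms(1)] form_holomorphic assms(2) by blast

lemma zero_if_eq_on_cofinite_poly:
  fixes p :: "complex poly"
  assumes "finite X" "\<And>t. t \<notin> X \<Longrightarrow> poly p t = 0"
  shows "p = 0"
proof (rule poly_eq_if_infinite)
  have "- X \<subseteq> {t. poly p t = poly 0 t}" using assms(2) by auto
  moreover have "infinite (- X)"
    using finite_compl[OF assms(1)] infinite_UNIV_char_0[where 'a = complex] by simp
  ultimately show "infinite {t. poly p t = poly 0 t}" using finite_subset by blast
qed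

lemma form_zero_if_cofinite_on_line:
  assumes "form n F" "finite X" "\<And>t. t \<notin> X \<Longrightarrow> F (u + t *s v) = 0"
  shows "F (u + t *s v) = 0"
proof -
  obtain q where q: "\<And>t. F (u + t *s v) = poly q t" using form_on_line[OF assms(1)] by blast
  then have "q = 0" using zero_if_eq_on_cofinite_poly[OF assms(2), of q] assms(3) by simp
  then show ?thesis using q by simp
qed

abbreviation hc :: "complex \<Rightarrow> complex \<Rightarrow> complex \<Rightarrow> complex^3" where
  "hc x y z \<equiv> vector [x, y, z]"

lemma hc_add: "hc a b c + t *s hc x y z = hc (a + t * x) (b + t * y) (c + t * z)"
  by (simp add: vec3_eq_iff)

lemma hc_scale: "t *s hc x y z = hc (t * x) (t * y) (t * z)"
  by (simp add: vec3_eq_iff)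

lemma zero_hc: "hc 0 0 0 = 0"
  by (simp add: vec3_eq_iff)

lemma hc_plus: "hc a b c + hc x y z = hc (a + x) (b + y) (c + z)"
  by (simp add: vec3_eq_iff)

lemma axis_hc: "axis 1 1 = hc 1 0 0" "axis 2 1 = hc 0 1 0" "axis 3 1 = hc 0 0 1"
  by (simp_all add: vec3_eq_iff axis_def)

text \<open>One plane x = s z is split off at a time. The degree of the quotient is left open since
  only divisibility is used.\<close>

lemma form_divisible_by_planes:
  assumes "finite T" "form n F" "\<And>s y z. s \<in> T \<Longrightarrow> F (hc (s * z) y z) = 0"
  shows "\<exists>m G. form m G \<and> (\<forall>p. F p = (\<Prod>s\<in>T. p $ 1 - s * p $ 3) * G p)"
  using assms(1,3)
proof (induction T rule: finite_induct)
  case empty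
  then show ?case using assms(2) by auto
next
  case (insert s T)
  then obtain m G where G: "form m G" "\<And>p. F p = (\<Prod>s\<in>T. p $ 1 - s * p $ 3) * G p" by auto
  have G0: "G (hc (s * z) y z) = 0" for y z
  proof -
    \<comment> \<open>All the planes meet in x = z = 0, so the factors already split off are nonzero
      on the new plane only for t \<noteq> 0; the remaining parameter follows because the
      restriction is polynomial in t.\<close>
    have "G (hc 0 y 0 + t *s hc s 0 1) = 0" if "t \<notin> {0}" for t
    proof -
      have "F (hc (s * t) y t) = 0" using insert by auto
      moreover have "(\<Prod>s'\<in>T. s * t - s' * t) \<noteq> 0"
        using insert.hyps that by (auto simp: prod_zero_iff)
      ultimately show ?thesis using G(2)[of "hc (s * t) y t"] by (simp add: hc_add mult.commute)
    qed
    then show ?thesis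
      using form_zero_if_cofinite_on_line[OF G(1), of "{0}" "hc 0 y 0" "hc s 0 1" z]
      by (simp add: hc_add mult.commute)
  qed
  \<comment> \<open>Coordinates u = (y, z, x - s z), in which the plane is u_3 = 0 and
    \<open>form_split_third\<close> applies.\<close>
  have lin: "form 1 (\<lambda>u. hc (u $ 3 + s * u $ 2) (u $ 1) (u $ 2) $ i)" for i
    using exhaust_3[of i] form.add[OF form_coord' form_cmult[OF form_coord']] by (auto intro: form_coord')
  have fm: "form m (\<lambda>u. G (hc (u $ 3 + s * u $ 2) (u $ 1) (u $ 2)))"
    using form_compose[OF G(1) lin] by simp
  obtain H where H: "lower_form m H"
    "\<And>u. G (hc (u $ 3 + s * u $ 2) (u $ 1) (u $ 2)) = G (hc (s * u $ 2) (u $ 1) (u $ 2)) + u $ 3 * H u"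
    using form_split_third[OF fm] by (auto simp: add.commute)
  obtain m' where H': "form m' H" using lower_form_imp_form[OF H(1)] by blast
  have lin': "form 1 (\<lambda>p. hc (p $ 2) (p $ 3) (p $ 1 - s * p $ 3) $ i)" for i
    using exhaust_3[of i] form_diff[OF form_coord' form_cmult[OF form_coord']] by (auto intro: form_coord')
  have "form m' (\<lambda>p. H (hc (p $ 2) (p $ 3) (p $ 1 - s * p $ 3)))"
    using form_compose[OF H' lin'] by simp
  moreover have "F p = (\<Prod>s\<in>insert s T. p $ 1 - s * p $ 3) * H (hc (p $ 2) (p $ 3) (p $ 1 - s * p $ 3))" for p
  proof -
    have "G p = (p $ 1 - s * p $ 3) * H (hc (p $ 2) (p $ 3) (p $ 1 - s * p $ 3))"
      using H(2)[of "hc (p $ 2) (p $ 3) (p $ 1 - s * p $ 3)"] G0 vector3_eta[of p] by simp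
    then have "F p = (\<Prod>s\<in>T. p $ 1 - s * p $ 3) *
      ((p $ 1 - s * p $ 3) * H (hc (p $ 2) (p $ 3) (p $ 1 - s * p $ 3)))"
      using G(2)[of p] by (simp only:)
    then show ?thesis using insert.hyps by simp
  qed
  ultimately show ?case by blast
qed

lemma order_linear_poly: "order r [:- a, 1 :: complex:] = (if a = r then 1 else 0)"
  using order_power_n_n[of r 1] by (auto intro: order_0I)

lemma order_prod_complex:
  fixes f :: "'a \<Rightarrow> complex poly"
  assumes "finite I" "\<And>i. i \<in> I \<Longrightarrow> f i \<noteq> 0"
  shows "order r (\<Prod>i\<in>I. f i) = (\<Sum>i\<in>I. order r (f i))"
  using assms
proof (induction I rule: finite_induct)
  case (insert i I)
  then show ?case by (simp add: order_mult)
qed simp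

text \<open>
  \<open>x \<mapsto> (\<alpha>(x), b(x))\<close> is the restriction to \<open>y = 1\<close> of a homogeneous form \<open>A dx + B dy\<close> after a
  shear moving the direction \<open>r\<close> to the vertical one. Its tangent cone is \<open>(x - r) \<alpha> + b\<close>, its
  inflection polynomial the product below, and \<open>k\<close> the number of invariant lines
  having the direction \<open>r\<close>: they account for the whole inflection there.
\<close>

lemma inflection_order_analysis:
  fixes \<alpha> b :: "complex poly" and r :: complex
  defines "W \<equiv> pderiv \<alpha> * b - \<alpha> * pderiv b" and "c \<equiv> [:- r, 1:] * \<alpha> + b"
  assumes nz: "W * c \<noteq> 0" and k: "order r (W * c) = k" "[:- r, 1:] ^ k dvd b" and root: "poly c r = 0"
  shows "poly \<alpha> r \<noteq> 0" "poly (pderiv c) r \<noteq> 0" "1 \<le> k" "poly (pderiv b) r \<noteq> 0 \<Longrightarrow> k = 1" "b \<noteq> 0"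
proof -
  let ?l = "[:- r, 1:]"
  show k1: "1 \<le> k" using nz root k(1) order_root[of "W * c" r] by auto
  show b0: "b \<noteq> 0" using nz by (auto simp: W_def)
  have W0: "W \<noteq> 0" and c0: "c \<noteq> 0" using nz by auto
  have br: "poly b r = 0" using root by (simp add: c_def)
  define m where "m = order r b"
  obtain b' where b': "b = ?l ^ m * b'" using order_decomp[OF b0, of r] unfolding m_def by blast
  have km: "k \<le> m" using k(2) b0 unfolding m_def by (simp add: order_divides)
  obtain j where j: "m = Suc j" using k1 km by (cases m) auto
  \<comment> \<open>If \<alpha> and b both vanished at r, then (x - r)^m would divide W, and the
    root of c would raise the order of W c to m + 1 > k.\<close>
  show ar: "poly \<alpha> r \<noteq> 0"
  proof
    assume "poly \<alpha> r = 0"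
    then obtain a where a: "\<alpha> = ?l * a" by (metis poly_eq_0_iff_dvd dvdE)
    have "?l ^ m dvd W"
    proof -
      define L where "L = ?l"
      have dL: "pderiv L = 1" by (simp add: L_def pderiv_pCons)
      have "pderiv b = L ^ j * (smult (of_nat m) b' + L * pderiv b')"
        unfolding b' j L_def[symmetric]
        by (simp only: pderiv_mult pderiv_power_Suc dL) (simp add: algebra_simps)
      then have "\<alpha> * pderiv b = L ^ m * (a * (smult (of_nat m) b' + L * pderiv b'))"
        unfolding a j L_def[symmetric] by (simp add: algebra_simps)
      then have "W = L ^ m * (pderiv \<alpha> * b' - a * (smult (of_nat m) b' + L * pderiv b'))"
        unfolding W_def using b' unfolding L_def[symmetric] by (simp add: algebra_simps)
      then show ?thesis unfolding L_def by (metis dvd_triv_left)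
    qed
    moreover have "?l dvd c" using root poly_eq_0_iff_dvd by blast
    ultimately have "?l ^ Suc m dvd W * c" by (metis mult_dvd_mono power_Suc2)
    then have "Suc m \<le> k" using nz k(1) order_divides by metis
    then show False using km by simp
  qed
  have simple: "m = 1" if "poly (pderiv b) r \<noteq> 0"
  proof (rule ccontr)
    assume "m \<noteq> 1"
    then have "?l ^ 2 dvd b" unfolding m_def using b0 j m_def by (simp add: order_divides)
    then obtain b'' where "b = ?l ^ 2 * b''" by (elim dvdE)
    then have "poly (pderiv b) r = poly (pderiv (?l * ?l * b'')) r" by (simp only: power2_eq_square)
    also have "\<dots> = 0" by (simp only: pderiv_mult poly_add poly_mult) simp
    finally have "poly (pderiv b) r = 0" .
    then show False using that by simp
  qed
  then show "poly (pderiv b) r \<noteq> 0 \<Longrightarrow> k = 1" using k1 km by auto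
  \<comment> \<open>A double root of c would give b'(r) = -\<alpha>(r) \<noteq> 0, hence k = 1,
    although c alone contributes order 2.\<close>
  show "poly (pderiv c) r \<noteq> 0"
  proof
    assume c': "poly (pderiv c) r = 0"
    have "poly (pderiv c) r = poly \<alpha> r + poly (pderiv b) r"
      unfolding c_def by (simp only: pderiv_add pderiv_mult poly_add poly_mult) (simp add: pderiv_pCons)
    then have "poly (pderiv b) r \<noteq> 0" using c' ar by auto
    then have "k = 1" using simple k1 km by auto
    have "order r c \<ge> 2"
    proof (rule ccontr)
      assume "\<not> 2 \<le> order r c"
      moreover have "order r c \<noteq> 0" using order_root[of c r] root c0 by auto
      ultimately have "order r c = 1" by simp
      moreover have "pderiv c \<noteq> 0"
        using root c0 pderiv_iszero[of c] by auto
      ultimately have "order r (pderiv c) = 0" using order_pderiv[of c r] root c0 by simp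
      then show False using c' order_root \<open>pderiv c \<noteq> 0\<close> by blast
    qed
    moreover have "order r (W * c) = order r W + order r c" using nz by (rule order_mult)
    ultimately show False using k(1) \<open>k = 1\<close> by simp
  qed
qed

text \<open>Lagrange interpolation of \<open>\<alpha>\<close> at the roots of \<open>c\<close>, read off at the leading coefficient.\<close>

lemma sum_residues:
  fixes \<alpha> c :: "complex poly"
  assumes deg: "degree \<alpha> \<le> d" "degree c = Suc d" and simple: "\<And>r. poly c r = 0 \<Longrightarrow> poly (pderiv c) r \<noteq> 0"
  shows "card {r. poly c r = 0} = Suc d"
    and "(\<Sum>r | poly c r = 0. poly \<alpha> r / poly (pderiv c) r) = coeff \<alpha> d / lead_coeff c"
proof -
  have c0: "c \<noteq> 0" using deg(2) by auto
  define R where "R = {r. poly c r = 0}"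
  have fin: "finite R" unfolding R_def by (rule poly_roots_finite[OF c0])
  have "order r c = 1" if "r \<in> R" for r
  proof -
    have r: "poly c r = 0" using that by (simp add: R_def)
    have "pderiv c \<noteq> 0" using simple[OF r] by auto
    moreover have "order r (pderiv c) = 0" using simple[OF r] by (rule order_0I)
    ultimately show ?thesis using order_pderiv[of c r] order_root[of c r] r c0 by simp
  qed
  then have "card R = degree c" using sum_order_complex[OF c0] unfolding R_def by simp
  then show card: "card {r. poly c r = 0} = Suc d" using deg(2) by (simp add: R_def)
  then have cardR: "card R = Suc d" by (simp add: R_def)
  define l where "l = lead_coeff c"
  have l0: "l \<noteq> 0" using c0 by (simp add: l_def)
  have c_eq: "c = smult l (\<Prod>a\<in>R. [:- a, 1:])"
    using poly_eq_prod_roots[OF fin cardR, of c] deg(2) by (auto simp: R_def l_def)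
  define P where "P r = (\<Prod>a\<in>R - {r}. [:- a, 1:])" for r
  have c': "poly (pderiv c) r = l * poly (P r) r" if "r \<in> R" for r
  proof -
    have "c = smult l ([:- r, 1:] * P r)"
      unfolding P_def by (subst c_eq) (simp add: prod.remove[OF fin that])
    then have "pderiv c = smult l ([:- r, 1:] * pderiv (P r) + P r * pderiv [:- r, 1:])"
      by (simp only: pderiv_smult pderiv_mult)
    then show ?thesis by (simp add: pderiv_pCons)
  qed
  have Pdeg: "degree (P r) = d" "coeff (P r) d = 1" if "r \<in> R" for r
  proof -
    have "card (R - {r}) = d" using cardR that fin by simp
    then show deg: "degree (P r) = d" unfolding P_def by (subst degree_prod_eq_sum_degree) auto
    show "coeff (P r) d = 1"
      using lead_coeff_prod[of "\<lambda>a. [:- a, 1 :: complex:]" "R - {r}"] deg unfolding P_def by simp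
  qed
  define Q where "Q = (\<Sum>r\<in>R. smult (poly \<alpha> r / poly (P r) r) (P r))"
  have Pzero: "poly (P r) r' = 0" if "r \<in> R" "r' \<in> R" "r' \<noteq> r" for r r'
    unfolding P_def poly_prod using that fin by (auto simp: prod_zero_iff)
  have Pnz: "poly (P r) r \<noteq> 0" if "r \<in> R" for r
    using c'[OF that] simple[of r] that by (auto simp: R_def)
  have Qval: "poly Q r = poly \<alpha> r" if "r \<in> R" for r
  proof -
    have "poly Q r = (\<Sum>r'\<in>R. poly \<alpha> r' / poly (P r') r' * poly (P r') r)"
      by (simp add: Q_def poly_sum)
    also have "\<dots> = (\<Sum>r'\<in>R. if r' = r then poly \<alpha> r else 0)"
      using Pzero Pnz that by (intro sum.cong) auto
    finally show ?thesis using fin that by simp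
  qed
  have "\<alpha> - Q = 0"
  proof (rule ccontr)
    assume nz: "\<alpha> - Q \<noteq> 0"
    have "degree Q \<le> d"
      unfolding Q_def by (intro degree_sum_le fin) (use Pdeg in \<open>auto intro: order_trans[OF degree_smult_le]\<close>)
    then have "degree (\<alpha> - Q) \<le> d" using deg(1) by (intro degree_diff_le)
    moreover have "card R \<le> card {x. poly (\<alpha> - Q) x = 0}"
      using Qval by (intro card_mono poly_roots_finite nz) auto
    ultimately show False using card_poly_roots_bound[OF nz] cardR by linarith
  qed
  then have "coeff \<alpha> d = coeff Q d" by simp
  also have "\<dots> = (\<Sum>r\<in>R. poly \<alpha> r / poly (P r) r)"
    using Pdeg by (simp add: Q_def coeff_sum)
  also have "\<dots> = (\<Sum>r\<in>R. l * (poly \<alpha> r / poly (pderiv c) r))"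
    using c' l0 by (intro sum.cong) auto
  finally have "coeff \<alpha> d = l * (\<Sum>r\<in>R. poly \<alpha> r / poly (pderiv c) r)"
    by (simp only: sum_distrib_left)
  then show "(\<Sum>r | poly c r = 0. poly \<alpha> r / poly (pderiv c) r) = coeff \<alpha> d / lead_coeff c"
    using l0 by (simp add: R_def[symmetric] l_def[symmetric])
qed

subsection \<open>A foliation near an invariant line\<close>

lemma line_axis3: "line (axis 3 1) = vec.span {hc 1 0 0, hc 0 1 0}"
proof -
  have "cross (hc 1 0 0) (hc 0 1 0) = axis 3 1" by (simp add: vec3_eq_iff axis_def)
  then show ?thesis using span_eq_line[of "hc 1 0 0" "hc 0 1 0"] by (simp add: axis_eq_0_iff)
qed

text \<open>Invariance of z = 0 makes the first two components vanish there, so both are divisible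
  by z; the radial relation then determines the third.\<close>

lemma foliation_with_invariant_line:
  assumes fol: "form_foliation (Suc d) \<omega>" and inv: "invariant_line \<omega> (line (axis 3 1))"
  obtains A B where "form d A" "form d B"
    "\<And>p. \<omega> p = hc (p $ 3 * A p) (p $ 3 * B p) (- (p $ 1 * A p + p $ 2 * B p))"
proof -
  have on_line: "\<omega> (hc x y 0) $ 1 = 0" "\<omega> (hc x y 0) $ 2 = 0" for x y
  proof -
    have "hc x y 0 \<in> line (axis 3 1)" "hc 1 0 0 \<in> line (axis 3 1)" "hc 0 1 0 \<in> line (axis 3 1)"
      by (simp_all add: pairing_3 axis_def)
    then have "pairing (\<omega> (hc x y 0)) (hc 1 0 0) = 0" "pairing (\<omega> (hc x y 0)) (hc 0 1 0) = 0"
      using inv unfolding invariant_line_def by blast+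
    then show "\<omega> (hc x y 0) $ 1 = 0" "\<omega> (hc x y 0) $ 2 = 0" by (simp_all add: pairing_3)
  qed
  obtain A where A: "lower_form (Suc d) A" "\<And>p. \<omega> p $ 1 = \<omega> (hc (p $ 1) (p $ 2) 0) $ 1 + p $ 3 * A p"
    using form_split_third[OF form_foliation_form[OF fol, of 1]] by blast
  obtain B where B: "lower_form (Suc d) B" "\<And>p. \<omega> p $ 2 = \<omega> (hc (p $ 1) (p $ 2) 0) $ 2 + p $ 3 * B p"
    using form_split_third[OF form_foliation_form[OF fol, of 2]] by blast
  have fA: "form d A" and fB: "form d B" using A(1) B(1) by simp_all
  have "\<omega> p $ 3 = - (p $ 1 * A p + p $ 2 * B p)" for p
  proof (rule form_eqI[OF form_foliation_form[OF fol, of 3]])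
    show "form (Suc d) (\<lambda>p. - (p $ 1 * A p + p $ 2 * B p))"
      by (intro form_minus form.add form_coord_mult fA fB)
    fix x y
    have "pairing (\<omega> (hc x y 1)) (hc x y 1) = 0" by (rule form_foliation_radial[OF fol])
    then show "\<omega> (hc x y 1) $ 3 = - (hc x y 1 $ 1 * A (hc x y 1) + hc x y 1 $ 2 * B (hc x y 1))"
      using A(2)[of "hc x y 1"] B(2)[of "hc x y 1"] on_line
      by (simp add: pairing_3 algebra_simps eq_neg_iff_add_eq_0)
  qed
  then have "\<omega> p = hc (p $ 3 * A p) (p $ 3 * B p) (- (p $ 1 * A p + p $ 2 * B p))" for p
    using A(2) B(2) on_line by (simp add: vec3_eq_iff)
  then show thesis using that fA fB by blast
qed

text \<open>
  Here \<open>z = 0\<close> is invariant. The polynomials \<open>\<alpha>\<close> and \<open>\<beta>\<close> describe the foliation along that line, in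
  the coordinate \<open>x\<close> of the points \<open>[x : 1 : 0]\<close>; the point \<open>[1 : 0 : 0]\<close> is regular.
\<close>

locale convex_chart =
  fixes d :: nat and \<omega> :: "complex^3 \<Rightarrow> complex^3" and A B :: "complex^3 \<Rightarrow> complex"
    and DA DB :: "complex^3 \<Rightarrow> complex^3" and \<alpha> \<beta> :: "complex poly"
  assumes d: "d \<ge> 1"
    and convex: "reduced_convex_form d \<omega>"
    and formA: "form d A" and formB: "form d B"
    and \<omega>_eq: "\<And>p. \<omega> p = hc (p $ 3 * A p) (p $ 3 * B p) (- (p $ 1 * A p + p $ 2 * B p))"
    and DA: "\<And>i. lower_form d (\<lambda>p. DA p $ i)"
    and DB: "\<And>i. lower_form d (\<lambda>p. DB p $ i)"
    and gradA: "gradient A DA" and gradB: "gradient B DB"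
    and \<alpha>: "\<And>x. poly \<alpha> x = A (hc x 1 0)" and \<beta>: "\<And>x. poly \<beta> x = B (hc x 1 0)"
    and A_nonzero: "A (hc 1 0 0) \<noteq> 0"

lemma convex_chart_exists:
  assumes "d \<ge> 1" "reduced_convex_form d \<omega>" "invariant_line \<omega> (line (axis 3 1))" "\<omega> (hc 1 0 0) \<noteq> 0"
  obtains A B DA DB \<alpha> \<beta> where "convex_chart d \<omega> A B DA DB \<alpha> \<beta>"
proof -
  have "form_foliation (Suc d) \<omega>" using assms(2) by (simp add: reduced_convex_form_def)
  then obtain A B where AB: "form d A" "form d B"
    "\<And>p. \<omega> p = hc (p $ 3 * A p) (p $ 3 * B p) (- (p $ 1 * A p + p $ 2 * B p))"
    using foliation_with_invariant_line assms(3) by blast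
  obtain DA where DA: "\<And>i. lower_form d (\<lambda>p. DA p $ i)" "gradient A DA"
    using form_gradient[OF AB(1)] by metis
  obtain DB where DB: "\<And>i. lower_form d (\<lambda>p. DB p $ i)" "gradient B DB"
    using form_gradient[OF AB(2)] by metis
  obtain \<alpha> where \<alpha>: "\<And>t. A (hc 0 1 0 + t *s hc 1 0 0) = poly \<alpha> t" using form_on_line[OF AB(1)] by blast
  obtain \<beta> where \<beta>: "\<And>t. B (hc 0 1 0 + t *s hc 1 0 0) = poly \<beta> t" using form_on_line[OF AB(2)] by blast
  have "A (hc 1 0 0) \<noteq> 0"
  proof
    assume "A (hc 1 0 0) = 0"
    then have "\<omega> (hc 1 0 0) = 0" by (simp add: AB(3) vec3_eq_iff)
    then show False using assms(4) by simp
  qed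
  then have "convex_chart d \<omega> A B DA DB \<alpha> \<beta>"
    using assms(1,2) AB DA DB \<alpha> \<beta> by unfold_locales (simp_all add: hc_add)
  then show thesis by (rule that)
qed

section \<open>Invariant lines and the inflection polynomial in the chart\<close>

context convex_chart
begin

lemma fol: "form_foliation (Suc d) \<omega>"
  and card_lines: "card {L. invariant_line \<omega> L} = 3 * d"
  using convex by (simp_all add: reduced_convex_form_def)

lemma finite_lines: "finite {L. invariant_line \<omega> L}"
  using card_lines d by (intro card_ge_0_finite) simp

lemma A_zero: "A 0 = 0" and B_zero: "B 0 = 0"
  using form_scale[OF formA, of 0 0] form_scale[OF formB, of 0 0] d by (simp_all add: power_0_left)

lemma \<omega>_hc: "\<omega> (hc x y z) = hc (z * A (hc x y z)) (z * B (hc x y z)) (- (x * A (hc x y z) + y * B (hc x y z)))"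
  by (subst \<omega>_eq) simp

lemmas deriv_on_line = gradient_on_line[OF gradA] gradient_on_line[OF gradB]

lemma \<alpha>_degree: "degree \<alpha> = d" and lead_coeff_\<alpha>: "coeff \<alpha> d = A (hc 1 0 0)"
  and \<beta>_degree: "degree \<beta> \<le> d"
proof -
  obtain q where q: "degree q \<le> d" "coeff q d = A (hc 1 0 0)" "\<And>t. A (hc 0 1 0 + t *s hc 1 0 0) = poly q t"
    using form_on_line[OF formA] by blast
  have "poly \<alpha> = poly q" by (rule ext) (use q(3) in \<open>simp add: \<alpha> hc_add\<close>)
  then have "\<alpha> = q" by (simp add: poly_eq_poly_eq_iff)
  then show "coeff \<alpha> d = A (hc 1 0 0)" "degree \<alpha> = d"
    using q A_nonzero by (auto intro!: antisym le_degree)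
  obtain q where q: "degree q \<le> d" "\<And>t. B (hc 0 1 0 + t *s hc 1 0 0) = poly q t"
    using form_on_line[OF formB] by blast
  have "poly \<beta> = poly q" by (rule ext) (use q(2) in \<open>simp add: \<beta> hc_add\<close>)
  then show "degree \<beta> \<le> d" using q(1) by (simp add: poly_eq_poly_eq_iff)
qed

text \<open>The pair (r, s) stands for the line x = r y + s z. Every invariant line except z = 0 has
  such an equation, because z = 0 is the only one through the regular point [1:0:0].\<close>

definition other_lines :: "(complex \<times> complex) set" where
  "other_lines = {(r, s). \<forall>y z. r * A (hc (r * y + s * z) y z) + B (hc (r * y + s * z) y z) = 0}"

lemma other_lineD: "(r, s) \<in> other_lines \<Longrightarrow> r * A (hc (r * y + s * z) y z) + B (hc (r * y + s * z) y z) = 0"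
  by (simp add: other_lines_def)

lemma span_other_line: "line (hc 1 (- r) (- s)) = vec.span {hc r 1 0, hc s 0 1}"
proof -
  have "cross (hc r 1 0) (hc s 0 1) = hc 1 (- r) (- s)" by (simp add: vec3_eq_iff)
  moreover have "hc 1 (- r) (- s) \<noteq> 0" by (simp add: vec3_eq_iff)
  ultimately show ?thesis using span_eq_line[of "hc r 1 0" "hc s 0 1"] by simp
qed

text \<open>On the two spanning vectors the form has the common factor r A + B, multiplied by z and
  by -y. These vanish together only for y = z = 0, where A and B are zero since d \<ge> 1.\<close>

lemma invariant_other_line_iff:
  "invariant_line \<omega> (line (hc 1 (- r) (- s))) \<longleftrightarrow> (r, s) \<in> other_lines"
proof -
  have nz: "cross (hc r 1 0) (hc s 0 1) \<noteq> 0" by (simp add: vec3_eq_iff)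
  have pt: "y *s hc r 1 0 + z *s hc s 0 1 = hc (r * y + s * z) y z" for y z
    by (simp add: vec3_eq_iff mult.commute)
  have pair: "pairing (\<omega> (hc (r * y + s * z) y z)) (hc r 1 0) =
      z * (r * A (hc (r * y + s * z) y z) + B (hc (r * y + s * z) y z))"
    "pairing (\<omega> (hc (r * y + s * z) y z)) (hc s 0 1) =
      - (y * (r * A (hc (r * y + s * z) y z) + B (hc (r * y + s * z) y z)))" for y z
    unfolding \<omega>_hc pairing_3 vector_3
    by (simp_all add: algebra_simps)
  have "invariant_line \<omega> (line (hc 1 (- r) (- s))) \<longleftrightarrow>
    (\<forall>y z. z * (r * A (hc (r * y + s * z) y z) + B (hc (r * y + s * z) y z)) = 0 \<and>
           y * (r * A (hc (r * y + s * z) y z) + B (hc (r * y + s * z) y z)) = 0)"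
    unfolding span_other_line invariant_line_span_iff[OF nz] pt pair neg_equal_0_iff_equal ..
  also have "\<dots> \<longleftrightarrow> (r, s) \<in> other_lines"
  proof -
    have "hc 0 0 0 = 0" by (simp add: vec3_eq_iff)
    then have 0: "A (hc 0 0 0) = 0" "B (hc 0 0 0) = 0" using A_zero B_zero by simp_all
    have "(\<forall>y z. z * F y z = 0 \<and> y * F y z = 0) \<longleftrightarrow> (\<forall>y z. F y z = 0)"
      if "F 0 0 = 0" for F :: "complex \<Rightarrow> complex \<Rightarrow> complex"
      using that by (metis mult_eq_0_iff)
    from this[of "\<lambda>y z. r * A (hc (r * y + s * z) y z) + B (hc (r * y + s * z) y z)"]
    show ?thesis using 0 by (simp add: other_lines_def)
  qed
  finally show ?thesis .
qed

lemma bij_other_lines: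
  "bij_betw (\<lambda>(r, s). line (hc 1 (- r) (- s))) other_lines ({L. invariant_line \<omega> L} - {line (axis 3 1)})"
  unfolding bij_betw_def
proof
  show "inj_on (\<lambda>(r, s). line (hc 1 (- r) (- s))) other_lines"
  proof (rule inj_onI, clarify)
    fix r s r' s' assume eq: "line (hc 1 (- r) (- s)) = line (hc 1 (- r') (- s'))"
    have "hc r 1 0 \<in> line (hc 1 (- r) (- s))" "hc s 0 1 \<in> line (hc 1 (- r) (- s))"
      by (simp_all add: pairing_3)
    then have "hc r 1 0 \<in> line (hc 1 (- r') (- s'))" "hc s 0 1 \<in> line (hc 1 (- r') (- s'))"
      using eq by simp_all
    then show "r = r' \<and> s = s'" by (simp add: pairing_3)
  qed
  have ne: "line (hc 1 (- r) (- s)) \<noteq> line (axis 3 1)" for r s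
  proof
    assume eq: "line (hc 1 (- r) (- s)) = line (axis 3 1)"
    have "hc 1 0 0 \<in> line (axis 3 1)" by (simp add: pairing_3 axis_def)
    then have "hc 1 0 0 \<in> line (hc 1 (- r) (- s))" unfolding eq .
    then show False by (simp add: pairing_3)
  qed
  show "(\<lambda>(r, s). line (hc 1 (- r) (- s))) ` other_lines = {L. invariant_line \<omega> L} - {line (axis 3 1)}"
  proof (intro set_eqI iffI)
    fix L assume "L \<in> (\<lambda>(r, s). line (hc 1 (- r) (- s))) ` other_lines"
    then show "L \<in> {L. invariant_line \<omega> L} - {line (axis 3 1)}"
      using ne by (auto simp: invariant_other_line_iff)
  next
    fix L assume L: "L \<in> {L. invariant_line \<omega> L} - {line (axis 3 1)}"
    then obtain l where l: "l \<noteq> 0" "L = line l" by (auto simp: invariant_line_def)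
    \<comment> \<open>Otherwise the line contains [1:0:0], where the foliation is regular with
      tangent line z = 0.\<close>
    have l1: "l $ 1 \<noteq> 0"
    proof
      assume l1: "l $ 1 = 0"
      have "hc 1 0 0 \<in> L" "hc 0 (- l $ 3) (l $ 2) \<in> L" using l l1 by (simp_all add: pairing_3)
      then have "pairing (\<omega> (hc 1 0 0)) (hc 0 (- l $ 3) (l $ 2)) = 0"
        using L unfolding invariant_line_def by blast
      then have "l $ 2 = 0" using A_nonzero by (simp add: \<omega>_hc pairing_3)
      then have "l = l $ 3 *s axis 3 1" "l $ 3 \<noteq> 0" using l1 l(1) by (auto simp: vec3_eq_iff axis_def)
      then have "L = line (axis 3 1)" using l(2) line_scale by metis
      then show False using L by simp
    qed
    have "l = l $ 1 *s hc 1 (- (- l $ 2 / l $ 1)) (- (- l $ 3 / l $ 1))"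
      using l1 by (simp add: vec3_eq_iff)
    then have "L = line (hc 1 (- (- l $ 2 / l $ 1)) (- (- l $ 3 / l $ 1)))"
      using l(2) line_scale[OF l1] by metis
    moreover from this have "(- l $ 2 / l $ 1, - l $ 3 / l $ 1) \<in> other_lines"
      using L invariant_other_line_iff[of "- l $ 2 / l $ 1" "- l $ 3 / l $ 1"] by simp
    ultimately show "L \<in> (\<lambda>(r, s). line (hc 1 (- r) (- s))) ` other_lines" by force
  qed
qed

lemma invariant_axis3: "invariant_line \<omega> (line (axis 3 1))"
proof -
  have nz: "cross (hc 1 0 0) (hc 0 1 0) \<noteq> 0" by (simp add: vec3_eq_iff)
  show ?thesis unfolding line_axis3 invariant_line_span_iff[OF nz]
    by (simp add: hc_scale hc_add \<omega>_eq pairing_3)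
qed

lemma finite_other_lines: "finite other_lines" and card_other_lines: "card other_lines = 3 * d - 1"
proof -
  show "finite other_lines"
    using bij_betw_finite[OF bij_other_lines] finite_lines by simp
  show "card other_lines = 3 * d - 1"
    using bij_betw_same_card[OF bij_other_lines] finite_lines card_lines invariant_axis3
    by (simp add: card_Diff_singleton)
qed

section \<open>The inflection polynomial and its factorization\<close>

text \<open>In the chart z = 1 the vector v = (B, -A) is tangent to the foliation. The expression is
  the derivative along v of A v_1 + B v_2 with v kept fixed, so that its zeros at regular points are
  the inflection points. Every term has degree (d - 1) + 2 d.\<close>

definition inflection :: "complex^3 \<Rightarrow> complex" where
  "inflection p = DA p $ 1 * (B p)\<^sup>2 - (DA p $ 2 + DB p $ 1) * (A p * B p) + DB p $ 2 * (A p)\<^sup>2"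

lemma form_inflection: "form (3 * d - 1) inflection"
proof -
  obtain k where k: "d = Suc k" using d by (cases d) auto
  have D: "form k (\<lambda>p. DA p $ i)" "form k (\<lambda>p. DB p $ i)" for i
    using DA[of i] DB[of i] by (simp_all add: k)
  have eq: "3 * d - 1 = k + (d + d)" using k by simp
  show ?thesis
    unfolding inflection_def eq power2_eq_square
    by (intro form.add form_diff form.mult D formA formB)
qed

text \<open>On the line, B = -r A, so the tangent vector is -A (r, 1), and the derivative of r A + B
  along (r, 1) vanishes.\<close>

lemma inflection_zero_on_lines:
  assumes "(r, s) \<in> other_lines"
  shows "inflection (hc (r * y + s * z) y z) = 0"
proof -
  let ?p = "hc (r * y + s * z) y z" and ?v = "hc r 1 0"
  have "((\<lambda>t. r * A (?p + t *s ?v) + B (?p + t *s ?v)) has_field_derivative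
      r * pairing (DA (?p + 0 *s ?v)) ?v + pairing (DB (?p + 0 *s ?v)) ?v) (at 0)"
    by (intro DERIV_add DERIV_cmult deriv_on_line)
  moreover have "r * A (?p + t *s ?v) + B (?p + t *s ?v) = 0" for t
    using other_lineD[OF assms, of "y + t" z] by (simp only: hc_add) (simp add: algebra_simps)
  ultimately have "r * pairing (DA ?p) ?v + pairing (DB ?p) ?v = 0"
    using DERIV_unique[OF _ DERIV_const] by (auto simp: algebra_simps)
  then have D: "r * (DA ?p $ 1 * r + DA ?p $ 2) + (DB ?p $ 1 * r + DB ?p $ 2) = 0"
    by (simp add: pairing_3)
  have B: "B ?p = - r * A ?p" using other_lineD[OF assms, of y z] by (simp add: add_eq_0_iff)
  have "inflection ?p = (A ?p)\<^sup>2 * (r * (DA ?p $ 1 * r + DA ?p $ 2) + (DB ?p $ 1 * r + DB ?p $ 2))"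
    unfolding inflection_def B by (simp add: algebra_simps power2_eq_square)
  then show ?thesis using D by simp
qed

text \<open>For every other z the 3 d - 1 invariant lines meet y = 1 at this height in distinct
  points; two of them coincide for at most one z.\<close>

lemma finite_coincidences: "finite {z. \<not> inj_on (\<lambda>(r, s). r + s * z) other_lines}"
proof (rule finite_subset)
  let ?X = "\<lambda>(r, s). \<lambda>(r', s'). {z. (r, s) \<noteq> (r', s') \<and> r + s * z = r' + s' * (z :: complex)}"
  show "{z. \<not> inj_on (\<lambda>(r, s). r + s * z) other_lines} \<subseteq> (\<Union>a\<in>other_lines. \<Union>b\<in>other_lines. ?X a b)"
    unfolding inj_on_def by force
  have "finite (?X a b)" for a b
  proof -
    obtain r s r' s' where ab: "a = (r, s)" "b = (r', s')" by (cases a, cases b) auto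
    have "?X a b \<subseteq> {(r' - r) / (s - s')}"
    proof
      fix z assume "z \<in> ?X a b"
      then have z: "(r, s) \<noteq> (r', s')" "r + s * z = r' + s' * z" by (auto simp: ab)
      then have "s \<noteq> s'" by auto
      moreover have "(s - s') * z = r' - r" using z(2) by (simp add: algebra_simps)
      ultimately show "z \<in> {(r' - r) / (s - s')}" by (simp add: field_simps)
    qed
    then show ?thesis by (rule finite_subset) simp
  qed
  then show "finite (\<Union>a\<in>other_lines. \<Union>b\<in>other_lines. ?X a b)"
    using finite_other_lines by blast
qed

lemma inflection_product_generic:
  assumes inj: "inj_on (\<lambda>(r, s). r + s * z) other_lines"
  shows "inflection (hc x 1 z) = inflection (hc 1 0 0) * (\<Prod>(r, s)\<in>other_lines. x - r - s * z)"
proof -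
  let ?T = "(\<lambda>(r, s). r + s * z) ` other_lines"
  have "inflection (hc 0 1 z + a *s hc 1 0 0) = 0" if a: "a \<in> ?T" for a
  proof -
    obtain r s where "a = r + s * z" "(r, s) \<in> other_lines" using a by auto
    then show ?thesis
      using inflection_zero_on_lines[of r s 1 z]
      by (simp only: hc_add mult_1_right mult_zero_right add_0 add_0_right)
  qed
  then have "inflection (hc 0 1 z + x *s hc 1 0 0) = inflection (hc 1 0 0) * (\<Prod>a\<in>?T. x - a)"
    using card_image[OF inj] card_other_lines finite_other_lines
    by (intro form_eq_prod_roots_on_line[OF form_inflection]) auto
  also have "(\<Prod>a\<in>?T. x - a) = (\<Prod>(r, s)\<in>other_lines. x - r - s * z)"
    by (subst prod.reindex[OF inj]) (auto intro!: prod.cong simp: algebra_simps)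
  finally show ?thesis by (simp add: hc_add)
qed

text \<open>Counting roots fails where some of them coincide, in particular at z = 0 for lines of
  equal direction. For fixed x, however, both sides are polynomials in z that agree off a finite
  set. The case z = 0 yields the multiplicities used below.\<close>

lemma inflection_product:
  "inflection (hc x 1 z) = inflection (hc 1 0 0) * (\<Prod>(r, s)\<in>other_lines. x - r - s * z)"
proof -
  obtain q where q: "\<And>t. inflection (hc x 1 0 + t *s hc 0 0 1) = poly q t"
    using form_on_line[OF form_inflection] by blast
  define p where "p = smult (inflection (hc 1 0 0)) (\<Prod>(r, s)\<in>other_lines. [:x - r, - s:])"
  have p: "poly p t = inflection (hc 1 0 0) * (\<Prod>(r, s)\<in>other_lines. x - r - s * t)" for t
    by (simp add: p_def poly_prod case_prod_unfold algebra_simps)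
  have "q - p = 0"
  proof (rule zero_if_eq_on_cofinite_poly[OF finite_coincidences])
    fix t assume "t \<notin> {z. \<not> inj_on (\<lambda>(r, s). r + s * z) other_lines}"
    then show "poly (q - p) t = 0"
      using inflection_product_generic[of t x] q[of t] p[of t] by (simp add: hc_add)
  qed
  then show ?thesis using q[of z] p[of z] by (simp add: hc_add)
qed

text \<open>The point is taken on the conic [1:t:t^2], which every line meets for finitely many t;
  finitely many further t are excluded by the singular points, and t = 0 by the third
  coordinate.\<close>

lemma regular_point_off_lines:
  obtains q where "\<omega> q \<noteq> 0" "q $ 3 \<noteq> 0" "\<forall>L. invariant_line \<omega> L \<longrightarrow> q \<notin> L"
proof -
  let ?q = "\<lambda>t :: complex. hc 1 t (t\<^sup>2)"
  have q0: "?q t \<noteq> 0" for t by (simp add: vec3_eq_iff)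
  have "finite {t. ?q t \<in> L}" if L: "invariant_line \<omega> L" for L
  proof -
    obtain l where l: "l \<noteq> 0" "L = line l" using L by (auto simp: invariant_line_def)
    have "{t. ?q t \<in> L} = {t. poly [:l $ 1, l $ 2, l $ 3:] t = 0}"
      using l(2) by (auto simp: pairing_3 algebra_simps power2_eq_square)
    moreover have "[:l $ 1, l $ 2, l $ 3:] \<noteq> 0" using l(1) by (auto simp: vec3_eq_iff)
    ultimately show ?thesis by (metis poly_roots_finite)
  qed
  then have 1: "finite (\<Union>L\<in>{L. invariant_line \<omega> L}. {t. ?q t \<in> L})"
    using finite_lines by blast
  have 2: "finite {t. \<omega> (?q t) = 0}"
  proof (rule finite_imageD)
    show "finite ((\<lambda>t. point (?q t)) ` {t. \<omega> (?q t) = 0})"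
      by (rule finite_subset[OF _ form_foliation_finite[OF fol]]) (use q0 in blast)
    show "inj_on (\<lambda>t. point (?q t)) {t. \<omega> (?q t) = 0}"
      by (rule inj_onI) (auto simp: point_eq_iff[OF q0 q0] vec3_eq_iff)
  qed
  have "infinite (UNIV :: complex set)" by (rule infinite_UNIV_char_0)
  then obtain t where t: "t \<notin> (\<Union>L\<in>{L. invariant_line \<omega> L}. {t. ?q t \<in> L}) \<union> {t. \<omega> (?q t) = 0} \<union> {0}"
    using ex_new_if_finite[of "(\<Union>L\<in>{L. invariant_line \<omega> L}. {t. ?q t \<in> L}) \<union> {t. \<omega> (?q t) = 0} \<union> {0}"] 1 2 by auto
  show thesis by (rule that[of "?q t"]) (use t in auto)
qed

text \<open>
  If the inflection polynomial vanished, the tangent line at a regular point \<open>q\<close> off the finitely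
  many invariant lines would be invariant: the restriction \<open>f\<close> of the form to this line solves
  a linear differential equation.
\<close>

lemma inflection_nonzero: "\<exists>q. inflection q \<noteq> 0"
proof (rule ccontr)
  assume "\<not> (\<exists>q. inflection q \<noteq> 0)"
  then have infl: "inflection p = 0" for p by blast
  obtain q where q: "\<omega> q \<noteq> 0" "q $ 3 \<noteq> 0" "\<forall>L. invariant_line \<omega> L \<longrightarrow> q \<notin> L"
    using regular_point_off_lines by blast
  \<comment> \<open>Together with q this vector spans the tangent line at q, and it lies on the line
    at infinity.\<close>
  define v where "v = hc (B q) (- A q) 0"
  define p where "p t = q + t *s v" for t
  define F where "F = (\<lambda>p. A p * v $ 1 + B p * v $ 2)"
  define f where "f t = F (p t)" for t
  have formF: "form d F"
    unfolding F_def using form.add[OF form_cmult[OF formA, of "v $ 1"] form_cmult[OF formB, of "v $ 2"]]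
    by (simp add: mult.commute)
  define f' where "f' t = v $ 1 * (DA (p t) $ 1 * v $ 1 + DA (p t) $ 2 * v $ 2) +
    v $ 2 * (DB (p t) $ 1 * v $ 1 + DB (p t) $ 2 * v $ 2)" for t
  have v3: "v $ 3 = 0" by (simp add: v_def)
  have "(f has_field_derivative f' t) (at t)" for t
  proof -
    have "((\<lambda>t. A (q + t *s v) * v $ 1 + B (q + t *s v) * v $ 2) has_field_derivative
      pairing (DA (q + t *s v)) v * v $ 1 + pairing (DB (q + t *s v)) v * v $ 2) (at t)"
      by (intro DERIV_add DERIV_cmult_right deriv_on_line)
    then show ?thesis
      unfolding f_def[abs_def] F_def f'_def p_def by (simp add: pairing_3 v3 algebra_simps)
  qed
  then have deriv_f: "deriv f t = f' t" for t by (rule DERIV_imp_deriv)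
  have hol_p: "(\<lambda>t. p t $ i) holomorphic_on S" for i S
    unfolding p_def by (auto intro!: holomorphic_intros)
  note hol = form_holomorphic[OF formA hol_p] form_holomorphic[OF formB hol_p]
    lower_form_holomorphic[OF DA hol_p] lower_form_holomorphic[OF DB hol_p]
    form_holomorphic[OF formF hol_p, folded f_def]
  have f0: "f 0 = 0" by (simp add: f_def F_def p_def v_def)
  have f_zero: "f t = 0" for t
  proof -
    have tin: "t \<in> ball 0 (norm t + 1)" by simp
    have rpos: "norm t + 1 > 0" by (simp add: add_nonneg_pos)
    have "v $ 1 \<noteq> 0 \<or> v $ 2 \<noteq> 0"
      using q(1) by (subst (asm) \<omega>_eq) (auto simp: v_def vec3_eq_iff)
    then show ?thesis
    proof
      assume v1: "v $ 1 \<noteq> 0"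
      \<comment> \<open>Obtained by replacing A v_1 with f - B v_2 in v_1^2
        \<open>inflection\<close>: all terms free of f add up to B^2 f', the others to -f h.\<close>
      define h where "h t = (DA (p t) $ 2 + DB (p t) $ 1) * (B (p t) * v $ 1)
        - DB (p t) $ 2 * (f t - 2 * (B (p t) * v $ 2))" for t
      show ?thesis
      proof (rule zero_if_linear_ode[where f = f and r = "norm t + 1" and g = "\<lambda>t. (B (p t))\<^sup>2" and h = h])
        show "h holomorphic_on ball 0 (norm t + 1)"
          unfolding h_def by (intro holomorphic_intros hol)
        show "(B (p 0))\<^sup>2 \<noteq> 0" using v1 by (simp add: p_def v_def)
        fix s
        have "(v $ 1)\<^sup>2 * inflection (p s) = (B (p s))\<^sup>2 * f' s - f s * h s"
          by (simp add: inflection_def f_def F_def f'_def h_def power2_eq_square algebra_simps)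
        then show "(B (p s))\<^sup>2 * deriv f s = f s * h s" using infl by (simp add: deriv_f)
      qed (intro holomorphic_intros hol rpos f0 tin)+
    next
      assume v2: "v $ 2 \<noteq> 0"
      define h where "h t = (DA (p t) $ 2 + DB (p t) $ 1) * (A (p t) * v $ 2)
        - DA (p t) $ 1 * (f t - 2 * (A (p t) * v $ 1))" for t
      show ?thesis
      proof (rule zero_if_linear_ode[where f = f and r = "norm t + 1" and g = "\<lambda>t. (A (p t))\<^sup>2" and h = h])
        show "h holomorphic_on ball 0 (norm t + 1)"
          unfolding h_def by (intro holomorphic_intros hol)
        show "(A (p 0))\<^sup>2 \<noteq> 0" using v2 by (simp add: p_def v_def)
        fix s
        have "(v $ 2)\<^sup>2 * inflection (p s) = (A (p s))\<^sup>2 * f' s - f s * h s"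
          by (simp add: inflection_def f_def F_def f'_def h_def power2_eq_square algebra_simps)
        then show "(A (p s))\<^sup>2 * deriv f s = f s * h s" using infl by (simp add: deriv_f)
      qed (intro holomorphic_intros hol rpos f0 tin)+
    qed
  qed
  have "v \<noteq> 0"
    using q(1) by (subst (asm) \<omega>_eq) (auto simp: v_def vec3_eq_iff)
  have cr: "cross q v \<noteq> 0"
    using q(2) \<open>v \<noteq> 0\<close> v3 by (auto simp: vec3_eq_iff)
  \<comment> \<open>F vanishes at all q + t v, so its leading coefficient, the value at the point at
    infinity of this line, vanishes too.\<close>
  have Fv: "F v = 0"
  proof -
    obtain k where k: "coeff k d = F v" "\<And>t. F (q + t *s v) = poly k t"
      using form_on_line[OF formF] by blast
    have "k = 0" using f_zero k(2) unfolding f_def p_def by (metis poly_all_0_iff_0)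
    then show ?thesis using k(1) by simp
  qed
  have Fz: "F (s *s q + t *s v) = 0" for s t
  proof (cases "s = 0")
    case True
    then show ?thesis using form_scale[OF formF, of t v] Fv by simp
  next
    case False
    then have "s *s q + t *s v = s *s p (t / s)" by (simp add: p_def vec_eq_iff field_simps)
    then show ?thesis using form_scale[OF formF, of s "p (t / s)"] f_zero by (simp add: f_def)
  qed
  have \<omega>v: "pairing (\<omega> (s *s q + t *s v)) v = 0" for s t
  proof -
    have "pairing (\<omega> x) v = x $ 3 * F x" for x
      by (subst \<omega>_eq) (simp add: pairing_3 v3 F_def algebra_simps)
    then show ?thesis using Fz by simp
  qed
  have \<omega>q: "pairing (\<omega> (s *s q + t *s v)) q = 0" for s t
  proof (cases "s = 0")
    case False
    have "pairing (\<omega> (s *s q + t *s v)) (s *s q + t *s v) = 0" by (rule form_foliation_radial[OF fol])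
    then show ?thesis using \<omega>v[of s t] False by (simp add: pairing_add pairing_scale)
  next
    case True
    have "v $ 1 * A v + v $ 2 * B v = 0" using Fv by (simp add: F_def mult.commute)
    then have "\<omega> v = 0" by (subst \<omega>_eq) (simp add: v3 vec3_eq_iff)
    then have "\<omega> (t *s v) = 0" by (simp add: form_foliation_scale[OF fol])
    then show ?thesis using True by simp
  qed
  have "invariant_line \<omega> (vec.span {q, v})"
    unfolding invariant_line_span_iff[OF cr] using \<omega>v \<omega>q by blast
  then show False using q(3) vec.span_base[of q "{q, v}"] by blast
qed

lemma inflection_lead_nonzero: "inflection (hc 1 0 0) \<noteq> 0"
proof
  assume 0: "inflection (hc 1 0 0) = 0"
  have z: "inflection p = 0" if "p $ 2 \<noteq> 0" for p
  proof -
    have p: "p = p $ 2 *s hc (p $ 1 / p $ 2) 1 (p $ 3 / p $ 2)" using that by (simp add: vec3_eq_iff)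
    show ?thesis
      by (subst p) (simp only: form_scale[OF form_inflection], simp add: inflection_product 0)
  qed
  have "inflection p = 0" for p
  proof -
    have "inflection (p + t *s hc 0 1 0) = 0" if "t \<notin> {- p $ 2}" for t
      using that by (intro z) (simp add: add_eq_0_iff)
    then show ?thesis
      using form_zero_if_cofinite_on_line[OF form_inflection, of "{- p $ 2}" p "hc 0 1 0" 0] by simp
  qed
  then show False using inflection_nonzero by blast
qed

section \<open>Singular directions on the line at infinity, their lines and indices\<close>

definition cone :: "complex poly" where
  "cone = pCons 0 \<alpha> + \<beta>"

definition wronskian :: "complex poly" where
  "wronskian = pderiv \<alpha> * \<beta> - \<alpha> * pderiv \<beta>"

definition directions :: "complex set" where
  "directions = {r. poly cone r = 0}"

definition lines_at :: "complex \<Rightarrow> complex set" where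
  "lines_at r = {s. (r, s) \<in> other_lines}"

text \<open>The residue at r of \<alpha> divided by \<open>cone\<close>, whose roots turn out to be
  simple; \<open>has_CS_index_model\<close> identifies it with the Camacho--Sad index of the line at
  infinity for the homogeneous foliation \<open>model\<close>.\<close>

definition index :: "complex \<Rightarrow> complex" where
  "index r = poly \<alpha> r / poly (pderiv cone) r"

lemma partials_at_infinity:
  shows "DA (hc x 1 0) $ 1 = poly (pderiv \<alpha>) x"
    and "DA (hc x 1 0) $ 2 = of_nat d * poly \<alpha> x - x * poly (pderiv \<alpha>) x"
    and "DB (hc x 1 0) $ 1 = poly (pderiv \<beta>) x"
    and "DB (hc x 1 0) $ 2 = of_nat d * poly \<beta> x - x * poly (pderiv \<beta>) x"
proof -
  have "((\<lambda>t. A (hc 0 1 0 + t *s hc 1 0 0)) has_field_derivative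
    pairing (DA (hc 0 1 0 + x *s hc 1 0 0)) (hc 1 0 0)) (at x)" by (rule deriv_on_line)
  then have "(poly \<alpha> has_field_derivative DA (hc x 1 0) $ 1) (at x)"
    by (simp add: hc_add \<alpha>[abs_def] pairing_3)
  then show A1: "DA (hc x 1 0) $ 1 = poly (pderiv \<alpha>) x" using DERIV_unique poly_DERIV by blast
  have "((\<lambda>t. B (hc 0 1 0 + t *s hc 1 0 0)) has_field_derivative
    pairing (DB (hc 0 1 0 + x *s hc 1 0 0)) (hc 1 0 0)) (at x)" by (rule deriv_on_line)
  then have "(poly \<beta> has_field_derivative DB (hc x 1 0) $ 1) (at x)"
    by (simp add: hc_add \<beta>[abs_def] pairing_3)
  then show B1: "DB (hc x 1 0) $ 1 = poly (pderiv \<beta>) x" using DERIV_unique poly_DERIV by blast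
  show "DA (hc x 1 0) $ 2 = of_nat d * poly \<alpha> x - x * poly (pderiv \<alpha>) x"
    using form_euler[OF formA gradA, of "hc x 1 0"] by (simp add: pairing_3 A1 \<alpha> algebra_simps)
  show "DB (hc x 1 0) $ 2 = of_nat d * poly \<beta> x - x * poly (pderiv \<beta>) x"
    using form_euler[OF formB gradB, of "hc x 1 0"] by (simp add: pairing_3 B1 \<beta> algebra_simps)
qed

text \<open>Only derivatives along z = 0 enter. Euler's relation expresses the second partial
  derivatives by the first ones, and the terms with the factor d cancel.\<close>

lemma inflection_at_infinity: "inflection (hc x 1 0) = poly (wronskian * cone) x"
  unfolding inflection_def partials_at_infinity \<alpha>[symmetric] \<beta>[symmetric] wronskian_def cone_def
  by (simp add: algebra_simps power2_eq_square)

lemma wronskian_cone_eq: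
  "wronskian * cone = smult (inflection (hc 1 0 0)) (\<Prod>(r, s)\<in>other_lines. [:- r, 1:])"
proof -
  have "poly (wronskian * cone) x = poly (smult (inflection (hc 1 0 0)) (\<Prod>(r, s)\<in>other_lines. [:- r, 1:])) x" for x
    unfolding inflection_at_infinity[symmetric] inflection_product
    by (simp add: poly_prod case_prod_unfold)
  then show ?thesis by (simp add: poly_eq_poly_eq_iff[symmetric] fun_eq_iff)
qed

lemma wronskian_cone_nonzero: "wronskian * cone \<noteq> 0"
  unfolding wronskian_cone_eq using inflection_lead_nonzero finite_other_lines
  by (auto simp: prod_zero_iff)

lemma order_wronskian_cone: "order r (wronskian * cone) = card (lines_at r)"
proof -
  have "order r (wronskian * cone) = (\<Sum>a\<in>other_lines. order r (case a of (r, s) \<Rightarrow> [:- r, 1:]))"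
    unfolding wronskian_cone_eq order_smult[OF inflection_lead_nonzero]
    by (rule order_prod_complex[OF finite_other_lines]) auto
  also have "\<dots> = (\<Sum>a\<in>other_lines. if fst a = r then 1 else 0)"
    by (intro sum.cong refl) (auto simp: order_linear_poly)
  also have "\<dots> = card {a \<in> other_lines. fst a = r}"
    by (simp add: sum.If_cases[OF finite_other_lines] Int_def)
  also have "{a \<in> other_lines. fst a = r} = Pair r ` lines_at r"
    by (auto simp: lines_at_def)
  also have "card \<dots> = card (lines_at r)" by (rule card_image) (simp add: inj_on_def)
  finally show ?thesis .
qed

lemma finite_lines_at: "finite (lines_at r)"
  by (rule finite_subset[OF _ finite_imageI[OF finite_other_lines, of snd]])
     (force simp: lines_at_def)

text \<open>The form r A + B vanishes on all invariant lines x = r y + s z. The shear by r y turns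
  them into the planes x = s z, so a product of k linear factors splits off; at z = 0 each factor
  becomes x - r.\<close>

lemma lines_at_divide: "[:- r, 1:] ^ card (lines_at r) dvd smult r \<alpha> + \<beta>"
proof -
  define T where "T p = hc (p $ 1 + r * p $ 2) (p $ 2) (p $ 3)" for p :: "complex^3"
  define F where "F p = r * A (T p) + B (T p)" for p
  have T: "form 1 (\<lambda>p. T p $ i)" for i
    unfolding T_def using exhaust_3[of i] form.add[OF form_coord' form_cmult[OF form_coord']]
    by (auto intro: form_coord')
  have formF: "form d F"
    unfolding F_def using form_compose[OF formA T] form_compose[OF formB T]
    by (intro form.add form_cmult) simp_all
  have "F (hc (s * z) y z) = 0" if "s \<in> lines_at r" for s y z
    using other_lineD[of r s y z] that by (simp add: F_def T_def lines_at_def add.commute)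
  then obtain m G where G: "form m G" "\<And>p. F p = (\<Prod>s\<in>lines_at r. p $ 1 - s * p $ 3) * G p"
    using form_divisible_by_planes[OF finite_lines_at formF] by blast
  obtain g where g: "\<And>t. G (hc (- r) 1 0 + t *s hc 1 0 0) = poly g t" using form_on_line[OF G(1)] by blast
  have "poly (smult r \<alpha> + \<beta>) x = poly ([:- r, 1:] ^ card (lines_at r) * g) x" for x
  proof -
    have "poly (smult r \<alpha> + \<beta>) x = F (hc (x - r) 1 0)"
      by (simp add: F_def T_def \<alpha> \<beta>)
    also have "\<dots> = (x - r) ^ card (lines_at r) * G (hc (x - r) 1 0)"
      by (simp add: G(2))
    also have "G (hc (x - r) 1 0) = poly g x" using g[of x] by (simp add: hc_add)
    finally show ?thesis by simp
  qed
  then have "smult r \<alpha> + \<beta> = [:- r, 1:] ^ card (lines_at r) * g"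
    by (simp add: poly_eq_poly_eq_iff[symmetric] fun_eq_iff)
  then show ?thesis by simp
qed

text \<open>Replacing \<beta> by b = r \<alpha> + \<beta> does not change the Wronskian, and the
  cone becomes (x - r) \<alpha> + b. As b is nonzero of degree at most d and divisible by (x - r)^k,
  k is at most d. The derivative of the cone at r is \<alpha>(r) + b'(r), so an index other than 1
  means b'(r) \<noteq> 0.\<close>

lemma singular_direction:
  assumes "r \<in> directions"
  shows "poly \<alpha> r \<noteq> 0" "poly (pderiv cone) r \<noteq> 0" "1 \<le> card (lines_at r)" "card (lines_at r) \<le> d"
    and "index r \<noteq> 1 \<Longrightarrow> card (lines_at r) = 1"
proof -
  let ?b = "smult r \<alpha> + \<beta>"
  have c: "cone = [:- r, 1:] * \<alpha> + ?b" by (simp add: cone_def)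
  have W: "wronskian = pderiv \<alpha> * ?b - \<alpha> * pderiv ?b"
    by (simp add: wronskian_def pderiv_add pderiv_smult algebra_simps)
  note * = inflection_order_analysis[of \<alpha> ?b r "card (lines_at r)", folded c W,
      OF wronskian_cone_nonzero order_wronskian_cone lines_at_divide]
  have root: "poly cone r = 0" using assms by (simp add: directions_def)
  show "poly \<alpha> r \<noteq> 0" "poly (pderiv cone) r \<noteq> 0" "1 \<le> card (lines_at r)" using *[OF root] by auto
  have "degree ([:- r, 1:] ^ card (lines_at r)) \<le> degree ?b"
    by (rule dvd_imp_degree_le[OF lines_at_divide *(5)[OF root]])
  also have "degree ?b \<le> d"
    using \<alpha>_degree \<beta>_degree by (intro degree_add_le order_trans[OF degree_smult_le]) auto
  finally show "card (lines_at r) \<le> d" by (simp add: degree_linear_power)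
  assume "index r \<noteq> 1"
  moreover have "poly (pderiv cone) r = poly \<alpha> r + poly (pderiv ?b) r"
    unfolding c by (simp only: pderiv_add pderiv_mult poly_add poly_mult) (simp add: pderiv_pCons)
  ultimately have "poly (pderiv ?b) r \<noteq> 0"
    using \<open>poly \<alpha> r \<noteq> 0\<close> by (intro notI) (simp add: index_def)
  then show "card (lines_at r) = 1" using *(4)[OF root] by simp
qed

lemma index_nonzero: "r \<in> directions \<Longrightarrow> index r \<noteq> 0"
  using singular_direction(1,2) by (simp add: index_def)

lemma degree_cone: "degree cone = Suc d" and lead_coeff_cone: "lead_coeff cone = coeff \<alpha> d"
proof -
  have "\<alpha> \<noteq> 0" using A_nonzero lead_coeff_\<alpha> by auto
  then have "degree (pCons 0 \<alpha>) = Suc d" using \<alpha>_degree by simp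
  then show *: "degree cone = Suc d"
    unfolding cone_def using \<beta>_degree by (subst degree_add_eq_left) auto
  show "lead_coeff cone = coeff \<alpha> d"
    unfolding * using \<beta>_degree by (simp add: cone_def coeff_eq_0)
qed

text \<open>The Camacho--Sad formula for a line, of self-intersection 1: by interpolation the sum is
  a quotient of leading coefficients, and these agree for \<alpha> and \<open>cone\<close> as
  \<beta> has degree at most d.\<close>

lemma card_directions: "card directions = Suc d" and sum_index: "(\<Sum>r\<in>directions. index r) = 1"
proof -
  have "poly cone r = 0 \<Longrightarrow> poly (pderiv cone) r \<noteq> 0" for r
    using singular_direction(2) by (simp add: directions_def)
  note * = sum_residues[OF _ degree_cone this, of \<alpha>]
  show "card directions = Suc d" using *(1) \<alpha>_degree by (simp add: directions_def)
  show "(\<Sum>r\<in>directions. index r) = 1"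
    using *(2) \<alpha>_degree lead_coeff_cone lead_coeff_\<alpha> A_nonzero by (simp add: directions_def index_def)
qed

lemma finite_directions: "finite directions"
  using card_directions by (intro card_ge_0_finite) simp

lemma other_line_direction: "(r, s) \<in> other_lines \<Longrightarrow> r \<in> directions"
  using other_lineD[of r s 1 0] by (simp add: directions_def cone_def \<alpha> \<beta>)

lemma sum_lines_at: "(\<Sum>r\<in>directions. card (lines_at r)) = 3 * d - 1"
proof -
  have "other_lines = Sigma directions lines_at"
    using other_line_direction by (auto simp: lines_at_def)
  then show ?thesis
    using card_other_lines card_SigmaI[OF finite_directions, of lines_at] finite_lines_at by simp
qed

end


subsection \<open>The homogeneous foliation of an invariant line\<close>

lemma poly2_mult: "poly2 (p * q) x y = poly2 p x y * poly2 q x y"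
  by (simp add: poly2_def)

lemma poly2_altdef: "poly2 p x y = (\<Sum>j\<le>degree p. poly (coeff p j) x * y ^ j)"
  by (simp add: poly2_def poly_altdef[of p] poly_sum)

text \<open>A common factor c vanishes at most at the origin. If it involves y, then at an x
  \<noteq> 0 that does not kill its leading coefficient it has a zero (x, y); if it involves x only,
  it has a zero (x, 1).\<close>

lemma coprime_if_no_common_zero:
  fixes p q :: "complex poly poly"
  assumes "\<And>x y. poly2 p x y = 0 \<Longrightarrow> poly2 q x y = 0 \<Longrightarrow> x = 0 \<and> y = 0"
  shows "coprime p q"
proof (rule coprimeI)
  fix c assume "c dvd p" "c dvd q"
  then have zero: "x = 0 \<and> y = 0" if "poly2 c x y = 0" for x y
    using assms[of x y] that by (auto simp: poly2_mult elim!: dvdE)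
  have "c \<noteq> 0" using zero[of 1 0] by (auto simp: poly2_def)
  have "degree c = 0"
  proof (rule ccontr)
    assume deg: "degree c \<noteq> 0"
    have "finite ({x. poly (lead_coeff c) x = 0} \<union> {0})"
      using \<open>c \<noteq> 0\<close> by (intro finite_UnI poly_roots_finite) auto
    then obtain x where x: "poly (lead_coeff c) x \<noteq> 0" "x \<noteq> 0"
      using ex_new_if_finite[OF infinite_UNIV_char_0] by blast
    define m where "m = map_poly (\<lambda>h. poly h x) c"
    have m: "coeff m j = poly (coeff c j) x" for j unfolding m_def by (simp add: coeff_map_poly)
    have "degree m = degree c"
      using x(1) by (intro antisym degree_le le_degree) (auto simp: m coeff_eq_0)
    then have "\<not> constant (poly m)" using deg by (simp add: constant_degree)
    then obtain y where "poly m y = 0" using fundamental_theorem_of_algebra by blast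
    then have "poly2 c x y = 0"
      unfolding poly2_altdef using \<open>degree m = degree c\<close> by (simp add: poly_altdef m)
    then show False using zero x(2) by blast
  qed
  then obtain h where h: "c = [:h:]" by (metis degree_eq_zeroE)
  have "constant (poly h)"
  proof (rule ccontr)
    assume "\<not> constant (poly h)"
    then obtain x where "poly h x = 0" using fundamental_theorem_of_algebra by blast
    then have "poly2 c x 1 = 0" by (simp add: poly2_def h)
    then show False using zero[of x 1] by simp
  qed
  then have "degree h = 0" by (simp add: constant_degree)
  then obtain a where "h = [:a:]" by (metis degree_eq_zeroE)
  then show "is_unit c" using h \<open>c \<noteq> 0\<close> by (simp add: is_unit_const_poly_iff dvd_field_iff)
qed

text \<open>The polynomial y^n p(x / y), with y as the outer variable as in
  \<open>poly2\<close>.\<close>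

definition homogenization :: "nat \<Rightarrow> complex poly \<Rightarrow> complex poly poly" where
  "homogenization n p = (\<Sum>i\<le>n. monom (monom (coeff p i) i) (n - i))"

lemma homogeneous_homogenization: "homogeneous_poly2 n (homogenization n p)"
  unfolding homogeneous_poly2_def
proof (intro allI impI)
  fix i j assume "coeff (coeff (homogenization n p) j) i \<noteq> 0"
  then have "(\<Sum>k\<le>n. coeff (coeff (monom (monom (coeff p k) k) (n - k)) j) i) \<noteq> 0"
    by (simp add: homogenization_def coeff_sum)
  then obtain k where "k \<in> {..n}" "coeff (coeff (monom (monom (coeff p k) k) (n - k)) j) i \<noteq> 0"
    by (rule sum.not_neutral_contains_not_neutral)
  then show "i + j = n" by (auto split: if_splits)
qed

lemma poly2_homogenization: "poly2 (homogenization n p) x y = (\<Sum>i\<le>n. coeff p i * x ^ i * y ^ (n - i))"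
  by (simp add: homogenization_def poly2_def poly_sum poly_monom)

lemma form_restrict_eq_homogenization:
  assumes "form n F" "\<And>x. F (hc x 1 0) = poly p x"
  shows "F (hc x y 0) = poly2 (homogenization n p) x y"
proof -
  obtain q where q: "degree q \<le> n" "coeff q n = F (hc 1 0 0)" "\<And>t. F (hc 0 1 0 + t *s hc 1 0 0) = poly q t"
    using form_on_line[OF assms(1)] by blast
  have "poly p = poly q" by (rule ext) (use q(3) in \<open>simp add: assms(2)[symmetric] hc_add\<close>)
  then have pq: "p = q" by (simp add: poly_eq_poly_eq_iff)
  show ?thesis
  proof (cases "y = 0")
    case False
    have "hc x y 0 = y *s hc (x / y) 1 0" using False by (simp add: hc_scale)
    then have "F (hc x y 0) = y ^ n * poly p (x / y)" using form_scale[OF assms(1)] assms(2) by simp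
    also have "poly p (x / y) = (\<Sum>i\<le>n. coeff p i * (x / y) ^ i)"
      using poly_as_sum_of_monoms'[of p n] q(1) pq by (metis (no_types, lifting) poly_monom poly_sum sum.cong)
    also have "y ^ n * \<dots> = (\<Sum>i\<le>n. coeff p i * x ^ i * y ^ (n - i))"
      unfolding sum_distrib_left using False
      by (intro sum.cong) (auto simp: power_diff power_divide)
    finally show ?thesis by (simp add: poly2_homogenization)
  next
    case True
    have "hc x y 0 = x *s hc 1 0 0" using True by (simp add: hc_scale)
    then have "F (hc x y 0) = coeff p n * x ^ n"
      using form_scale[OF assms(1)] q(2) pq by (simp add: mult.commute)
    also have "\<dots> = (\<Sum>i\<in>{n}. coeff p i * x ^ i * y ^ (n - i))" by simp
    also have "\<dots> = (\<Sum>i\<le>n. coeff p i * x ^ i * y ^ (n - i))"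
      by (rule sum.mono_neutral_left) (auto simp: True)
    finally show ?thesis by (simp add: poly2_homogenization)
  qed
qed

lemma pairing_eq_0_if_dependent:
  assumes "pairing w p = 0" "pairing w q = 0" "cross p q \<noteq> 0" "pairing (cross p q) r = 0"
  shows "pairing w r = 0"
proof -
  obtain k where "w = k *s cross p q" using annihilator_multiple_of_cross assms(1-3) by blast
  then show ?thesis using assms(4) by (simp add: pairing_scale_left)
qed

context convex_chart
begin

text \<open>Setting the third coordinate to 0 in A and B removes the lower degree terms of the
  affine form. Along z = 0 nothing changes, so \<alpha>, \<beta>, the cone and the indices are
  shared with \<omega>.\<close>

definition model :: "complex^3 \<Rightarrow> complex^3" where
  "model p = hc (p $ 3 * A (hc (p $ 1) (p $ 2) 0)) (p $ 3 * B (hc (p $ 1) (p $ 2) 0))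
     (- (p $ 1 * A (hc (p $ 1) (p $ 2) 0) + p $ 2 * B (hc (p $ 1) (p $ 2) 0)))"

lemma tangent_cone_eq:
  assumes "y \<noteq> 0"
  shows "x * A (hc x y 0) + y * B (hc x y 0) = y ^ Suc d * poly cone (x / y)"
proof -
  have "hc x y 0 = y *s hc (x / y) 1 0" using assms by (simp add: hc_scale)
  then have "A (hc x y 0) = y ^ d * poly \<alpha> (x / y)" "B (hc x y 0) = y ^ d * poly \<beta> (x / y)"
    using form_scale[OF formA] form_scale[OF formB] \<alpha> \<beta> by simp_all
  then show ?thesis using assms by (simp add: cone_def algebra_simps)
qed

lemma A_axis: "A (hc x 0 0) = x ^ d * A (hc 1 0 0)"
  using form_scale[OF formA, of x "hc 1 0 0"] by (simp add: hc_scale)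

text \<open>A common zero would be a root of the cone at which \<alpha> vanishes. This provides both
  the coprimality and the isolated singularities of \<open>model\<close>.\<close>

lemma no_common_zero:
  assumes "A (hc x y 0) = 0" "B (hc x y 0) = 0"
  shows "x = 0 \<and> y = 0"
proof (cases "y = 0")
  case True
  then show ?thesis using assms A_axis[of x] A_nonzero by simp
next
  case False
  have "hc x y 0 = y *s hc (x / y) 1 0" using False by (simp add: hc_scale)
  then have "poly \<alpha> (x / y) = 0" using form_scale[OF formA, of y] \<alpha> assms False by simp
  moreover have "poly cone (x / y) = 0" using tangent_cone_eq[OF False, of x] assms False by simp
  ultimately show ?thesis using singular_direction(1)[of "x / y"] by (simp add: directions_def)
qed

lemma form_foliation_model: "form_foliation (Suc d) model"
  unfolding form_foliation_def
proof (intro conjI allI)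
  have T: "form 1 (\<lambda>p. hc (p $ 1) (p $ 2) 0 $ i)" for i
    using exhaust_3[of i] by (auto intro: form_coord' form.zero)
  have "form d (\<lambda>p. A (hc (p $ 1) (p $ 2) 0))" "form d (\<lambda>p. B (hc (p $ 1) (p $ 2) 0))"
    using form_compose[OF formA T] form_compose[OF formB T] by simp_all
  note * = form_coord_mult[OF this(1)] form_coord_mult[OF this(2)]
  fix i show "form (Suc d) (\<lambda>p. model p $ i)"
    using exhaust_3[of i] *(1)[of 3] *(2)[of 3] form_minus[OF form.add[OF *(1)[of 1] *(2)[of 2]]]
    by (auto simp: model_def)
next
  fix p show "pairing (model p) p = 0" by (simp add: model_def pairing_3 algebra_simps)
next
  have "{point p | p. p \<noteq> 0 \<and> model p = 0} \<subseteq> {point (hc 0 0 1)} \<union> (\<lambda>r. point (hc r 1 0)) ` directions"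
  proof clarify
    fix p assume p: "p \<noteq> 0" "model p = 0" "point p \<notin> (\<lambda>r. point (hc r 1 0)) ` directions"
    show "point p = point (hc 0 0 1)"
    proof (cases "p $ 3 = 0")
      case False
      then have "p $ 1 = 0" "p $ 2 = 0"
        using no_common_zero[of "p $ 1" "p $ 2"] p(2) by (auto simp: model_def vec3_eq_iff)
      then have "p = p $ 3 *s hc 0 0 1" by (simp add: vec3_eq_iff)
      moreover have "hc 0 0 1 \<noteq> 0" by (simp add: vec3_eq_iff)
      ultimately have "point (hc 0 0 1) = point p" using point_eq_iff[of "hc 0 0 1" p] p(1) False by blast
      then show ?thesis ..
    next
      case True
      have cone0: "p $ 1 * A (hc (p $ 1) (p $ 2) 0) + p $ 2 * B (hc (p $ 1) (p $ 2) 0) = 0"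
      proof -
        have "model p $ 3 = 0" using p(2) by simp
        then show ?thesis unfolding model_def vector_3 using neg_equal_0_iff_equal by blast
      qed
      have "p $ 2 \<noteq> 0"
      proof
        assume "p $ 2 = 0"
        then have "p $ 1 = 0" using cone0 A_axis[of "p $ 1"] A_nonzero by auto
        then show False using p(1) True \<open>p $ 2 = 0\<close> by (simp add: vec3_eq_iff)
      qed
      then have dir: "p $ 1 / p $ 2 \<in> directions"
        using cone0 tangent_cone_eq[of "p $ 2" "p $ 1"] by (simp add: directions_def)
      have "point p = point (hc (p $ 1 / p $ 2) 1 0)"
      proof -
        have "p = p $ 2 *s hc (p $ 1 / p $ 2) 1 0" using True \<open>p $ 2 \<noteq> 0\<close> by (simp add: vec3_eq_iff)
        moreover have "hc (p $ 1 / p $ 2) 1 0 \<noteq> 0" by (simp add: vec3_eq_iff)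
        ultimately show ?thesis using point_eq_iff[of "hc (p $ 1 / p $ 2) 1 0" p] p(1) \<open>p $ 2 \<noteq> 0\<close> by metis
      qed
      then show ?thesis using p(3) imageI[OF dir, of "\<lambda>r. point (hc r 1 0)"] by simp
    qed
  qed
  then show "finite {point p | p. p \<noteq> 0 \<and> model p = 0}"
    by (rule finite_subset) (intro finite_UnI finite_imageI finite_directions finite.intros)
qed

lemma homogeneous_foliation_model:
  "homogeneous_foliation d model (axis 3 1) (axis 1 1) (axis 2 1)"
  unfolding homogeneous_foliation_def
proof (intro conjI exI)
  show "foliation model" using form_foliation_model foliation_iff_form_foliation by blast
  show "has_degree model d" using has_degree_form_foliation_iff[OF form_foliation_model] by simp
  show "homogeneous_poly2 d (homogenization d \<alpha>)" "homogeneous_poly2 d (homogenization d \<beta>)"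
    by (rule homogeneous_homogenization)+
  note AB = form_restrict_eq_homogenization[OF formA \<alpha>[symmetric]]
    form_restrict_eq_homogenization[OF formB \<beta>[symmetric]]
  show "coprime (homogenization d \<alpha>) (homogenization d \<beta>)"
  proof (rule coprime_if_no_common_zero)
    fix x y assume "poly2 (homogenization d \<alpha>) x y = 0" "poly2 (homogenization d \<beta>) x y = 0"
    then show "x = 0 \<and> y = 0" unfolding AB[symmetric] by (rule no_common_zero)
  qed
  have "basis3 (axis 3 1) (axis 1 1) (axis 2 1)" by (simp add: basis3_def det_3 axis_def)
  moreover have "axis 3 1 + x *s axis 1 1 + y *s axis 2 1 = hc x y 1" for x y :: complex
    by (simp add: vec3_eq_iff axis_def)
  ultimately show "given_in_chart model (axis 3 1) (axis 1 1) (axis 2 1)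
      (poly2 (homogenization d \<alpha>)) (poly2 (homogenization d \<beta>))"
    unfolding given_in_chart_def
    by (auto simp: model_def pairing_3 AB[symmetric] axis_def intro!: exI[of _ 1])
qed

text \<open>In the coordinates (u, v) of the point [r + u : 1 : v], the coefficient of du is v
  \<alpha>(r + u) and that of dv at v = 0 is minus the cone. The quotient is therefore \<alpha>
  divided by the cone, with a simple pole at u = 0.\<close>

lemma has_CS_index_model:
  assumes "r \<in> directions"
  shows "has_CS_index model (vec.span {axis 1 1, axis 2 1}) (point (hc r 1 0)) (index r)"
  unfolding has_CS_index_def
proof (intro conjI exI)
  have nz: "cross (hc 1 0 0) (hc 0 1 0) \<noteq> 0" by (simp add: vec3_eq_iff)
  show "invariant_line model (vec.span {axis 1 1, axis 2 1})"
    unfolding axis_hc invariant_line_span_iff[OF nz]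
    by (simp add: hc_scale hc_add model_def pairing_3)
  show "point (hc r 1 0) = point (hc r 1 0)" ..
  have "r * poly \<alpha> r + poly \<beta> r = 0" using assms by (simp add: directions_def cone_def)
  then show "model (hc r 1 0) = 0" by (simp add: model_def vec3_eq_iff \<alpha> \<beta>)
  show "vec.span {axis 1 1, axis 2 1} = vec.span {hc r 1 0, hc 1 0 0}"
  proof -
    have 1: "cross (hc r 1 0) (hc 1 0 0) \<noteq> 0" by (simp add: vec3_eq_iff)
    have "cross (hc r 1 0) (hc 1 0 0) = (-1) *s cross (hc 1 0 0) (hc 0 1 0)" by (simp add: vec3_eq_iff)
    then show ?thesis
      unfolding axis_hc span_eq_line[OF 1] span_eq_line[OF nz] using line_scale[of "-1"] by simp
  qed
  show "basis3 (hc r 1 0) (hc 1 0 0) (hc 0 0 1)" by (simp add: basis3_def det_3)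
  have pt: "hc r 1 0 + u *s hc 1 0 0 + v *s hc 0 0 1 = hc (r + u) 1 v" for u v
    by (simp add: vec3_eq_iff)
  have Q: "deriv (\<lambda>v. pairing (model (hc (r + u) 1 v)) (hc 1 0 0)) 0 = poly \<alpha> (r + u)" for u
  proof -
    have "(\<lambda>v. pairing (model (hc (r + u) 1 v)) (hc 1 0 0)) = (\<lambda>v. v * poly \<alpha> (r + u))"
      by (simp add: model_def pairing_3 \<alpha>)
    then show ?thesis by simp
  qed
  have P: "pairing (model (hc (r + u) 1 0)) (hc 0 0 1) = - poly cone (r + u)" for u
    by (simp add: model_def pairing_3 cone_def \<alpha> \<beta>)
  obtain g where g: "cone = [:- r, 1:] * g"
    using assms unfolding directions_def by (metis mem_Collect_eq poly_eq_0_iff_dvd dvdE)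
  have gr: "poly g r = poly (pderiv cone) r"
    unfolding g by (simp only: pderiv_mult poly_add poly_mult) (simp add: pderiv_pCons)
  have cone_shift: "poly cone (r + u) = u * poly g (r + u)" for u
    by (simp add: g algebra_simps)
  let ?S = "{u. poly g (r + u) \<noteq> 0}"
  have "residue (\<lambda>u. (poly \<alpha> (r + u) / poly g (r + u)) / (u - 0)) 0 = poly \<alpha> (r + 0) / poly g (r + 0)"
  proof (rule residue_simple[of ?S])
    show "open ?S" by (intro open_Collect_neq continuous_intros)
    show "0 \<in> ?S" using gr singular_direction(2)[OF assms] by simp
    show "(\<lambda>u. poly \<alpha> (r + u) / poly g (r + u)) holomorphic_on ?S"
      by (intro holomorphic_intros) auto
  qed
  moreover have "(\<lambda>u. - poly \<alpha> (r + u) / - poly cone (r + u)) =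
      (\<lambda>u. (poly \<alpha> (r + u) / poly g (r + u)) / (u - 0))"
    by (simp add: cone_shift mult.commute)
  ultimately show "let P = \<lambda>u v. pairing (model (hc r 1 0 + u *s hc 1 0 0 + v *s hc 0 0 1)) (hc 0 0 1);
      Q0 = \<lambda>u. - deriv (\<lambda>v. pairing (model (hc r 1 0 + u *s hc 1 0 0 + v *s hc 0 0 1)) (hc 1 0 0)) 0
    in index r = residue (\<lambda>u. Q0 u / P u 0) 0"
    unfolding Let_def pt Q P by (simp add: index_def gr)
qed

text \<open>By the product formula, a zero of \<open>inflection\<close> on z = 0 is the direction of
  an invariant line, hence a root of the cone.\<close>

lemma inflection_nonzero_off_cone:
  assumes "x * A (hc x y 0) + y * B (hc x y 0) \<noteq> 0"
  shows "inflection (hc x y 0) \<noteq> 0"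
proof (cases "y = 0")
  case True
  then have "x \<noteq> 0" using assms by auto
  moreover have "hc x y 0 = x *s hc 1 0 0" using True by (simp add: hc_scale)
  ultimately show ?thesis
    using form_scale[OF form_inflection, of x "hc 1 0 0"] inflection_lead_nonzero by simp
next
  case False
  have xy: "hc x y 0 = y *s hc (x / y) 1 0" using False by (simp add: hc_scale)
  have "poly cone (x / y) \<noteq> 0" using assms tangent_cone_eq[OF False, of x] by auto
  then have "x / y \<notin> directions" by (simp add: directions_def)
  then have "inflection (hc (x / y) 1 0) \<noteq> 0"
    unfolding inflection_product using other_line_direction inflection_lead_nonzero finite_other_lines
    by (auto simp: prod_zero_iff)
  then show ?thesis unfolding xy form_scale[OF form_inflection] using False by simp
qed

section \<open>Convexity of the homogeneous foliation\<close>

text \<open>A leaf that starts on the line at infinity or on an invariant line through the origin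
  stays there, by uniqueness for a linear equation. On any other leaf an inflection point would be a
  zero of \<open>inflection\<close> off the tangent cone.\<close>

lemma convex_model: "convex_foliation model"
  unfolding convex_foliation_def
proof (intro allI impI, elim conjE)
  fix \<rho> \<gamma>
  assume leaf: "leaf_param model \<rho> \<gamma>"
    and wronski: "det (vector [\<gamma> 0, vderiv \<gamma> 0, vderiv (vderiv \<gamma>) 0] :: complex^3^3) = 0"
  define x y z where "x t = \<gamma> t $ 1" and "y t = \<gamma> t $ 2" and "z t = \<gamma> t $ 3" for t
  define a b where "a t = A (hc (x t) (y t) 0)" and "b t = B (hc (x t) (y t) 0)" for t
  have \<rho>: "\<rho> > 0" and hol: "(\<lambda>t. \<gamma> t $ i) holomorphic_on ball 0 \<rho>" for i
    using leaf by (auto simp: leaf_param_def)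
  have 0: "0 \<in> ball 0 \<rho>" using \<rho> by simp
  have holx: "x holomorphic_on ball 0 \<rho>" and holy: "y holomorphic_on ball 0 \<rho>"
    and holz: "z holomorphic_on ball 0 \<rho>"
    using hol[of 1] hol[of 2] hol[of 3] by (simp_all add: x_def[abs_def] y_def[abs_def] z_def[abs_def])
  have holxy: "(\<lambda>t. hc (x t) (y t) 0 $ i) holomorphic_on ball 0 \<rho>" for i
    using exhaust_3[of i] holx holy by auto
  have hola: "a holomorphic_on ball 0 \<rho>" and holb: "b holomorphic_on ball 0 \<rho>"
    using form_holomorphic[OF formA holxy] form_holomorphic[OF formB holxy]
    by (simp_all add: a_def[abs_def] b_def[abs_def])
  have \<gamma>': "vderiv \<gamma> t = hc (deriv x t) (deriv y t) (deriv z t)" for t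
    by (simp add: vderiv_def vec3_eq_iff x_def[abs_def] y_def[abs_def] z_def[abs_def])
  have \<gamma>'': "vderiv (vderiv \<gamma>) t = hc (deriv (deriv x) t) (deriv (deriv y) t) (deriv (deriv z) t)" for t
    unfolding \<gamma>'[abs_def] by (simp add: vderiv_def vec3_eq_iff)
  have model: "model (\<gamma> t) = hc (z t * a t) (z t * b t) (- (x t * a t + y t * b t))" for t
    by (simp add: model_def a_def b_def x_def y_def z_def)
  have tangent: "z t * a t * deriv x t + z t * b t * deriv y t = (x t * a t + y t * b t) * deriv z t"
    if "t \<in> ball 0 \<rho>" for t
  proof -
    have "pairing (model (\<gamma> t)) (vderiv \<gamma> t) = 0" using leaf that by (simp add: leaf_param_def)
    then show ?thesis by (simp add: model \<gamma>' pairing_3 algebra_simps)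
  qed
  have regular: "model (\<gamma> 0) \<noteq> 0" and immersed: "vderiv \<gamma> 0 \<notin> vec.span {\<gamma> 0}" and \<gamma>0: "\<gamma> 0 \<noteq> 0"
    using leaf 0 by (auto simp: leaf_param_def)
  have dx: "(x has_field_derivative deriv x t) (at t)" and dy: "(y has_field_derivative deriv y t) (at t)"
    and dz: "(z has_field_derivative deriv z t) (at t)" if "t \<in> ball 0 \<rho>" for t
    using holomorphic_derivI[OF _ open_ball that] holx holy holz by blast+
  have hol': "deriv x holomorphic_on ball 0 \<rho>" "deriv y holomorphic_on ball 0 \<rho>"
    "deriv z holomorphic_on ball 0 \<rho>"
    using holomorphic_deriv[OF _ open_ball] holx holy holz by blast+
  consider (infinity) "z 0 = 0" | (radial) "z 0 \<noteq> 0" "x 0 * a 0 + y 0 * b 0 = 0"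
    | (transverse) "z 0 \<noteq> 0" "x 0 * a 0 + y 0 * b 0 \<noteq> 0" by blast
  then show "\<exists>l. l \<noteq> 0 \<and> \<gamma> ` ball 0 \<rho> \<subseteq> line l"
  proof cases
    case infinity
    \<comment> \<open>At a regular point of z = 0 the coefficient x a + y b of z' is nonzero, so the
      tangency relation is a linear equation for z.\<close>
    have "z t = 0" if "t \<in> ball 0 \<rho>" for t
    proof (rule zero_if_linear_ode[where f = z and r = \<rho> and g = "\<lambda>t. x t * a t + y t * b t"
          and h = "\<lambda>t. a t * deriv x t + b t * deriv y t"])
      show "x 0 * a 0 + y 0 * b 0 \<noteq> 0"
      proof
        assume "x 0 * a 0 + y 0 * b 0 = 0"
        then have "model (\<gamma> 0) = hc 0 0 (- 0)" unfolding model infinity by (simp only: mult_zero_left)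
        then show False using regular by (simp add: zero_hc)
      qed
      show "(x t * a t + y t * b t) * deriv z t = z t * (a t * deriv x t + b t * deriv y t)"
        if "t \<in> ball 0 \<rho>" for t
        using tangent[OF that] by (simp add: algebra_simps)
    qed (intro holomorphic_intros hola holb holx holy holz hol' \<rho> infinity that)+
    then have "\<gamma> ` ball 0 \<rho> \<subseteq> line (hc 0 0 1)" by (auto simp: pairing_3 z_def)
    moreover have "hc 0 0 1 \<noteq> 0" by (simp add: vec3_eq_iff)
    ultimately show ?thesis by blast
  next
    case radial
    have "y 0 \<noteq> 0"
    proof
      assume y0: "y 0 = 0"
      then have "x 0 * (x 0 ^ d * A (hc 1 0 0)) = 0" using radial(2) A_axis[of "x 0"] by (simp add: a_def)
      then have "x 0 = 0" using A_nonzero by auto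
      then have "a 0 = 0" "b 0 = 0" using y0 A_zero B_zero by (simp_all add: a_def b_def zero_hc)
      then show False using regular by (simp add: model vec3_eq_iff)
    qed
    define r where "r = x 0 / y 0"
    have x0: "x 0 = r * y 0" using \<open>y 0 \<noteq> 0\<close> by (simp add: r_def)
    have r: "r \<in> directions"
      using radial(2) tangent_cone_eq[OF \<open>y 0 \<noteq> 0\<close>, of "x 0"] \<open>y 0 \<noteq> 0\<close>
      by (simp add: directions_def r_def a_def b_def)
    define T where "T p = hc (p $ 1 + r * p $ 2) (p $ 2) 0" for p :: "complex^3"
    define F where "F p = r * A (T p) + B (T p)" for p
    have T: "form 1 (\<lambda>p. T p $ i)" for i
      unfolding T_def using exhaust_3[of i] form.add[OF form_coord' form_cmult[OF form_coord']]
      by (auto intro: form_coord' form.zero)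
    have formF: "form d F"
      unfolding F_def using form_compose[OF formA T] form_compose[OF formB T]
      by (intro form.add form_cmult) simp_all
    \<comment> \<open>As r is a root of the cone, r A + B vanishes in the direction r; hence r a + b
      has the factor f = x - r y.\<close>
    have "F (hc (s * v) u v) = 0" if "s \<in> {0}" for s u v
    proof -
      have "T (hc (s * v) u v) = u *s hc r 1 0" using that by (simp add: T_def hc_scale mult.commute)
      moreover have "r * poly \<alpha> r + poly \<beta> r = 0" using r by (simp add: directions_def cone_def)
      then have "u ^ d * (r * poly \<alpha> r + poly \<beta> r) = 0" by simp
      ultimately show ?thesis
        by (simp add: F_def form_scale[OF formA] form_scale[OF formB] \<alpha> \<beta> algebra_simps)
    qed
    then obtain m G where G: "form m G" "\<And>p. F p = (\<Prod>s\<in>{0}. p $ 1 - s * p $ 3) * G p"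
      using form_divisible_by_planes[OF _ formF, of "{0}"] by blast
    define f where "f t = x t - r * y t" for t
    define g where "g t = G (hc (f t) (y t) 0)" for t
    have rab: "r * a t + b t = f t * g t" for t
      using G(2)[of "hc (f t) (y t) 0"] by (simp add: F_def T_def f_def g_def a_def b_def)
    have holf: "f holomorphic_on ball 0 \<rho>"
      unfolding f_def[abs_def] by (intro holomorphic_intros holx holy)
    have "(\<lambda>t. hc (f t) (y t) 0 $ i) holomorphic_on ball 0 \<rho>" for i
      using exhaust_3[of i] holf holy by auto
    then have holg: "g holomorphic_on ball 0 \<rho>"
      using form_holomorphic[OF G(1)] by (simp add: g_def[abs_def])
    have df: "deriv f t = deriv x t - r * deriv y t" if "t \<in> ball 0 \<rho>" for t
      unfolding f_def[abs_def] by (intro DERIV_imp_deriv DERIV_diff DERIV_cmult dx dy that)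
    \<comment> \<open>Inserting b = f g - r a and x = f + r y into the tangency relation leaves z a
      f' on one side and a multiple of f on the other; z a is nonzero at 0 because \<alpha>(r)
      is.\<close>
    have "f t = 0" if "t \<in> ball 0 \<rho>" for t
    proof (rule zero_if_linear_ode[where f = f and r = \<rho> and g = "\<lambda>t. z t * a t"
          and h = "\<lambda>t. (a t + y t * g t) * deriv z t - z t * g t * deriv y t"])
      have "hc (x 0) (y 0) 0 = y 0 *s hc r 1 0" using x0 by (simp add: hc_scale mult.commute)
      then have "a 0 = y 0 ^ d * poly \<alpha> r" by (simp add: a_def form_scale[OF formA] \<alpha>)
      then show "z 0 * a 0 \<noteq> 0" using radial(1) \<open>y 0 \<noteq> 0\<close> singular_direction(1)[OF r] by simp
      show "f 0 = 0" by (simp add: f_def x0)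
      fix t :: complex assume t: "t \<in> ball 0 \<rho>"
      have b: "b t = f t * g t - r * a t" using rab[of t] by (simp add: algebra_simps)
      have x: "x t = f t + r * y t" by (simp add: f_def)
      have "z t * a t * deriv x t + z t * (f t * g t - r * a t) * deriv y t =
          ((f t + r * y t) * a t + y t * (f t * g t - r * a t)) * deriv z t"
        using tangent[OF t] unfolding b x .
      then show "z t * a t * deriv f t = f t * ((a t + y t * g t) * deriv z t - z t * g t * deriv y t)"
        unfolding df[OF t] by (simp add: algebra_simps)
    qed (intro holomorphic_intros hola holb holx holy holz holg holf hol' \<rho> that)+
    then have "\<gamma> ` ball 0 \<rho> \<subseteq> line (hc 1 (- r) 0)" by (auto simp: pairing_3 f_def x_def y_def)
    moreover have "hc 1 (- r) 0 \<noteq> 0" by (simp add: vec3_eq_iff)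
    ultimately show ?thesis by blast
  next
    case transverse
    define p where "p = hc (x 0) (y 0) 0"
    define x' y' z' where "x' = deriv x 0" and "y' = deriv y 0" and "z' = deriv z 0"
    \<comment> \<open>Up to the factor z^2 the derivatives of the affine coordinates x / z and y /
      z.\<close>
    define X Y where "X = z 0 * x' - x 0 * z'" and "Y = z 0 * y' - y 0 * z'"
    define a' b' where "a' = DA p $ 1 * x' + DA p $ 2 * y'" and "b' = DB p $ 1 * x' + DB p $ 2 * y'"
    have \<gamma>_eq: "\<gamma> 0 = hc (x 0) (y 0) (z 0)" by (simp add: x_def y_def z_def vec3_eq_iff)
    have cr: "cross (\<gamma> 0) (vderiv \<gamma> 0) \<noteq> 0"
      using cross_eq_0_imp_multiple \<gamma>0 immersed unfolding span1 by blast
    have XY: "X \<noteq> 0 \<or> Y \<noteq> 0"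
    proof (rule ccontr)
      assume "\<not> (X \<noteq> 0 \<or> Y \<noteq> 0)"
      then have 1: "z 0 * x' = x 0 * z'" "z 0 * y' = y 0 * z'" by (simp_all add: X_def Y_def)
      have "z 0 * (x 0 * y' - y 0 * x') = x 0 * (z 0 * y') - y 0 * (z 0 * x')"
        by (simp add: algebra_simps)
      also have "\<dots> = 0" unfolding 1 by (simp add: algebra_simps)
      finally have "z 0 * (x 0 * y' - y 0 * x') = 0" .
      then have "x 0 * y' = y 0 * x'" using transverse(1) by simp
      then have "cross (\<gamma> 0) (vderiv \<gamma> 0) = 0"
        using 1 by (simp add: \<gamma>_eq \<gamma>' vec3_eq_iff x'_def y'_def z'_def)
      then show False using cr by simp
    qed
    \<comment> \<open>The vanishing Wronskian puts the second derivative into the span of the point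
      and its first derivative, both annihilated by the form.\<close>
    have "pairing (model (\<gamma> 0)) (vderiv (vderiv \<gamma>) 0) = 0"
    proof (rule pairing_eq_0_if_dependent[OF _ _ cr])
      show "pairing (model (\<gamma> 0)) (\<gamma> 0) = 0" by (rule form_foliation_radial[OF form_foliation_model])
      show "pairing (model (\<gamma> 0)) (vderiv \<gamma> 0) = 0" using leaf 0 by (simp add: leaf_param_def)
      show "pairing (cross (\<gamma> 0) (vderiv \<gamma> 0)) (vderiv (vderiv \<gamma>) 0) = 0"
        using wronski by (simp only: det_vector3)
    qed
    then have second: "z 0 * a 0 * deriv (deriv x) 0 + z 0 * b 0 * deriv (deriv y) 0 =
        (x 0 * a 0 + y 0 * b 0) * deriv (deriv z) 0"
      by (simp add: model \<gamma>'' pairing_3 algebra_simps)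
    have dxy: "((\<lambda>s. hc (x s) (y s) 0 $ i) has_field_derivative hc x' y' 0 $ i) (at 0)" for i
      using exhaust_3[of i] dx[OF 0] dy[OF 0] by (auto simp: x'_def y'_def)
    have da: "(a has_field_derivative a') (at 0)" and db: "(b has_field_derivative b') (at 0)"
      using gradientD[OF gradA dxy] gradientD[OF gradB dxy]
      by (simp_all add: a_def[abs_def] b_def[abs_def] a'_def b'_def p_def pairing_3)
    have d2: "(deriv x has_field_derivative deriv (deriv x) 0) (at 0)"
      "(deriv y has_field_derivative deriv (deriv y) 0) (at 0)"
      "(deriv z has_field_derivative deriv (deriv z) 0) (at 0)"
      using holomorphic_derivI[OF _ open_ball 0] hol' by blast+
    \<comment> \<open>The tangency relation holds on the whole disc, so its derivative vanishes;
      removing the relation \<open>second\<close> leaves a' X + b' Y = 0.\<close>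
    let ?\<Phi> = "\<lambda>t. z t * a t * deriv x t + z t * b t * deriv y t - (x t * a t + y t * b t) * deriv z t"
    have "(?\<Phi> has_field_derivative
       ((z' * a 0 + a' * z 0) * x' + deriv (deriv x) 0 * (z 0 * a 0))
       + ((z' * b 0 + b' * z 0) * y' + deriv (deriv y) 0 * (z 0 * b 0))
       - (((x' * a 0 + a' * x 0) + (y' * b 0 + b' * y 0)) * z' + deriv (deriv z) 0 * (x 0 * a 0 + y 0 * b 0))) (at 0)"
      unfolding x'_def y'_def z'_def
      by (intro DERIV_diff DERIV_add DERIV_mult da db dx[OF 0] dy[OF 0] dz[OF 0] d2)
    moreover have "(?\<Phi> has_field_derivative 0) (at 0)"
    proof (rule has_field_derivative_transform_within_open[OF DERIV_const open_ball 0])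
      fix t :: complex assume "t \<in> ball 0 \<rho>"
      then show "0 = ?\<Phi> t" using tangent by simp
    qed
    ultimately have "((z' * a 0 + a' * z 0) * x' + deriv (deriv x) 0 * (z 0 * a 0))
       + ((z' * b 0 + b' * z 0) * y' + deriv (deriv y) 0 * (z 0 * b 0))
       - (((x' * a 0 + a' * x 0) + (y' * b 0 + b' * y 0)) * z' + deriv (deriv z) 0 * (x 0 * a 0 + y 0 * b 0)) = 0"
      by (rule DERIV_unique)
    then have ab': "a' * X + b' * Y = 0"
      using second by (simp add: X_def Y_def algebra_simps)
    have ab: "a 0 * X + b 0 * Y = 0"
      using tangent[OF 0] by (simp add: X_def Y_def x'_def y'_def z'_def algebra_simps)
    have eulerA: "x 0 * DA p $ 1 + y 0 * DA p $ 2 = of_nat d * a 0"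
      and eulerB': "x 0 * DB p $ 1 + y 0 * DB p $ 2 = of_nat d * b 0"
      using form_euler[OF formA gradA, of p] form_euler[OF formB gradB, of p] by (simp_all add: p_def a_def b_def pairing_3 mult.commute)
    \<comment> \<open>Since z x' = X + x z' and z y' = Y + y z', Euler's relation turns the extra
      terms into multiples of a and b, which disappear in the combination with X and Y.\<close>
    have za': "z 0 * a' = DA p $ 1 * X + DA p $ 2 * Y + z' * (of_nat d * a 0)"
      unfolding a'_def X_def Y_def eulerA[symmetric] by (simp add: algebra_simps)
    have zb': "z 0 * b' = DB p $ 1 * X + DB p $ 2 * Y + z' * (of_nat d * b 0)"
      unfolding b'_def X_def Y_def eulerB'[symmetric] by (simp add: algebra_simps)
    \<comment> \<open>The quadratic form that \<open>inflection\<close> evaluates at (b, -a). By a X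
      + b Y = 0 this vector is proportional to (X, Y), which gives the two identities with the
      factors X^2 and Y^2, not both zero.\<close>
    define Q where "Q = (DA p $ 1 * X + DA p $ 2 * Y) * X + (DB p $ 1 * X + DB p $ 2 * Y) * Y"
    have "z 0 * (a' * X + b' * Y) = Q + z' * of_nat d * (a 0 * X + b 0 * Y)"
      unfolding distrib_left mult.assoc[symmetric] za' zb' by (simp add: Q_def algebra_simps)
    then have Q: "Q = 0" using ab ab' by simp
    have infl: "inflection p = DA p $ 1 * (b 0)\<^sup>2 - (DA p $ 2 + DB p $ 1) * (a 0 * b 0) + DB p $ 2 * (a 0)\<^sup>2"
      by (simp add: inflection_def p_def a_def b_def)
    have "X\<^sup>2 * inflection p = (b 0)\<^sup>2 * Q + (a 0 * X + b 0 * Y) *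
        (DB p $ 2 * (a 0 * X - b 0 * Y) - (DA p $ 2 + DB p $ 1) * b 0 * X)"
      unfolding infl Q_def by (simp add: power2_eq_square algebra_simps)
    moreover have "Y\<^sup>2 * inflection p = (a 0)\<^sup>2 * Q + (a 0 * X + b 0 * Y) *
        (DA p $ 1 * (b 0 * Y - a 0 * X) - (DA p $ 2 + DB p $ 1) * a 0 * Y)"
      unfolding infl Q_def by (simp add: power2_eq_square algebra_simps)
    ultimately have "inflection p = 0" using XY Q ab by auto
    then show ?thesis
      using inflection_nonzero_off_cone[of "x 0" "y 0"] transverse(2) by (simp add: p_def a_def b_def)
  qed
qed

lemma index_in_CS_values: "r \<in> directions \<Longrightarrow> index r \<in> hom_convex_CS_values d"
  unfolding hom_convex_CS_values_def
  using homogeneous_foliation_model convex_model has_CS_index_model by blast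

end

subsection \<open>Reciprocity of the indices and the count of lines\<close>

lemma transpose_columns3: "transpose (columns3 a b c) *v l = hc (pairing l a) (pairing l b) (pairing l c)"
  by (simp add: columns3_def vec3_eq_iff matrix_vector_mult_def pairing_3 sum_3 mult.commute)

text \<open>
  The indices at the intersection of the line \<open>z = 0\<close> with another invariant line, computed in
  two charts that exchange the roles of the two lines, are mutually inverse.
\<close>

lemma (in convex_chart) reciprocal_chart:
  assumes r: "r \<in> directions"
  obtains M A' B' DA' DB' \<alpha>' \<beta>' where "invertible M" "convex_chart d (pull M \<omega>) A' B' DA' DB' \<alpha>' \<beta>'"
    "0 \<in> convex_chart.directions \<alpha>' \<beta>'" "convex_chart.index \<alpha>' \<beta>' 0 = 1 / index r"
proof -
  obtain s where "s \<in> lines_at r" using singular_direction(3)[OF r] by fastforce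
  then have s: "(r, s) \<in> other_lines" by (simp add: lines_at_def)
  have "cross (hc s 0 1) (hc r 1 0) \<noteq> 0" by (simp add: vec3_eq_iff)
  then obtain t where t: "\<omega> (hc s 0 1 + t *s hc r 1 0) \<noteq> 0"
    by (rule nonsingular_point_on_line[OF fol])
  define g where "g = hc (s + t * r) t 1"
  have g: "\<omega> g \<noteq> 0" using t by (simp add: g_def hc_add)
  \<comment> \<open>The first two columns, a regular point g of the other line and the common point,
    make that line the new z = 0; the old line at infinity, spanned by the last two, becomes x = 0,
    and the common point becomes [0:1:0].\<close>
  define M where "M = columns3 g (hc r 1 0) (hc 1 0 0)"
  have inv: "invertible M" by (simp add: M_def invertible_columns3 pairing_3 g_def)
  have M: "M *v hc x y z = x *s g + y *s hc r 1 0 + z *s hc 1 0 0" for x y z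
    by (simp add: M_def columns3_mult)
  have "invariant_line (pull M \<omega>) (line (axis 3 1))"
  proof -
    have "transpose M *v hc 1 (- r) (- s) = axis 3 1"
      by (simp add: M_def transpose_columns3 pairing_3 g_def vec3_eq_iff axis_def algebra_simps)
    then show ?thesis using pull_line_iff[OF inv, of \<omega> "hc 1 (- r) (- s)"] invariant_other_line_iff s by simp
  qed
  moreover have "pull M \<omega> (hc 1 0 0) \<noteq> 0"
  proof (rule pull_nonzero[OF inv])
    have "M *v hc 1 0 0 = g" by (simp add: M)
    then show "\<omega> (M *v hc 1 0 0) \<noteq> 0" using g by simp
  qed
  ultimately obtain A' B' DA' DB' \<alpha>' \<beta>' where chart: "convex_chart d (pull M \<omega>) A' B' DA' DB' \<alpha>' \<beta>'"
    using convex_chart_exists[OF d reduced_convex_form_pull[OF convex inv]] by blast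
  interpret other: convex_chart d "pull M \<omega>" A' B' DA' DB' \<alpha>' \<beta>' by (rule chart)
  \<comment> \<open>Both sides are minus the third component of the pullback on the other line. The
    derivative at 0 is then -\<alpha>(r): the old numerator becomes the new denominator.\<close>
  have cone': "poly other.cone x = - (x * A (hc r 1 0 + x *s g))" for x
  proof -
    have Mx: "M *v hc x 1 0 = hc r 1 0 + x *s g" by (simp add: M add.commute)
    have "- poly other.cone x = pull M \<omega> (hc x 1 0) $ 3"
      by (simp add: other.\<omega>_hc other.cone_def other.\<alpha> other.\<beta>)
    also have "\<dots> = pairing (\<omega> (hc r 1 0 + x *s g)) (hc 1 0 0)"
      using Mx by (simp add: M_def pull_columns3)
    also have "\<dots> = x * A (hc r 1 0 + x *s g)"
      by (subst \<omega>_eq) (simp add: pairing_3 g_def)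
    finally show ?thesis by (metis minus_minus)
  qed
  have "poly other.cone 0 = 0" by (simp add: cone')
  then have "0 \<in> other.directions" by (simp add: other.directions_def)
  moreover have "poly (pderiv other.cone) 0 = - poly \<alpha> r"
  proof -
    have "((\<lambda>x. - (x * A (hc r 1 0 + x *s g))) has_field_derivative
        - (1 * A (hc r 1 0 + 0 *s g) + pairing (DA (hc r 1 0 + 0 *s g)) g * 0)) (at 0)"
      by (intro DERIV_minus DERIV_mult DERIV_ident deriv_on_line)
    then have "(poly other.cone has_field_derivative - poly \<alpha> r) (at 0)"
      by (simp add: cone'[abs_def] \<alpha>)
    then show ?thesis using DERIV_unique poly_DERIV by blast
  qed
  moreover have "poly \<alpha>' 0 = - poly (pderiv cone) r"
  proof -
    \<comment> \<open>The first component of the pullback along the old line at infinity. Its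
      derivative at z = 0 makes the old denominator the new numerator, with the same sign
      -1.\<close>
    have eq: "z * A' (hc 0 1 0 + z *s hc 0 0 1) = - poly cone (r + z)" for z
    proof -
      have Mz: "M *v hc 0 1 z = hc (r + z) 1 0" by (simp add: M vec3_eq_iff)
      have "z * A' (hc 0 1 z) = pull M \<omega> (hc 0 1 z) $ 1" by (simp add: other.\<omega>_hc)
      also have "\<dots> = pairing (\<omega> (hc (r + z) 1 0)) g"
        using Mz by (simp add: M_def pull_columns3)
      also have "\<dots> = - poly cone (r + z)"
        by (simp add: \<omega>_hc pairing_3 g_def cone_def \<alpha> \<beta>)
      finally show ?thesis by (simp add: hc_add)
    qed
    have "((\<lambda>z. z * A' (hc 0 1 0 + z *s hc 0 0 1)) has_field_derivative
        1 * A' (hc 0 1 0 + 0 *s hc 0 0 1) + pairing (DA' (hc 0 1 0 + 0 *s hc 0 0 1)) (hc 0 0 1) * 0) (at 0)"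
      by (intro DERIV_mult DERIV_ident other.deriv_on_line)
    then have "((\<lambda>z. - poly cone (r + z)) has_field_derivative poly \<alpha>' 0) (at 0)"
      by (simp add: eq other.\<alpha>)
    moreover have "((\<lambda>z. - poly cone (r + z)) has_field_derivative - (poly (pderiv cone) (r + 0) * (0 + 1))) (at 0)"
      by (intro DERIV_minus DERIV_chain'[where g = "poly cone", OF _ poly_DERIV] DERIV_add DERIV_const DERIV_ident)
    ultimately show ?thesis using DERIV_unique by fastforce
  qed
  ultimately show thesis
    using that[OF inv chart] by (simp add: other.index_def index_def)
qed

lemma (in convex_chart) index_values:
  assumes "HCS d = {1 - of_nat d, 1 / (1 - of_nat d)}" "r \<in> directions" "index r \<noteq> 1"
  shows "index r = 1 - of_nat d \<or> index r = 1 / (1 - of_nat d)"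
proof -
  obtain M A' B' DA' DB' \<alpha>' \<beta>' where chart: "convex_chart d (pull M \<omega>) A' B' DA' DB' \<alpha>' \<beta>'"
    "0 \<in> convex_chart.directions \<alpha>' \<beta>'" "convex_chart.index \<alpha>' \<beta>' 0 = 1 / index r"
    using reciprocal_chart[OF assms(2)] by metis
  have "1 / index r \<in> hom_convex_CS_values d"
    using convex_chart.index_in_CS_values[OF chart(1,2)] chart(3) by simp
  then have "index r \<in> HCS d"
    using index_in_CS_values[OF assms(2)] index_nonzero[OF assms(2)] assms(3) by (simp add: HCS_def)
  then show ?thesis using assms(1) by simp
qed

text \<open>Let p, q, t count the indices 1, 1 - d and 1 / (1 - d). Then p + q + t = d + 1 and p + q
  (1 - d) + t / (1 - d) = 1, whence t = (d - 1) (1 - q). The point r0 gives t \<ge> 1, so q = 0, t =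
  d - 1 and p = 2. The t points carry one line each, leaving 2 d lines for two points that carry at
  most d each.\<close>

lemma (in convex_chart) two_full_pencils:
  assumes d2: "d \<ge> 2" and hcs: "HCS d = {1 - of_nat d, 1 / (1 - of_nat d)}"
    and r0: "r0 \<in> directions" "index r0 = 1 / (1 - of_nat d)"
  obtains r1 r2 where "r1 \<noteq> r2" "card (lines_at r1) = d" "card (lines_at r2) = d"
proof -
  define P where "P = {r \<in> directions. index r = 1}"
  define T where "T = {r \<in> directions. index r = 1 / (1 - of_nat d)}"
  \<comment> \<open>For d = 2 the two values coincide; all such points are then counted in
    T.\<close>
  define Q where "Q = directions - P - T"
  have d1: "(1 :: complex) - of_nat d \<noteq> 0" using d2 by (metis One_nat_def Suc_1 Suc_n_not_le_n of_nat_1 of_nat_eq_iff right_minus_eq)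
  have t1: "1 / (1 - of_nat d) \<noteq> (1 :: complex)" using d2 d1 by (auto simp: divide_eq_eq)
  have fin: "finite P" "finite Q" "finite T"
    using finite_directions by (auto simp: P_def Q_def T_def)
  have dir: "directions = P \<union> (Q \<union> T)" by (auto simp: P_def Q_def T_def)
  have disj: "P \<inter> (Q \<union> T) = {}" "Q \<inter> T = {}" using t1 by (auto simp: P_def Q_def T_def)
  have sum3: "sum f directions = sum f P + (sum f Q + sum f T)" for f :: "complex \<Rightarrow> 'b :: comm_monoid_add"
    unfolding dir using disj fin by (simp add: sum.union_disjoint)
  have iQ: "index r = 1 - of_nat d" if "r \<in> Q" for r
    using index_values[OF hcs, of r] that by (auto simp: P_def Q_def T_def)
  have card3: "card P + (card Q + card T) = Suc d"
    using sum3[of "\<lambda>_. 1 :: nat"] card_directions by simp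
  have "(\<Sum>r\<in>P. index r) = of_nat (card P)"
    "(\<Sum>r\<in>Q. index r) = of_nat (card Q) * (1 - of_nat d)"
    "(\<Sum>r\<in>T. index r) = of_nat (card T) * (1 / (1 - of_nat d))"
    using iQ by (simp_all add: P_def T_def)
  then have "of_nat (card P) + (of_nat (card Q) * (1 - of_nat d) + of_nat (card T) / (1 - of_nat d)) = (1 :: complex)"
    using sum_index sum3[of index] by simp
  then have "(of_nat (card P) + (of_nat (card Q) * (1 - of_nat d) + of_nat (card T) / (1 - of_nat d))) * (1 - of_nat d) = (1 :: complex) * (1 - of_nat d)"
    by (rule arg_cong)
  then have "of_nat (card P) * (1 - of_nat d) + of_nat (card Q) * (1 - of_nat d)\<^sup>2 + of_nat (card T) = (1 - of_nat d :: complex)"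
    using d1 by (simp add: distrib_right power2_eq_square mult.assoc add.assoc)
  then have "complex_of_int (int (card P) * (1 - int d) + int (card Q) * (1 - int d)\<^sup>2 + int (card T)) = complex_of_int (1 - int d)"
    by simp
  then have eq: "int (card P) * (1 - int d) + int (card Q) * (1 - int d)\<^sup>2 + int (card T) = 1 - int d"
    by (simp only: of_int_eq_iff)
  have cardP: "int (card P) = int d + 1 - int (card Q) - int (card T)" using card3 by linarith
  \<comment> \<open>Over the integers, where the differences are not truncated; substituting for
    \<open>card P\<close> brings out the factor d.\<close>
  have "int d * ((1 - int d) * (1 - int (card Q)) + int (card T)) = 0"
    using eq unfolding cardP by (simp add: power2_eq_square algebra_simps)
  then have "(1 - int d) * (1 - int (card Q)) + int (card T) = 0"
    using d2 by (simp only: mult_eq_0_iff) simp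
  then have T: "int (card T) = (int d - 1) * (1 - int (card Q))"
    by (simp add: algebra_simps)
  have "r0 \<in> T" using r0 by (simp add: T_def)
  then have "card T \<ge> 1" using fin(3) by (metis One_nat_def Suc_leI card_gt_0_iff empty_iff)
  then have "(int d - 1) * (1 - int (card Q)) > 0" using T by linarith
  then have "card Q = 0" using d2 by (simp add: zero_less_mult_iff)
  then have "card T = d - 1" "card P = 2" using T card3 d2 by auto
  obtain r1 r2 where P: "P = {r1, r2}" "r1 \<noteq> r2" using \<open>card P = 2\<close> by (auto simp: card_2_iff)
  have "(\<Sum>r\<in>T. card (lines_at r)) = (\<Sum>r\<in>T. 1)"
    using singular_direction(5) t1 by (intro sum.cong) (auto simp: T_def)
  moreover have "Q = {}" using \<open>card Q = 0\<close> fin(2) by simp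
  ultimately have "card (lines_at r1) + card (lines_at r2) + (d - 1) = 3 * d - 1"
    using sum3[of "\<lambda>r. card (lines_at r)"] sum_lines_at P \<open>card T = d - 1\<close> by simp
  moreover have "r1 \<in> directions" "r2 \<in> directions" using P by (auto simp: P_def)
  then have "card (lines_at r1) \<le> d" "card (lines_at r2) \<le> d" using singular_direction(4) by blast+
  ultimately have "card (lines_at r1) = d" "card (lines_at r2) = d" using d2 by linarith+
  then show thesis using that P(2) by blast
qed

lemma convex_chart_of_invariant_line:
  assumes d: "d \<ge> 1" and rc: "reduced_convex_form d \<omega>"
  obtains M A B DA DB \<alpha> \<beta> where "invertible M" "convex_chart d (pull M \<omega>) A B DA DB \<alpha> \<beta>"
proof -
  have fol: "form_foliation (Suc d) \<omega>" and "card {L. invariant_line \<omega> L} = 3 * d" using rc by (simp_all add: reduced_convex_form_def)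
  then have "{L. invariant_line \<omega> L} \<noteq> {}" using d by (intro notI) simp
  then obtain l where l: "l \<noteq> 0" "invariant_line \<omega> (line l)" by (auto simp: invariant_line_def)
  obtain a b where ab: "a \<in> line l" "b \<in> line l" "cross a b \<noteq> 0" using line_has_basis[OF l(1)] .
  obtain t where t: "\<omega> (a + t *s b) \<noteq> 0" using nonsingular_point_on_line[OF fol ab(3)] .
  define g where "g = a + t *s b"
  obtain j where j: "l $ j \<noteq> 0" using l(1) by (rule nonzero_component)
  define f :: "complex^3" where "f = axis j 1"
  have lf: "pairing l f = l $ j" using exhaust_3[of j] by (auto simp: f_def pairing_3 axis_def)
  have lg: "pairing l g = 0" "pairing l b = 0" using ab by (simp_all add: g_def pairing_add pairing_scale)
  have crg: "cross g b = cross a b" by (simp add: g_def vec3_eq_iff algebra_simps)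
  define M where "M = columns3 g b f"
  obtain k where k: "l = k *s cross g b"
    using annihilator_multiple_of_cross[OF lg] crg ab(3) by auto
  have inv: "invertible M"
    unfolding M_def invertible_columns3
  proof
    assume "pairing (cross g b) f = 0"
    then have "pairing l f = 0" unfolding k by (simp only: pairing_scale_left) simp
    then show False using lf j by simp
  qed
  have "invariant_line (pull M \<omega>) (line (axis 3 1))"
  proof -
    have "transpose M *v l = l $ j *s axis 3 1"
      by (simp add: M_def transpose_columns3 lg lf vec3_eq_iff axis_def)
    then show ?thesis using pull_line_iff[OF inv, of \<omega> l] l(2) line_scale[OF j] by simp
  qed
  moreover have "pull M \<omega> (hc 1 0 0) \<noteq> 0"
  proof (rule pull_nonzero[OF inv])
    have "M *v hc 1 0 0 = g" by (simp add: M_def columns3_mult)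
    then show "\<omega> (M *v hc 1 0 0) \<noteq> 0" using t by (simp add: g_def)
  qed
  ultimately show thesis using convex_chart_exists[OF d reduced_convex_form_pull[OF rc inv]] that inv by metis
qed

lemma invertible_mult:
  fixes M N :: "complex^3^3"
  shows "invertible M \<Longrightarrow> invertible N \<Longrightarrow> invertible (M ** N)"
  by (simp add: invertible_det_nz det_mul)

text \<open>The d + 1 indices add up to 1, so they are not all 1. If the exceptional one found is 1
  - d, the chart of the other line through this point has the index 1 / (1 - d).\<close>

lemma chart_with_two_full_pencils:
  assumes d2: "d \<ge> 2" and hcs: "HCS d = {1 - of_nat d, 1 / (1 - of_nat d)}" and rc: "reduced_convex_form d \<omega>"
  obtains M A B DA DB \<alpha> \<beta> r1 r2 where "invertible M" "convex_chart d (pull M \<omega>) A B DA DB \<alpha> \<beta>"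
    "r1 \<noteq> r2" "card (convex_chart.lines_at A B r1) = d" "card (convex_chart.lines_at A B r2) = d"
proof -
  have "d \<ge> 1" using d2 by simp
  then obtain M A B DA DB \<alpha> \<beta> where M: "invertible M" "convex_chart d (pull M \<omega>) A B DA DB \<alpha> \<beta>"
    using convex_chart_of_invariant_line rc by metis
  interpret convex_chart d "pull M \<omega>" A B DA DB \<alpha> \<beta> by (rule M(2))
  have "\<exists>r\<in>directions. index r \<noteq> 1"
  proof (rule ccontr)
    assume "\<not> (\<exists>r\<in>directions. index r \<noteq> 1)"
    then have "(\<Sum>r\<in>directions. index r) = of_nat (card directions)" by simp
    then have "of_nat (Suc d) = (1 :: complex)" using sum_index card_directions by simp
    then show False using d2 by (metis of_nat_1 of_nat_eq_iff Suc_eq_plus1 add_cancel_left_left not_numeral_le_zero)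
  qed
  then obtain r where r: "r \<in> directions" "index r \<noteq> 1" by blast
  from index_values[OF hcs r] show thesis
  proof
    assume "index r = 1 / (1 - of_nat d)"
    then obtain r1 r2 where "r1 \<noteq> r2" "card (lines_at r1) = d" "card (lines_at r2) = d"
      using two_full_pencils[OF d2 hcs r(1)] by metis
    then show thesis using that M by blast
  next
    assume i: "index r = 1 - of_nat d"
    obtain N A' B' DA' DB' \<alpha>' \<beta>' where N: "invertible N" "convex_chart d (pull N (pull M \<omega>)) A' B' DA' DB' \<alpha>' \<beta>'"
      "0 \<in> convex_chart.directions \<alpha>' \<beta>'" "convex_chart.index \<alpha>' \<beta>' 0 = 1 / index r"
      using reciprocal_chart[OF r(1)] by metis
    then obtain r1 r2 where "r1 \<noteq> r2" "card (convex_chart.lines_at A' B' r1) = d" "card (convex_chart.lines_at A' B' r2) = d"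
      using convex_chart.two_full_pencils[OF N(2) d2 hcs N(3)] i by metis
    then show thesis using that[of "M ** N"] N(1,2) M(1) by (simp add: pull_pull invertible_mult)
  qed
qed

subsection \<open>Normal form\<close>

lemma form_prod:
  assumes "finite S" "\<And>a. a \<in> S \<Longrightarrow> form 1 (F a)"
  shows "form (card S) (\<lambda>p. \<Prod>a\<in>S. F a p)"
  using assms
proof (induction S rule: finite_induct)
  case empty
  then show ?case using form.const[of 1] by simp
next
  case (insert a S)
  then show ?case using form.mult[of 1 "F a"] by simp
qed

text \<open>The roots are those of X^d - X multiplied by u: zero, and u times the (d - 1)-th roots
  of unity.\<close>

lemma power_minus_linear_eq_prod:
  assumes "d \<ge> 2" "(u :: complex) \<noteq> 0"
  shows "x ^ d - u ^ (d - 1) * x = (\<Prod>w\<in>insert 0 {z. z ^ (d - 1) = u ^ (d - 1)}. x - w)"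
    and "card (insert 0 {z. z ^ (d - 1) = u ^ (d - 1)}) = d"
    and "finite {z. z ^ (d - 1) = u ^ (d - 1)}"
proof -
  let ?O = "{z. z ^ (d - 1) = u ^ (d - 1)}"
  have u: "u ^ (d - 1) \<noteq> 0" "0 < d - 1" using assms by auto
  show fin: "finite ?O" by (rule finite_nth_roots[OF u(2)])
  have "0 \<notin> ?O" using u by (simp add: power_0_left)
  moreover have "card ?O = d - 1" by (rule card_nth_roots[OF u])
  ultimately show card: "card (insert 0 ?O) = d" using fin assms(1) by simp
  define q where "q = monom 1 d - monom (u ^ (d - 1)) 1"
  have "coeff q d = 1" using assms(1) by (simp add: q_def)
  have "q = smult (coeff q d) (\<Prod>a\<in>insert 0 ?O. [:- a, 1:])"
  proof (rule poly_eq_prod_roots[OF _ card])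
    show "degree q \<le> d"
      unfolding q_def using assms(1) by (intro degree_diff_le order_trans[OF degree_monom_le]) auto
    fix a assume a: "a \<in> insert 0 ?O"
    have "a ^ d = a ^ (d - 1) * a" using assms(1) by (metis Suc_1 Suc_diff_1 Suc_leD less_le_trans power_Suc2 zero_less_Suc)
    then show "poly q a = 0" using a by (auto simp: q_def poly_monom)
  qed (use fin in simp)
  then have "poly q x = poly (\<Prod>a\<in>insert 0 ?O. [:- a, 1:]) x"
    using \<open>coeff q d = 1\<close> by (metis smult_1_left)
  then show "x ^ d - u ^ (d - 1) * x = (\<Prod>w\<in>insert 0 ?O. x - w)"
    by (simp add: q_def poly_monom poly_prod)
qed

lemma form_fermat: "d \<ge> 1 \<Longrightarrow> form (Suc d) (\<lambda>p. fermat_foliation d p $ i)"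
proof -
  assume d: "d \<ge> 1"
  have "form d (\<lambda>p. (p $ j) ^ d - p $ j * (p $ 3) ^ (d - 1))" for j :: 3
    using form_diff[OF form_coord_power[of d j] form_mult'[OF form.coord[of j] form_coord_power[of "d - 1" 3], of d]] d
    by simp
  then have 1: "form (Suc d) (\<lambda>p. p $ 3 * ((p $ j) ^ d - p $ j * (p $ 3) ^ (d - 1)))" for j :: 3
    by (rule form_coord_mult)
  have 2: "form (Suc d) (\<lambda>p. p $ 1 * (p $ 2) ^ d - p $ 2 * (p $ 1) ^ d)"
    by (intro form_diff form_coord_mult form_coord_power)
  show ?thesis
    using exhaust_3[of i] form_minus[OF 1[of 2]] 1[of 1] 2
    by (auto simp: fermat_foliation_def Let_def)
qed

lemma proj_equivalent_pull:
  assumes "invertible M" "proj_equivalent \<eta> (pull M \<omega>)"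
  shows "proj_equivalent \<eta> \<omega>"
proof -
  obtain N where N: "M ** N = mat 1" "N ** M = mat 1" "invertible N"
    using invertible_obtain_inverse[OF assms(1)] .
  obtain K c where K: "invertible K" "c \<noteq> 0"
    "\<And>p v. pairing (pull M \<omega> p) v = c * pairing (\<eta> (K *v p)) (K *v v)"
    using assms(2) unfolding proj_equivalent_def by blast
  have "pairing (\<omega> p) v = c * pairing (\<eta> ((K ** N) *v p)) ((K ** N) *v v)" for p v
  proof -
    have "pairing (pull M \<omega> (N *v p)) (N *v v) = pairing (\<omega> p) v"
      unfolding pairing_pull by (simp add: matrix_inverse_cancel[OF N(1)])
    then show ?thesis using K(3) by (simp add: matrix_vector_mul_assoc)
  qed
  then show ?thesis unfolding proj_equivalent_def using invertible_mult[OF K(1) N(3)] K(2) by blast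
qed

text \<open>The configuration of lines behind the normal form: z = 0, the d lines x = a, the d lines
  y = b, and d - 1 oblique lines y = \<tau> x + \<sigma>.\<close>

context
  fixes d :: nat and \<omega> :: "complex^3 \<Rightarrow> complex^3" and P Q :: "complex set" and T :: "(complex \<times> complex) set"
  assumes d: "d \<ge> 2" and fol: "form_foliation (Suc d) \<omega>"
    and infinity: "invariant_line \<omega> (line (axis 3 1))"
    and P: "finite P" "card P = d" "\<And>a. a \<in> P \<Longrightarrow> invariant_line \<omega> (line (hc 1 0 (- a)))"
    and Q: "finite Q" "card Q = d" "\<And>b. b \<in> Q \<Longrightarrow> invariant_line \<omega> (line (hc 0 1 (- b)))"
    and T: "card T = d - 1" "\<And>\<tau> \<sigma>. (\<tau>, \<sigma>) \<in> T \<Longrightarrow> \<tau> \<noteq> 0 \<and> invariant_line \<omega> (line (hc (- \<tau>) 1 (- \<sigma>)))"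
begin

lemma T_nonempty: "T \<noteq> {}"
  using T(1) d by (intro notI) simp

text \<open>A has degree d and vanishes on the d lines y = b, and B likewise on the lines x = a, so
  each depends on one affine variable. An oblique line ties the two products together; its leading
  coefficient shows that A0 and B0 vanish only together, when the form would be zero.\<close>

lemma fermat_normal_form_products:
  obtains A0 B0 where
    "\<And>x y. pairing (\<omega> (hc x y 1)) (hc 1 0 0) = A0 * (\<Prod>b\<in>Q. y - b)"
    "\<And>x y. pairing (\<omega> (hc x y 1)) (hc 0 1 0) = B0 * (\<Prod>a\<in>P. x - a)"
    "A0 \<noteq> 0" "B0 \<noteq> 0" "\<And>\<tau> \<sigma>. (\<tau>, \<sigma>) \<in> T \<Longrightarrow> A0 * \<tau> ^ d + \<tau> * B0 = 0"
    "\<And>\<tau> \<sigma> x. (\<tau>, \<sigma>) \<in> T \<Longrightarrow> A0 * (\<Prod>b\<in>Q. \<tau> * x + \<sigma> - b) + \<tau> * (B0 * (\<Prod>a\<in>P. x - a)) = 0"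
proof -
  obtain A B where AB: "form d A" "form d B"
    "\<And>p. \<omega> p = hc (p $ 3 * A p) (p $ 3 * B p) (- (p $ 1 * A p + p $ 2 * B p))"
    using foliation_with_invariant_line[OF fol infinity] by metis
  have \<omega>_hc: "\<omega> (hc x y z) = hc (z * A (hc x y z)) (z * B (hc x y z)) (- (x * A (hc x y z) + y * B (hc x y z)))" for x y z
    by (subst AB(3)) simp
  have AQ: "A (hc x b 1) = 0" if "b \<in> Q" for x b
  proof -
    have "hc x b 1 \<in> line (hc 0 1 (- b))" "hc 1 0 0 \<in> line (hc 0 1 (- b))" by (simp_all add: pairing_3)
    then have "pairing (\<omega> (hc x b 1)) (hc 1 0 0) = 0" using Q(3)[OF that] unfolding invariant_line_def by blast
    then show ?thesis by (simp add: \<omega>_hc pairing_3)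
  qed
  have BP: "B (hc a y 1) = 0" if "a \<in> P" for a y
  proof -
    have "hc a y 1 \<in> line (hc 1 0 (- a))" "hc 0 1 0 \<in> line (hc 1 0 (- a))" by (simp_all add: pairing_3)
    then have "pairing (\<omega> (hc a y 1)) (hc 0 1 0) = 0" using P(3)[OF that] unfolding invariant_line_def by blast
    then show ?thesis by (simp add: \<omega>_hc pairing_3)
  qed
  have TAB: "A (hc x (\<tau> * x + \<sigma>) 1) + \<tau> * B (hc x (\<tau> * x + \<sigma>) 1) = 0" if "(\<tau>, \<sigma>) \<in> T" for \<tau> \<sigma> x
  proof -
    have "hc x (\<tau> * x + \<sigma>) 1 \<in> line (hc (- \<tau>) 1 (- \<sigma>))" "hc 1 \<tau> 0 \<in> line (hc (- \<tau>) 1 (- \<sigma>))"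
      by (simp_all add: pairing_3)
    then have "pairing (\<omega> (hc x (\<tau> * x + \<sigma>) 1)) (hc 1 \<tau> 0) = 0" using T(2)[OF that] unfolding invariant_line_def by blast
    then show ?thesis by (simp add: \<omega>_hc pairing_3 mult.commute)
  qed
  define A0 B0 where "A0 = A (hc 0 1 0)" and "B0 = B (hc 1 0 0)"
  have A: "A (hc x y 1) = A0 * (\<Prod>b\<in>Q. y - b)" for x y
    using form_eq_prod_roots_on_line[OF AB(1) Q(1,2), of "hc x 0 1" "hc 0 1 0" y] AQ
    by (simp add: hc_add A0_def)
  have B: "B (hc x y 1) = B0 * (\<Prod>a\<in>P. x - a)" for x y
    using form_eq_prod_roots_on_line[OF AB(2) P(1,2), of "hc 0 y 1" "hc 1 0 0" x] BP
    by (simp add: hc_add B0_def)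
  have lin: "form 1 (\<lambda>p. p $ i - b * p $ 3)" for i :: 3 and b
    by (intro form_diff form_cmult form.coord)
  \<comment> \<open>The homogenized products are valid on z = 0 as well, where the leading
    coefficients are taken.\<close>
  have A': "A p = A0 * (\<Prod>b\<in>Q. p $ 2 - b * p $ 3)" for p
    by (rule form_eqI[OF AB(1)]) (use form_cmult[OF form_prod[OF Q(1) lin], of A0] Q(2) in \<open>simp_all add: A\<close>)
  have B': "B p = B0 * (\<Prod>a\<in>P. p $ 1 - a * p $ 3)" for p
    by (rule form_eqI[OF AB(2)]) (use form_cmult[OF form_prod[OF P(1) lin], of B0] P(2) in \<open>simp_all add: B\<close>)
  have lead: "A0 * \<tau> ^ d + \<tau> * B0 = 0" if "(\<tau>, \<sigma>) \<in> T" for \<tau> \<sigma>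
  proof -
    have "form d (\<lambda>p. A p + \<tau> * B p)" by (intro form.add form_cmult AB)
    then obtain q where q: "coeff q d = A (hc 1 \<tau> 0) + \<tau> * B (hc 1 \<tau> 0)"
      "\<And>t. A (hc 0 \<sigma> 1 + t *s hc 1 \<tau> 0) + \<tau> * B (hc 0 \<sigma> 1 + t *s hc 1 \<tau> 0) = poly q t"
      using form_on_line[of d "\<lambda>p. A p + \<tau> * B p"] by blast
    have "poly q t = 0" for t
      using q(2)[of t] TAB[OF that, of t] by (simp add: hc_add algebra_simps)
    then have "q = 0" by (metis poly_all_0_iff_0)
    then show ?thesis using q(1) P(2) Q(2) by (simp add: A' B')
  qed
  obtain \<tau> \<sigma> where \<tau>: "(\<tau>, \<sigma>) \<in> T" using T_nonempty by auto
  have nz: "A0 \<noteq> 0 \<or> B0 \<noteq> 0"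
  proof (rule ccontr)
    assume "\<not> (A0 \<noteq> 0 \<or> B0 \<noteq> 0)"
    then have "A p = 0" "B p = 0" for p using A' B' by simp_all
    then have "\<omega> p = 0" for p by (simp add: AB(3) zero_hc vec3_eq_iff)
    moreover have "cross (hc 1 0 0) (hc 0 1 0) \<noteq> 0" by (simp add: vec3_eq_iff)
    ultimately show False using nonsingular_point_on_line[OF fol] by metis
  qed
  have "A0 \<noteq> 0" "B0 \<noteq> 0" using nz lead[OF \<tau>] T(2)[OF \<tau>] by auto
  then show thesis
    using that[of A0 B0] lead TAB by (simp add: \<omega>_hc pairing_3 A B)
qed

text \<open>Each oblique line maps P onto Q, and going forth along one and back along another
  permutes P. The slopes are all the solutions of \<tau>^(d - 1) = \<kappa>, so these permutations
  are the rotations by the (d - 1)-th roots of unity. A set of d points stable under them is the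
  centre together with one orbit, that is, the zero set of X^d - X up to an affine map.\<close>

lemma equivalent_to_fermat: "proj_equivalent (fermat_foliation d) \<omega>"
proof -
  obtain A0 B0 where
    A: "\<And>x y. pairing (\<omega> (hc x y 1)) (hc 1 0 0) = A0 * (\<Prod>b\<in>Q. y - b)" and
    B: "\<And>x y. pairing (\<omega> (hc x y 1)) (hc 0 1 0) = B0 * (\<Prod>a\<in>P. x - a)" and
    nz: "A0 \<noteq> 0" "B0 \<noteq> 0" and lead: "\<And>\<tau> \<sigma>. (\<tau>, \<sigma>) \<in> T \<Longrightarrow> A0 * \<tau> ^ d + \<tau> * B0 = 0" and
    prods: "\<And>\<tau> \<sigma> x. (\<tau>, \<sigma>) \<in> T \<Longrightarrow> A0 * (\<Prod>b\<in>Q. \<tau> * x + \<sigma> - b) + \<tau> * (B0 * (\<Prod>a\<in>P. x - a)) = 0"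
    using fermat_normal_form_products by metis
  have dpow: "z ^ d = z * z ^ (d - 1)" for z :: complex using d by (cases d) auto
  define \<kappa> where "\<kappa> = - B0 / A0"
  have \<kappa>0: "\<kappa> \<noteq> 0" using nz by (simp add: \<kappa>_def)
  have \<tau>pow: "\<tau> ^ (d - 1) = \<kappa>" if "(\<tau>, \<sigma>) \<in> T" for \<tau> \<sigma>
  proof -
    have "\<tau> * (A0 * \<tau> ^ (d - 1) + B0) = 0" using lead[OF that] by (simp add: dpow algebra_simps)
    then have "A0 * \<tau> ^ (d - 1) = - B0" using T(2)[OF that] by (simp add: eq_neg_iff_add_eq_0)
    then show ?thesis using nz by (simp add: \<kappa>_def field_simps)
  qed
  have bij: "bij_betw (\<lambda>x. \<tau> * x + \<sigma>) P Q" if "(\<tau>, \<sigma>) \<in> T" for \<tau> \<sigma>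
  proof -
    have inj: "inj_on (\<lambda>x. \<tau> * x + \<sigma>) P" using T(2)[OF that] by (auto intro: inj_onI)
    have "(\<lambda>x. \<tau> * x + \<sigma>) ` P \<subseteq> Q"
    proof clarify
      fix a assume "a \<in> P"
      then have "(\<Prod>b\<in>P. a - b) = 0" using P(1) by (auto simp: prod_zero_iff)
      then have "(\<Prod>b\<in>Q. \<tau> * a + \<sigma> - b) = 0" using prods[OF that, of a] nz by simp
      then show "\<tau> * a + \<sigma> \<in> Q" using Q(1) by (auto simp: prod_zero_iff)
    qed
    then have "(\<lambda>x. \<tau> * x + \<sigma>) ` P = Q"
      using card_image[OF inj] P(2) Q by (intro card_subset_eq) auto
    then show ?thesis using inj by (simp add: bij_betw_def)
  qed
  define cP cQ where "cP = (\<Sum>a\<in>P. a) / of_nat d" and "cQ = (\<Sum>b\<in>Q. b) / of_nat d"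
  \<comment> \<open>Summation over the bijection: all oblique lines pass through the pair of
    barycentres. The slope thus determines the line, and d - 1 distinct slopes exhaust the roots of
    \<kappa>.\<close>
  have center: "\<tau> * cP + \<sigma> = cQ" if "(\<tau>, \<sigma>) \<in> T" for \<tau> \<sigma>
  proof -
    have "(\<Sum>b\<in>Q. b) = (\<Sum>a\<in>P. \<tau> * a + \<sigma>)"
      using sum.reindex_bij_betw[OF bij[OF that], of "\<lambda>x. x"] by simp
    also have "\<dots> = \<tau> * (\<Sum>a\<in>P. a) + of_nat d * \<sigma>"
      by (simp add: sum.distrib sum_distrib_left P(2))
    finally show ?thesis using d by (simp add: cP_def cQ_def field_simps)
  qed
  have "inj_on fst T"
  proof (rule inj_onI, clarify)
    fix \<tau> \<sigma> \<tau>' \<sigma>' assume "(\<tau>, \<sigma>) \<in> T" "(\<tau>', \<sigma>') \<in> T" "fst (\<tau>, \<sigma>) = fst (\<tau>', \<sigma>')"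
    then show "\<tau> = \<tau>' \<and> \<sigma> = \<sigma>'" using center[of \<tau> \<sigma>] center[of \<tau>' \<sigma>'] by (auto simp: add_left_cancel)
  qed
  then have "card (fst ` T) = d - 1" using T(1) by (simp add: card_image)
  moreover have "fst ` T \<subseteq> {z. z ^ (d - 1) = \<kappa>}" using \<tau>pow by auto
  moreover have "finite {z. z ^ (d - 1) = \<kappa>}" "card {z. z ^ (d - 1) = \<kappa>} = d - 1"
    using d \<kappa>0 by (auto intro!: finite_nth_roots card_nth_roots)
  ultimately have fstT: "fst ` T = {z. z ^ (d - 1) = \<kappa>}" by (intro card_subset_eq) auto
  \<comment> \<open>Going from P to Q by slope \<tau> and back by slope \<tau> u / z is the rotation
    about x0 that takes u to z.\<close>
  have closed: "z + x0 \<in> P"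
    if xy: "\<And>\<tau> \<sigma>. (\<tau>, \<sigma>) \<in> T \<Longrightarrow> \<tau> * x0 + \<sigma> = y0" and u: "u \<noteq> 0" "u + x0 \<in> P" "z ^ (d - 1) = u ^ (d - 1)"
    for x0 y0 u z
  proof -
    obtain \<tau> \<sigma> where \<tau>: "(\<tau>, \<sigma>) \<in> T" using T_nonempty by auto
    have \<tau>0: "\<tau> \<noteq> 0" using T(2)[OF \<tau>] by simp
    have z0: "z \<noteq> 0" using u d by (intro notI) (simp add: power_0_left)
    have "(\<tau> * u / z) ^ (d - 1) = \<kappa>"
      using u z0 \<tau>pow[OF \<tau>] by (simp add: power_mult_distrib power_divide)
    then have "\<tau> * u / z \<in> fst ` T" using fstT by simp
    then obtain \<sigma>' where \<tau>': "(\<tau> * u / z, \<sigma>') \<in> T" by force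
    have "\<tau> * (u + x0) + \<sigma> \<in> Q" using bij[OF \<tau>] u(2) by (auto simp: bij_betw_def)
    then obtain a where a: "a \<in> P" "\<tau> * u / z * a + \<sigma>' = \<tau> * (u + x0) + \<sigma>"
      using bij[OF \<tau>'] by (auto simp: bij_betw_def image_iff)
    have "\<tau> * u / z * a + \<sigma>' = \<tau> * u / z * (a - x0) + y0"
    proof -
      define K where "K = \<tau> * u / z"
      have "K * x0 + \<sigma>' = y0" using xy[OF \<tau>'] by (simp add: K_def)
      then show ?thesis unfolding K_def[symmetric] by (auto simp: algebra_simps)
    qed
    moreover have "\<tau> * (u + x0) + \<sigma> = \<tau> * u + y0" using xy[OF \<tau>] by (simp add: algebra_simps)
    ultimately have "\<tau> * u / z * (a - x0) = \<tau> * u" using a(2) by simp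
    then have "\<tau> * u * (a - x0) = \<tau> * u * z" by (simp add: nonzero_divide_eq_eq[OF z0])
    then have "a - x0 = z" using \<tau>0 u(1) by simp
    then have "a = z + x0" by (simp add: algebra_simps)
    then show ?thesis using a(1) by simp
  qed
  \<comment> \<open>A common point of the oblique lines with abscissa in P. For d = 2 there is a
    single oblique line and any point of P will do; for d \<ge> 3 it is the barycentre.\<close>
  have "\<exists>x0 y0. x0 \<in> P \<and> (\<forall>\<tau> \<sigma>. (\<tau>, \<sigma>) \<in> T \<longrightarrow> \<tau> * x0 + \<sigma> = y0)"
  proof (cases "d = 2")
    case True
    obtain t where t: "T = {t}" using T(1) True by (auto simp: card_1_singleton_iff)
    have "P \<noteq> {}" using P(2) d by (intro notI) simp
    then obtain x0 where "x0 \<in> P" by blast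
    then show ?thesis using t by (cases t) auto
  next
    case False
    have "cP \<in> P"
    proof (rule ccontr)
      assume cP: "cP \<notin> P"
      have "P \<noteq> {}" using P(2) d by (intro notI) simp
      then obtain a where a: "a \<in> P" by blast
      define u where "u = a - cP"
      have u: "u \<noteq> 0" "u + cP \<in> P" using a cP by (auto simp: u_def)
      let ?O = "(\<lambda>z. z + cP) ` {z. z ^ (d - 1) = u ^ (d - 1)}"
      have sub: "?O \<subseteq> P" using closed[OF center u] by auto
      have "card ?O = card {z. z ^ (d - 1) = u ^ (d - 1)}" by (intro card_image) (simp add: inj_on_def)
      also have "\<dots> = d - 1" using u d by (intro card_nth_roots) auto
      finally have "card (P - ?O) = 1" using card_Diff_subset[OF finite_subset[OF sub P(1)] sub] P(2) d by simp
      then obtain b where b: "P - ?O = {b}" by (auto simp: card_1_singleton_iff)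
      define w where "w = b - cP"
      have "b \<in> P - ?O" using b by blast
      then have w: "w \<noteq> 0" "w + cP \<in> P" "w ^ (d - 1) \<noteq> u ^ (d - 1)"
        using cP by (auto simp: w_def image_iff)
      have "{z. z ^ (d - 1) = (1 :: complex)} \<noteq> {1}"
      proof
        assume "{z. z ^ (d - 1) = (1 :: complex)} = {1}"
        then have "card {z. z ^ (d - 1) = (1 :: complex)} = 1" by simp
        then show False using card_nth_roots[of 1 "d - 1"] d False by simp
      qed
      then obtain \<zeta> :: complex where \<zeta>: "\<zeta> ^ (d - 1) = 1" "\<zeta> \<noteq> 1" by force
      \<comment> \<open>Besides an orbit of d - 1 points, P has a single point b. Rotating b by a
        nontrivial root of unity, which exists as d - 1 \<ge> 2, stays in P outside this orbit, so b
        is fixed although it is not the centre.\<close>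
      have "\<zeta> * w + cP \<in> P" by (rule closed[OF center w(1,2)]) (use \<zeta> in \<open>auto simp: power_mult_distrib\<close>)
      moreover have "\<zeta> * w + cP \<notin> ?O" using w(3) \<zeta>(1) by (auto simp: power_mult_distrib)
      ultimately have "\<zeta> * w + cP = b" using b by blast
      then have "\<zeta> * w = w" by (simp add: w_def algebra_simps)
      then show False using \<zeta>(2) w(1) by simp
    qed
    then show ?thesis using center by blast
  qed
  then obtain x0 y0 where x0: "x0 \<in> P" and xy: "\<And>\<tau> \<sigma>. (\<tau>, \<sigma>) \<in> T \<Longrightarrow> \<tau> * x0 + \<sigma> = y0" by blast
  have "P - {x0} \<noteq> {}"
  proof
    assume "P - {x0} = {}"
    then have "card P \<le> card {x0}" by (intro card_mono) auto
    then show False using P(2) d by simp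
  qed
  then obtain a where a: "a \<in> P" "a \<noteq> x0" by blast
  define u where "u = a - x0"
  have u: "u \<noteq> 0" "u + x0 \<in> P" using a by (simp_all add: u_def)
  define O' where "O' = insert 0 {z. z ^ (d - 1) = u ^ (d - 1)}"
  note O' = power_minus_linear_eq_prod[OF d u(1), folded O'_def]
  have finO: "finite O'" using O'(3) by (simp add: O'_def)
  have PO: "(\<lambda>w. w + x0) ` O' = P"
  proof (rule card_subset_eq[OF P(1)])
    show "(\<lambda>w. w + x0) ` O' \<subseteq> P" using closed[OF xy u] x0 by (auto simp: O'_def)
    show "card ((\<lambda>w. w + x0) ` O') = card P" using O'(2) P(2) by (subst card_image) (auto simp: inj_on_def)
  qed
  obtain \<tau> \<sigma> where \<tau>: "(\<tau>, \<sigma>) \<in> T" using T_nonempty by auto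
  have \<tau>0: "\<tau> \<noteq> 0" using T(2)[OF \<tau>] by simp
  have udpow: "u ^ d = u * u ^ (d - 1)" by (rule dpow)
  have prodP: "(\<Prod>a\<in>P. x0 + u * X - a) = u ^ d * (X ^ d - X)" for X
  proof -
    have "(\<Prod>a\<in>P. x0 + u * X - a) = (\<Prod>w\<in>O'. u * X - w)"
      unfolding PO[symmetric] by (subst prod.reindex) (auto simp: inj_on_def algebra_simps)
    also have "\<dots> = (u * X) ^ d - u ^ (d - 1) * (u * X)" by (rule O'(1)[symmetric])
    finally show ?thesis by (simp add: udpow power_mult_distrib algebra_simps)
  qed
  \<comment> \<open>The product over Q is carried over from the one over P along one oblique
    line.\<close>
  have prodQ: "A0 * (\<Prod>b\<in>Q. y0 + \<tau> * u * Y - b) = - (\<tau> * B0 * u ^ d * (Y ^ d - Y))" for Y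
  proof -
    have "\<tau> * (x0 + u * Y) + \<sigma> = y0 + \<tau> * u * Y" using xy[OF \<tau>] by (simp add: algebra_simps)
    then have "A0 * (\<Prod>b\<in>Q. y0 + \<tau> * u * Y - b) + \<tau> * (B0 * (u ^ d * (Y ^ d - Y))) = 0"
      using prods[OF \<tau>, of "x0 + u * Y"] by (simp add: prodP)
    then show ?thesis by (simp add: eq_neg_iff_add_eq_0 mult.assoc)
  qed
  \<comment> \<open>The substitution x = x0 + u X, y = y0 + \<tau> u Y. The factor \<tau> between
    the scales makes both components acquire the same constant c.\<close>
  define M where "M = columns3 (hc u 0 0) (hc 0 (\<tau> * u) 0) (hc x0 y0 1)"
  define c where "c = \<tau> * B0 * u ^ d * u"
  have inv: "invertible M"
    using u(1) \<tau>0 by (simp add: M_def invertible_columns3 pairing_3)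
  have c0: "c \<noteq> 0" using nz u \<tau>0 by (simp add: c_def)
  have M: "M *v hc X Y 1 = hc (x0 + u * X) (y0 + \<tau> * u * Y) 1" for X Y
    by (simp add: M_def columns3_mult vec3_eq_iff algebra_simps)
  have pull: "pull M \<omega> p = c *s fermat_foliation d p" for p
  proof -
    have fp: "form_foliation (Suc d) (pull M \<omega>)" by (rule form_foliation_pull[OF fol inv])
    have eq: "pull M \<omega> (hc X Y 1) = c *s fermat_foliation d (hc X Y 1)" for X Y
    proof -
      let ?w = "\<omega> (hc (x0 + u * X) (y0 + \<tau> * u * Y) 1)"
      have "pull M \<omega> (hc X Y 1) $ 1 = u * pairing ?w (hc 1 0 0)"
        using M[of X Y] by (simp add: M_def pull_columns3 pairing_3)
      then have 1: "pull M \<omega> (hc X Y 1) $ 1 = - (c * (Y ^ d - Y))"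
        unfolding A prodQ by (simp add: c_def algebra_simps)
      have "pull M \<omega> (hc X Y 1) $ 2 = \<tau> * u * pairing ?w (hc 0 1 0)"
        using M[of X Y] by (simp add: M_def pull_columns3 pairing_3)
      then have 2: "pull M \<omega> (hc X Y 1) $ 2 = c * (X ^ d - X)"
        unfolding B prodP by (simp add: c_def algebra_simps)
      have "pairing (pull M \<omega> (hc X Y 1)) (hc X Y 1) = 0" by (rule form_foliation_radial[OF fp])
      then have "pull M \<omega> (hc X Y 1) $ 3 = c * (Y ^ d - Y) * X - c * (X ^ d - X) * Y"
        by (simp add: pairing_3 1 2 eq_neg_iff_add_eq_0 algebra_simps)
      then show ?thesis
        using 1 2 by (simp add: vec3_eq_iff fermat_foliation_def Let_def algebra_simps)
    qed
    have "pull M \<omega> p $ i = c * fermat_foliation d p $ i" for i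
    proof (rule form_eqI[OF form_foliation_form[OF fp]])
      show "form (Suc d) (\<lambda>p. c * fermat_foliation d p $ i)" using d by (intro form_cmult form_fermat) simp
    qed (simp add: eq)
    then show ?thesis by (simp add: vec_eq_iff)
  qed
  have "proj_equivalent (fermat_foliation d) (pull M \<omega>)"
    unfolding proj_equivalent_def using c0
    by (intro exI[of _ "mat 1"] exI[of _ c]) (simp add: pull pairing_scale_left invertible_def)
  then show ?thesis by (rule proj_equivalent_pull[OF inv])
qed

end

text \<open>With [r1:1:0] and [r2:1:0] as the new points at infinity of the axes, the line (r, s)
  gets the covector (r1 - r, r2 - r, -s): it is vertical for r = r2, horizontal for r = r1 and
  oblique otherwise. There remain 3 d - 1 - 2 d = d - 1 oblique lines.\<close>

lemma (in convex_chart) equivalent_to_fermat_if_two_full_pencils: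
  assumes d2: "d \<ge> 2" and r: "r1 \<noteq> r2" "card (lines_at r1) = d" "card (lines_at r2) = d"
  shows "proj_equivalent (fermat_foliation d) \<omega>"
proof -
  define M where "M = columns3 (hc r1 1 0) (hc r2 1 0) (hc 0 0 1)"
  have inv: "invertible M" using r(1) by (simp add: M_def invertible_columns3 pairing_3)
  have line_iff: "invariant_line (pull M \<omega>) (line (hc (r1 - r) (r2 - r) (- s))) \<longleftrightarrow> (r, s) \<in> other_lines" for r s
  proof -
    have "transpose M *v hc 1 (- r) (- s) = hc (r1 - r) (r2 - r) (- s)"
      by (simp add: M_def transpose_columns3 pairing_3)
    then show ?thesis using pull_line_iff[OF inv, of \<omega> "hc 1 (- r) (- s)"] invariant_other_line_iff by simp
  qed
  have r12: "r1 - r2 \<noteq> 0" "r2 - r1 \<noteq> 0" using r(1) by auto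
  show ?thesis
  proof (rule proj_equivalent_pull[OF inv], rule equivalent_to_fermat[OF d2 form_foliation_pull[OF fol inv]])
    have "transpose M *v axis 3 1 = axis 3 1"
      by (simp add: M_def transpose_columns3 pairing_3 axis_def vec3_eq_iff)
    then show "invariant_line (pull M \<omega>) (line (axis 3 1))"
      using pull_line_iff[OF inv, of \<omega> "axis 3 1"] invariant_axis3 by simp
  next
    let ?P = "(\<lambda>s. s / (r1 - r2)) ` lines_at r2"
    show "finite ?P" using finite_lines_at by simp
    show "card ?P = d" using r r12 by (subst card_image) (auto simp: inj_on_def)
    fix a assume "a \<in> ?P"
    then obtain s where s: "(r2, s) \<in> other_lines" "a = s / (r1 - r2)" by (auto simp: lines_at_def)
    have "hc (r1 - r2) (r2 - r2) (- s) = (r1 - r2) *s hc 1 0 (- a)"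
      using s r12 by (simp add: hc_scale)
    then show "invariant_line (pull M \<omega>) (line (hc 1 0 (- a)))"
      using line_iff[of r2 s] s line_scale[OF r12(1)] by simp
  next
    let ?Q = "(\<lambda>s. s / (r2 - r1)) ` lines_at r1"
    show "finite ?Q" using finite_lines_at by simp
    show "card ?Q = d" using r r12 by (subst card_image) (auto simp: inj_on_def)
    fix b assume "b \<in> ?Q"
    then obtain s where s: "(r1, s) \<in> other_lines" "b = s / (r2 - r1)" by (auto simp: lines_at_def)
    have "hc (r1 - r1) (r2 - r1) (- s) = (r2 - r1) *s hc 0 1 (- b)"
      using s r12 by (simp add: hc_scale)
    then show "invariant_line (pull M \<omega>) (line (hc 0 1 (- b)))"
      using line_iff[of r1 s] s line_scale[OF r12(2)] by simp
  next
    define S where "S = {(r, s) \<in> other_lines. r \<noteq> r1 \<and> r \<noteq> r2}"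
    let ?T = "(\<lambda>(r, s). ((r - r1) / (r2 - r), s / (r2 - r))) ` S"
    have "other_lines = S \<union> (Pair r1 ` lines_at r1 \<union> Pair r2 ` lines_at r2)"
      by (auto simp: S_def lines_at_def)
    moreover have "finite S" by (rule finite_subset[OF _ finite_other_lines]) (auto simp: S_def)
    moreover have "S \<inter> (Pair r1 ` lines_at r1 \<union> Pair r2 ` lines_at r2) = {}"
      "Pair r1 ` lines_at r1 \<inter> Pair r2 ` lines_at r2 = {}" using r(1) by (auto simp: S_def)
    ultimately have "card other_lines = card S + (card (lines_at r1) + card (lines_at r2))"
      using finite_lines_at by (simp add: card_Un_disjoint card_image inj_on_def)
    then have "card S = d - 1" using r(2,3) card_other_lines d2 by linarith
    moreover have "inj_on (\<lambda>(r, s). ((r - r1) / (r2 - r), s / (r2 - r))) S"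
    proof (rule inj_onI, clarify)
      fix r s r' s' assume S: "(r, s) \<in> S" "(r', s') \<in> S"
        and eq: "(r - r1) / (r2 - r) = (r' - r1) / (r2 - r')" "s / (r2 - r) = s' / (r2 - r')"
      have nz: "r2 - r \<noteq> 0" "r2 - r' \<noteq> 0" using S by (auto simp: S_def)
      then have "(r - r1) * (r2 - r') = (r' - r1) * (r2 - r)" using eq(1) by (simp add: frac_eq_eq)
      then have "(r2 - r1) * (r - r') = 0" by (simp add: algebra_simps)
      then have "r = r'" using r12 by simp
      then show "r = r' \<and> s = s'" using eq(2) nz by simp
    qed
    ultimately show "card ?T = d - 1" by (simp add: card_image)
    fix \<tau> \<sigma> assume "(\<tau>, \<sigma>) \<in> ?T"
    then obtain r s where rs: "(r, s) \<in> S" "\<tau> = (r - r1) / (r2 - r)" "\<sigma> = s / (r2 - r)" by auto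
    have nz: "r2 - r \<noteq> 0" "r - r1 \<noteq> 0" and l: "(r, s) \<in> other_lines" using rs(1) by (auto simp: S_def)
    have "hc (r1 - r) (r2 - r) (- s) = (r2 - r) *s hc (- \<tau>) 1 (- \<sigma>)"
      using rs nz by (simp add: hc_scale)
    then show "\<tau> \<noteq> 0 \<and> invariant_line (pull M \<omega>) (line (hc (- \<tau>) 1 (- \<sigma>)))"
      using line_iff[of r s] l line_scale[OF nz(1)] rs nz by simp
  qed
qed


subsection \<open>The Fermat foliation\<close>

lemma fermat_hc:
  "fermat_foliation d (hc x y z) =
     hc (- (z * (y ^ d - y * z ^ (d - 1)))) (z * (x ^ d - x * z ^ (d - 1))) (x * y ^ d - y * x ^ d)"
  by (simp add: fermat_foliation_def Let_def)

lemma fixed_powers: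
  assumes "d \<ge> 2"
  shows "finite {z :: complex. z ^ d = z}" "card {z :: complex. z ^ d = z} = d"
proof -
  have "z ^ d = z * z ^ (d - 1)" for z :: complex using assms by (cases d) auto
  then have "{z :: complex. z ^ d = z} = insert 0 {z. z ^ (d - 1) = 1 ^ (d - 1)}"
    by (auto simp: power_0_left)
  then show "finite {z :: complex. z ^ d = z}" "card {z :: complex. z ^ d = z} = d"
    using power_minus_linear_eq_prod(2,3)[OF assms, of 1] by simp_all
qed

lemma form_foliation_fermat:
  assumes d: "d \<ge> 2"
  shows "form_foliation (Suc d) (fermat_foliation d)"
  unfolding form_foliation_def
proof (intro conjI allI)
  show "form (Suc d) (\<lambda>p. fermat_foliation d p $ i)" for i using d by (intro form_fermat) simp
  show "pairing (fermat_foliation d p) p = 0" for p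
    by (simp add: fermat_foliation_def Let_def pairing_3 algebra_simps)
  let ?Z = "{z :: complex. z ^ d = z}"
  have *: "point p \<in> (\<lambda>(a, b). point (hc a b 1)) ` (?Z \<times> ?Z) \<or> point p \<in> (\<lambda>a. point (hc a 1 0)) ` ?Z \<or>
      point p = point (hc 1 0 0)" if p: "p \<noteq> 0" "fermat_foliation d p = 0" for p
  proof -
    obtain x y z where xyz: "p = hc x y z" using vector3_eta[of p] by metis
    have eqs: "z * (y ^ d - y * z ^ (d - 1)) = 0" "z * (x ^ d - x * z ^ (d - 1)) = 0" "x * y ^ d = y * x ^ d"
      using p(2) by (simp_all add: xyz fermat_hc vec3_eq_iff)
    have same: "point p = point q" if "p = c *s q" "c \<noteq> 0" for c q
    proof -
      have "q \<noteq> 0" using that p(1) by auto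
      then show ?thesis using point_eq_iff[of q p] p(1) that by blast
    qed
    show ?thesis
    proof (cases "z = 0")
      case False
      have *: "(w / z) ^ d = w / z" if "z * (w ^ d - w * z ^ (d - 1)) = 0" for w
      proof -
        have "z ^ d = z * z ^ (d - 1)" using d by (cases d) auto
        then show ?thesis using that False by (simp add: power_divide field_simps)
      qed
      have "p = z *s hc (x / z) (y / z) 1" using False by (simp add: xyz hc_scale)
      then have "point p = point (hc (x / z) (y / z) 1)" using same False by blast
      then show ?thesis using *[OF eqs(1)] *[OF eqs(2)] by force
    next
      case z: True
      show ?thesis
      proof (cases "y = 0")
        case True
        then have "p = x *s hc 1 0 0" "x \<noteq> 0" using p(1) z by (auto simp: xyz hc_scale zero_hc)
        then show ?thesis using same by blast
      next
        case False
        have "(x / y) ^ d = x / y" using eqs(3) False by (simp add: power_divide field_simps)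
        moreover have "p = y *s hc (x / y) 1 0" using False z by (simp add: xyz hc_scale)
        then have "point p = point (hc (x / y) 1 0)" using same False by blast
        ultimately show ?thesis by force
      qed
    qed
  qed
  have "{point p | p. p \<noteq> 0 \<and> fermat_foliation d p = 0} \<subseteq>
    (\<lambda>(a, b). point (hc a b 1)) ` (?Z \<times> ?Z) \<union> ((\<lambda>a. point (hc a 1 0)) ` ?Z \<union> {point (hc 1 0 0)})"
    (is "?S \<subseteq> ?U \<union> (?V \<union> ?W)")
  proof
    fix R assume "R \<in> ?S"
    then obtain p where p: "R = point p" "p \<noteq> 0" "fermat_foliation d p = 0" by blast
    show "R \<in> ?U \<union> (?V \<union> ?W)" using *[OF p(2,3)] unfolding p(1) by blast
  qed
  then show "finite {point p | p. p \<noteq> 0 \<and> fermat_foliation d p = 0}"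
    by (rule finite_subset) (intro finite_UnI finite_imageI finite_cartesian_product fixed_powers[OF d] finite.intros)
qed

lemma fermat_invariant_lines:
  assumes d: "d \<ge> 2"
  shows "invariant_line (fermat_foliation d) (line (hc 0 0 1))"
    and "invariant_line (fermat_foliation d) (line (hc 1 0 (- a))) \<longleftrightarrow> a ^ d = a"
    and "invariant_line (fermat_foliation d) (line (hc 0 1 (- a))) \<longleftrightarrow> a ^ d = a"
    and "\<tau> \<noteq> 0 \<Longrightarrow> invariant_line (fermat_foliation d) (line (hc (- \<tau>) 1 (- \<sigma>))) \<longleftrightarrow> \<sigma> = 0 \<and> \<tau> ^ (d - 1) = 1"
proof -
  have pw: "z ^ d = z * z ^ (d - 1)" for z :: complex using d by (cases d) auto
  have span: "line (hc a b c) = vec.span {u, v}"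
    if "pairing (hc a b c) u = 0" "pairing (hc a b c) v = 0" "cross u v \<noteq> 0" "hc a b c \<noteq> 0" for a b c u v
    using line_eq_span[OF that(4), of u v] that by simp
  have cr: "cross (hc 1 0 0) (hc 0 1 0) \<noteq> 0" "cross (hc 0 1 0) (hc a 0 1) \<noteq> 0"
    "cross (hc 1 0 0) (hc 0 a 1) \<noteq> 0" "cross (hc 1 \<tau> 0) (hc 0 \<sigma> 1) \<noteq> 0"
    by (simp_all add: vec3_eq_iff)
  have "line (hc 0 0 1) = vec.span {hc 1 0 0, hc 0 1 0}"
    by (rule span) (simp_all add: pairing_3 vec3_eq_iff)
  then show "invariant_line (fermat_foliation d) (line (hc 0 0 1))"
    using invariant_line_span_iff[OF cr(1)] by (simp add: hc_scale hc_plus fermat_hc pairing_3)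
  show "invariant_line (fermat_foliation d) (line (hc 1 0 (- a))) \<longleftrightarrow> a ^ d = a"
  proof -
    have "line (hc 1 0 (- a)) = vec.span {hc 0 1 0, hc a 0 1}"
      by (rule span) (simp_all add: pairing_3 vec3_eq_iff)
    moreover have "pairing (fermat_foliation d (s *s hc 0 1 0 + t *s hc a 0 1)) (hc 0 1 0) = t * t ^ d * (a ^ d - a)"
      "pairing (fermat_foliation d (s *s hc 0 1 0 + t *s hc a 0 1)) (hc a 0 1) = s * t ^ d * (a - a ^ d)" for s t
      by (simp_all add: hc_scale hc_plus fermat_hc pairing_3 power_mult_distrib pw[of t] algebra_simps)
    ultimately have "invariant_line (fermat_foliation d) (line (hc 1 0 (- a))) \<longleftrightarrow>
        (\<forall>s t. t * t ^ d * (a ^ d - a) = 0 \<and> s * t ^ d * (a - a ^ d) = 0)"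
      using invariant_line_span_iff[OF cr(2)] by simp
    then show ?thesis by (auto dest: spec[of _ 1])
  qed
  show "invariant_line (fermat_foliation d) (line (hc 0 1 (- a))) \<longleftrightarrow> a ^ d = a"
  proof -
    have "line (hc 0 1 (- a)) = vec.span {hc 1 0 0, hc 0 a 1}"
      by (rule span) (simp_all add: pairing_3 vec3_eq_iff)
    moreover have "pairing (fermat_foliation d (s *s hc 1 0 0 + t *s hc 0 a 1)) (hc 1 0 0) = t * t ^ d * (a - a ^ d)"
      "pairing (fermat_foliation d (s *s hc 1 0 0 + t *s hc 0 a 1)) (hc 0 a 1) = s * t ^ d * (a ^ d - a)" for s t
      by (simp_all add: hc_scale hc_plus fermat_hc pairing_3 power_mult_distrib pw[of t] algebra_simps)
    ultimately have "invariant_line (fermat_foliation d) (line (hc 0 1 (- a))) \<longleftrightarrow>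
        (\<forall>s t. t * t ^ d * (a - a ^ d) = 0 \<and> s * t ^ d * (a ^ d - a) = 0)"
      using invariant_line_span_iff[OF cr(3)] by simp
    then show ?thesis by (auto dest: spec[of _ 1])
  qed
  assume \<tau>: "\<tau> \<noteq> 0"
  have sp: "line (hc (- \<tau>) 1 (- \<sigma>)) = vec.span {hc 1 \<tau> 0, hc 0 \<sigma> 1}"
    by (rule span) (simp_all add: pairing_3 vec3_eq_iff)
  have pt: "s *s hc 1 \<tau> 0 + t *s hc 0 \<sigma> 1 = hc s (s * \<tau> + t * \<sigma>) t" for s t
    by (simp add: hc_scale hc_plus)
  show "invariant_line (fermat_foliation d) (line (hc (- \<tau>) 1 (- \<sigma>))) \<longleftrightarrow> \<sigma> = 0 \<and> \<tau> ^ (d - 1) = 1"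
  proof
    assume "invariant_line (fermat_foliation d) (line (hc (- \<tau>) 1 (- \<sigma>)))"
    then have "pairing (fermat_foliation d (hc s (s * \<tau> + 1 * \<sigma>) 1)) (hc 1 \<tau> 0) = 0" for s
      unfolding sp invariant_line_span_iff[OF cr(4)] pt by blast
    then have *: "(s * \<tau> + \<sigma>) ^ d = \<sigma> + \<tau> * s ^ d" for s
      by (simp add: fermat_hc pairing_3 algebra_simps)
    have "poly ([:\<sigma>, \<tau>:] ^ d) s = poly ([:\<sigma>:] + monom \<tau> d) s" for s
      using *[of s] by (simp add: poly_monom algebra_simps)
    then have eq: "[:\<sigma>, \<tau>:] ^ d = [:\<sigma>:] + monom \<tau> d"
      by (simp add: poly_eq_poly_eq_iff[symmetric] fun_eq_iff)
    \<comment> \<open>The coefficients of s^d and s^(d - 1) are compared in (\<tau> s + \<sigma>)^d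
      = \<sigma> + \<tau> s^d. Since d - 1 \<ge> 1, the constant \<sigma> contributes to neither,
      and the second comparison forces \<sigma> = 0.\<close>
    have c0: "coeff [:\<sigma>:] k = 0" if "k \<ge> 1" for k using that by (cases k) auto
    have "coeff ([:\<sigma>, \<tau>:] ^ d) d = \<tau>" unfolding eq using c0[of d] d by simp
    then have "\<tau> ^ d = \<tau>" by (simp add: coeff_linear_poly_power)
    then have 1: "\<tau> ^ (d - 1) = 1" using \<tau> by (simp add: pw)
    have "coeff ([:\<sigma>, \<tau>:] ^ d) (d - 1) = 0" unfolding eq using c0[of "d - 1"] d by simp
    then have "of_nat (d choose (d - 1)) * \<sigma> = 0"
      using d \<tau> by (auto simp: coeff_linear_poly_power)
    moreover have "d choose (d - 1) \<noteq> 0" by (simp add: binomial_eq_0_iff)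
    ultimately show "\<sigma> = 0 \<and> \<tau> ^ (d - 1) = 1" using 1 by simp
  next
    assume *: "\<sigma> = 0 \<and> \<tau> ^ (d - 1) = 1"
    then have \<tau>d: "\<tau> ^ d = \<tau>" by (simp add: pw)
    show "invariant_line (fermat_foliation d) (line (hc (- \<tau>) 1 (- \<sigma>)))"
      unfolding sp invariant_line_span_iff[OF cr(4)] pt using *
      by (simp add: fermat_hc pairing_3 power_mult_distrib \<tau>d algebra_simps)
  qed
qed

text \<open>The count is 1 + d + d + (d - 1). The covectors in N are normalized, so that distinct
  ones are not proportional.\<close>

lemma card_fermat_invariant_lines:
  assumes d: "d \<ge> 2"
  shows "card {L. invariant_line (fermat_foliation d) L} = 3 * d"
proof -
  let ?Z = "{z :: complex. z ^ d = z}" and ?R = "{z :: complex. z ^ (d - 1) = 1}"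
  let ?N1 = "(\<lambda>a. hc 1 0 (- a)) ` ?Z" and ?N2 = "(\<lambda>a. hc 0 1 (- a)) ` ?Z" and ?N3 = "(\<lambda>\<tau>. hc (- \<tau>) 1 0) ` ?R"
  define N where "N = insert (hc 0 0 1) (?N1 \<union> (?N2 \<union> ?N3))"
  \<comment> \<open>Slope 0 is excluded from the oblique lines, so y = 0 is counted only among the
    horizontal ones.\<close>
  have R0: "0 \<notin> ?R" using d by (simp add: power_0_left)
  have fin: "finite ?Z" "finite ?R" using fixed_powers(1)[OF d] finite_nth_roots[of "d - 1" 1] d by auto
  have "card ?N1 = d" "card ?N2 = d"
    using fixed_powers(2)[OF d] by (simp_all add: card_image inj_on_def vec3_eq_iff)
  moreover have "card ?N3 = d - 1"
    using card_nth_roots[of 1 "d - 1"] d by (subst card_image) (auto simp: inj_on_def vec3_eq_iff)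
  moreover have "?N2 \<inter> ?N3 = {}" using R0 by (auto simp: vec3_eq_iff)
  moreover have "?N1 \<inter> (?N2 \<union> ?N3) = {}" by (auto simp: vec3_eq_iff)
  moreover have "hc 0 0 1 \<notin> ?N1 \<union> (?N2 \<union> ?N3)" by (auto simp: vec3_eq_iff)
  ultimately have "card N = 3 * d"
    unfolding N_def using fin d by (simp add: card_Un_disjoint)
  have "inj_on line N"
  proof (rule inj_onI)
    fix l l' assume l: "l \<in> N" "l' \<in> N" "line l = line l'"
    then have "l \<noteq> 0" "l' \<noteq> 0" by (auto simp: N_def vec3_eq_iff)
    then obtain c where c: "c \<noteq> 0" "l' = c *s l" using line_eq_imp_multiple[OF l(3)] by blast
    show "l = l'" using l(1,2) c R0 unfolding N_def by (auto simp: vec3_eq_iff)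
  qed
  have N3: "invariant_line (fermat_foliation d) (line (hc (- \<tau>) 1 0))" if "\<tau> ^ (d - 1) = 1" for \<tau>
    using fermat_invariant_lines(4)[OF d, of \<tau> 0] R0 that by (cases "\<tau> = 0") auto
  have "{L. invariant_line (fermat_foliation d) L} = line ` N"
  proof (intro set_eqI iffI)
    fix L assume "L \<in> {L. invariant_line (fermat_foliation d) L}"
    then have inv: "invariant_line (fermat_foliation d) L" by simp
    then obtain l where l: "l \<noteq> 0" "L = line l" by (auto simp: invariant_line_def)
    have scale: "L = line m" if "l = c *s m" "c \<noteq> 0" for c m using that l(2) line_scale by metis
    show "L \<in> line ` N"
    proof (cases "l $ 2 = 0")
      case True
      show ?thesis
      proof (cases "l $ 1 = 0")
        case True
        then have "l = l $ 3 *s hc 0 0 1" "l $ 3 \<noteq> 0" using \<open>l $ 2 = 0\<close> l(1) by (auto simp: vec3_eq_iff)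
        then show ?thesis using scale by (simp add: N_def)
      next
        case False
        define a where "a = - l $ 3 / l $ 1"
        have "l = l $ 1 *s hc 1 0 (- a)" using False True by (simp add: vec3_eq_iff a_def)
        then have L: "L = line (hc 1 0 (- a))" using scale False by blast
        then have "a ^ d = a" using inv fermat_invariant_lines(2)[OF d] by simp
        then show ?thesis unfolding L N_def by blast
      qed
    next
      case False
      define \<tau> \<sigma> where "\<tau> = - l $ 1 / l $ 2" and "\<sigma> = - l $ 3 / l $ 2"
      have "l = l $ 2 *s hc (- \<tau>) 1 (- \<sigma>)" using False by (simp add: vec3_eq_iff \<tau>_def \<sigma>_def)
      then have L: "L = line (hc (- \<tau>) 1 (- \<sigma>))" using scale False by blast
      show ?thesis
      proof (cases "\<tau> = 0")
        case True
        then have "\<sigma> ^ d = \<sigma>" using inv L fermat_invariant_lines(3)[OF d] by simp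
        moreover have "L = line (hc 0 1 (- \<sigma>))" using L True by simp
        ultimately show ?thesis unfolding N_def by blast
      next
        case False
        then have "\<sigma> = 0" "\<tau> ^ (d - 1) = 1" using inv L fermat_invariant_lines(4)[OF d False] by simp_all
        moreover from this have "L = line (hc (- \<tau>) 1 0)" using L by simp
        ultimately show ?thesis unfolding N_def by blast
      qed
    qed
  next
    fix L assume "L \<in> line ` N"
    then show "L \<in> {L. invariant_line (fermat_foliation d) L}"
      using fermat_invariant_lines(1-3)[OF d] N3[unfolded One_nat_def] by (auto simp: N_def)
  qed
  then show ?thesis using card_image[OF \<open>inj_on line N\<close>] \<open>card N = 3 * d\<close> by simp
qed

theorem corollaryE:
  fixes d :: nat
  assumes "d \<ge> 2"
    and "HCS d = {1 - of_nat d, 1 / (1 - of_nat d)}"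
  shows "reduced_convex d (fermat_foliation d) \<and>
    (\<forall>\<omega>. reduced_convex d \<omega> \<longrightarrow> proj_equivalent (fermat_foliation d) \<omega>)"
proof (intro conjI allI impI)
  show "reduced_convex d (fermat_foliation d)"
    using form_foliation_fermat card_fermat_invariant_lines assms(1)
    by (simp add: reduced_convex_iff reduced_convex_form_def)
next
  fix \<omega> assume "reduced_convex d \<omega>"
  then have "reduced_convex_form d \<omega>" by (simp add: reduced_convex_iff)
  then obtain M A B DA DB \<alpha> \<beta> r1 r2 where *: "invertible M" "convex_chart d (pull M \<omega>) A B DA DB \<alpha> \<beta>"
    "r1 \<noteq> r2" "card (convex_chart.lines_at A B r1) = d" "card (convex_chart.lines_at A B r2) = d"
    using chart_with_two_full_pencils[OF assms] by metis
  show "proj_equivalent (fermat_foliation d) \<omega>"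
    using convex_chart.equivalent_to_fermat_if_two_full_pencils[OF *(2) assms(1) *(3-5)] *(1)
    by (rule proj_equivalent_pull[rotated])
qed

end
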